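(* Let $u$ be the Gaussian random field defined in the context. Fix $M>0$ and $t_0\in(0,T]$. There exist positive constants $c_5,c_6$, depending on $\alpha,d,t_0,H,M,T$, such that for any $t,s\in[t_0,T]$ and $x,y\in[-M,M]^d$, $$c_5\,\Theta(t,s,x,y)\le\|u(t,x)-u(s,y)\|_{L^2(\Omega)}^2\le c_6\,\Theta(t,s,x,y),$$ where $$\Theta(t,s,x,y)=|t-s|^{2H-\frac{d-\alpha}{2}}+\left(\log\frac{2e\sqrt d\,M}{|x-y|}\right)^{\beta}|x-y|^{2\wedge(4H-(d-\alpha))},$$ with $\beta=1$ if $4H-(d-\alpha)=2$ and $\beta=0$ otherwise. The upper bound holds for any $t,s\in[0,T]$.
   Context: Let $d\ge1$, $T>0$, $H\in(1/2,1)$ and $\alpha\in[0,d)$ with $0<d-\alpha<4H$. Let $f$ be a non-negative definite tempered distribution on $\mathbb{R}^d$ given by an absolutely continuous measure $f(x)dx$, or $f=\delta_{\{0\}}$ (spatially white noise, case $\alpha=0$). Its spectral measure $\mu(d\xi)=(\mathcal{F}^{-1}f)(\xi)d\xi$ (non-negative, tempered, symmetric; the normalization of the Fourier transform is immaterial) is assumed to satisfy $\mu(d\xi)\asymp|\xi|^{-\alpha}d\xi$, i.e. for constants $0<k_1\le k_2$ and every non-negative measurable $h$, $k_1\int h(\xi)|\xi|^{-\alpha}d\xi\le\int h\,d\mu\le k_2\int h(\xi)|\xi|^{-\alpha}d\xi$. Constants may also depend on $k_1,k_2$. $W^{H,\alpha}$ is the centred Gaussian field with $E(W^{H,\alpha}(t,A)W^{H,\alpha}(s,B))=\frac12(t^{2H}+s^{2H}-|t-s|^{2H})\int_A\int_B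 f(z-w)\,dz\,dw$. With $G(t,x)=(4\pi t)^{-d/2}\exp(-|x|^2/(4t))$ for $t>0$, let $$u(t,x)=\int_0^t\int_{\mathbb{R}^d}G(t-s,x-y)\,W^{H,\alpha}(ds,dy)$$ (Wiener integral), the solution of $\partial_tu=\Delta u+\dot W^{H,\alpha}$ with zero initial condition. Thus $u$ is centred Gaussian with $$E(u(t,x)u(s,y))=H(2H-1)\int_0^td\tau\int_0^sd\sigma\,|\tau-\sigma|^{2H-2}\int_{\mathbb{R}^d}dz\int_{\mathbb{R}^d}dw\,f(z-w)G(t-\tau,x-z)G(s-\sigma,y-w).$$ When $x=y$ the expression $(\log\frac{2e\sqrt dM}{|x-y|})^\beta|x-y|^{2\wedge(4H-(d-\alpha))}$ is read as $0$. *)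

theory Defs
  imports "HOL-Probability.Probability"
begin

section \<open>Tempered measures and the spectral measure\<close>

fun iter_deriv :: "'a::euclidean_space list \<Rightarrow> ('a \<Rightarrow> 'b::real_normed_vector) \<Rightarrow> 'a \<Rightarrow> 'b" where
  "iter_deriv [] \<phi> = \<phi>"
| "iter_deriv (b # bs) \<phi> = (\<lambda>x. frechet_derivative (iter_deriv bs \<phi>) (at x) b)"

definition schwartz :: "('a::euclidean_space \<Rightarrow> complex) \<Rightarrow> bool" where
  "schwartz \<phi> \<longleftrightarrow>
     (\<forall>bs. set bs \<subseteq> Basis \<longrightarrow>
        (\<forall>x. iter_deriv bs \<phi> differentiable (at x)) \<and>
        (\<forall>k::nat. bounded (range (\<lambda>x. (norm x ^ k) *\<^sub>R iter_deriv bs \<phi> x))))"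

definition fourier :: "('a::euclidean_space \<Rightarrow> complex) \<Rightarrow> 'a \<Rightarrow> complex" where
  "fourier \<phi> \<xi> = (LINT x|lborel. exp (- (\<i> * complex_of_real (x \<bullet> \<xi>))) * \<phi> x)"

definition tempered_measure :: "'a::euclidean_space measure \<Rightarrow> bool" where
  "tempered_measure \<Lambda> \<longleftrightarrow>
     sets \<Lambda> = sets borel \<and>
     (\<exists>k::nat. (\<integral>\<^sup>+ x. ennreal (1 / (1 + norm x) ^ k) \<partial>\<Lambda>) < \<infinity>)"

definition nonneg_definite :: "'a::euclidean_space measure \<Rightarrow> bool" where
  "nonneg_definite \<Lambda> \<longleftrightarrow>
     (\<forall>\<phi>. schwartz \<phi> \<longrightarrow>
        (LINT x|\<Lambda>. (LINT y|lborel. \<phi> (x + y) * cnj (\<phi> y))) \<in> \<real>\<^sub>\<ge>\<^sub>0)"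

text \<open>
  The spatial correlation \<open>f\<close> is represented by the measure it defines: \<open>f(x) dx\<close> with a
  nonnegative density, or the Dirac mass at the origin (only for \<open>\<alpha> = 0\<close>).
\<close>
definition spatial_correlation :: "real \<Rightarrow> 'a::euclidean_space measure \<Rightarrow> bool" where
  "spatial_correlation \<alpha> \<Lambda> \<longleftrightarrow>
     ((\<exists>f \<in> borel_measurable borel. (\<forall>x. 0 \<le> (f x :: real)) \<and> \<Lambda> = density lborel (\<lambda>x. ennreal (f x)))
       \<or> (\<alpha> = 0 \<and> \<Lambda> = return borel 0)) \<and>
     tempered_measure \<Lambda> \<and> nonneg_definite \<Lambda>"

text \<open>
  \<open>\<mu>\<close> is the inverse Fourier transform of \<open>\<Lambda>\<close> in the sense of tempered distributions:
  \<open>\<langle>\<Lambda>, \<phi>\<rangle> = \<langle>\<mu>, \<F> \<phi>\<rangle>\<close> for every Schwartz function. The factor \<open>(2 \<pi>)\<close> to the power \<open>- d\<close>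
  is absorbed in \<open>\<mu>\<close>.
\<close>
definition spectral_measure :: "'a::euclidean_space measure \<Rightarrow> 'a measure \<Rightarrow> bool" where
  "spectral_measure \<Lambda> \<mu> \<longleftrightarrow>
     (\<exists>g \<in> borel_measurable borel. (\<forall>\<xi>. 0 \<le> (g \<xi> :: real)) \<and> \<mu> = density lborel (\<lambda>\<xi>. ennreal (g \<xi>))) \<and>
     tempered_measure \<mu> \<and>
     distr \<mu> borel uminus = \<mu> \<and>
     (\<forall>\<phi>. schwartz \<phi> \<longrightarrow> (LINT x|\<Lambda>. \<phi> x) = (LINT \<xi>|\<mu>. fourier \<phi> \<xi>))"

definition riesz_comparable :: "real \<Rightarrow> real \<Rightarrow> real \<Rightarrow> 'a::euclidean_space measure \<Rightarrow> bool" where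
  "riesz_comparable \<alpha> k1 k2 \<mu> \<longleftrightarrow>
     (\<forall>h \<in> borel_measurable borel.
        ennreal k1 * (\<integral>\<^sup>+ \<xi>. h \<xi> * ennreal (norm \<xi> powr (- \<alpha>)) \<partial>lborel) \<le> (\<integral>\<^sup>+ \<xi>. h \<xi> \<partial>\<mu>) \<and>
        (\<integral>\<^sup>+ \<xi>. h \<xi> \<partial>\<mu>) \<le> ennreal k2 * (\<integral>\<^sup>+ \<xi>. h \<xi> * ennreal (norm \<xi> powr (- \<alpha>)) \<partial>lborel))"

section \<open>The fractional-coloured Gaussian noise\<close>

text \<open>
  The measure \<open>f(z - w) dz dw\<close> on pairs \<open>(z, w)\<close>. Written as an image measure it also makes
  sense for the Dirac mass, where it is Lebesgue measure on the diagonal.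
\<close>
definition pair_correlation :: "'a::euclidean_space measure \<Rightarrow> ('a \<times> 'a) measure" where
  "pair_correlation \<Lambda> = distr (\<Lambda> \<Otimes>\<^sub>M lborel) (borel \<Otimes>\<^sub>M borel) (\<lambda>(v, w). (v + w, w))"

definition fractional_covariance :: "real \<Rightarrow> real \<Rightarrow> real \<Rightarrow> real" where
  "fractional_covariance H t s =
     (t powr (2 * H) + s powr (2 * H) - \<bar>t - s\<bar> powr (2 * H)) / 2"

text \<open>The elementary functions \<open>\<Sum> c 1\<^sub>[\<^sub>0\<^sub>,\<^sub>t\<^sub>]\<^sub>\<times>\<^sub>A\<close> are encoded by the lists of the triples \<open>(c, t, A)\<close>.\<close>

type_synonym 'a elementary = "(real \<times> real \<times> 'a set) list"

definition elementary :: "real \<Rightarrow> 'a::euclidean_space elementary \<Rightarrow> bool" where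
  "elementary T l \<longleftrightarrow> (\<forall>(c, t, A) \<in> set l. 0 \<le> t \<and> t \<le> T \<and> A \<in> sets borel \<and> bounded A)"

definition elem_fun :: "'a elementary \<Rightarrow> real \<Rightarrow> 'a \<Rightarrow> real" where
  "elem_fun l \<tau> z = (\<Sum>(c, t, A)\<leftarrow>l. c * indicat_real {0..t} \<tau> * indicat_real A z)"

definition elem_integral ::
    "(real \<Rightarrow> 'a set \<Rightarrow> 'w \<Rightarrow> real) \<Rightarrow> 'a elementary \<Rightarrow> 'w \<Rightarrow> real" where
  "elem_integral W l \<omega> = (\<Sum>(c, t, A)\<leftarrow>l. c * W t A \<omega>)"

text \<open>Zero variance is allowed.\<close>
definition centred_gaussian :: "'w measure \<Rightarrow> ('w \<Rightarrow> real) \<Rightarrow> bool" where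
  "centred_gaussian P X \<longleftrightarrow>
     X \<in> borel_measurable P \<and>
     ((AE \<omega> in P. X \<omega> = 0) \<or>
      (\<exists>\<sigma>>0. distributed P lborel X (\<lambda>x. ennreal (normal_density 0 \<sigma> x))))"

definition gaussian_noise ::
    "'w measure \<Rightarrow> real \<Rightarrow> real \<Rightarrow> 'a::euclidean_space measure \<Rightarrow>
     (real \<Rightarrow> 'a set \<Rightarrow> 'w \<Rightarrow> real) \<Rightarrow> bool" where
  "gaussian_noise P T H \<Lambda> W \<longleftrightarrow>
     (\<forall>l. elementary T l \<longrightarrow> centred_gaussian P (elem_integral W l)) \<and>
     (\<forall>t \<in> {0..T}. \<forall>s \<in> {0..T}. \<forall>A \<in> sets borel. \<forall>B \<in> sets borel. bounded A \<longrightarrow> bounded B \<longrightarrow>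
        (LINT \<omega>|P. W t A \<omega> * W s B \<omega>) =
          fractional_covariance H t s * measure (pair_correlation \<Lambda>) (A \<times> B))"

section \<open>Wiener integrals and the stochastic heat equation\<close>

definition energy_integrand ::
    "real \<Rightarrow> (real \<Rightarrow> 'a \<Rightarrow> real) \<Rightarrow> (real \<times> real) \<times> ('a \<times> 'a) \<Rightarrow> real" where
  "energy_integrand H g = (\<lambda>((\<tau>, \<sigma>), (z, w)). \<bar>\<tau> - \<sigma>\<bar> powr (2 * H - 2) * g \<tau> z * g \<sigma> w)"

definition energy_measure :: "'a::euclidean_space measure \<Rightarrow> ((real \<times> real) \<times> ('a \<times> 'a)) measure" where
  "energy_measure \<Lambda> = (lborel \<Otimes>\<^sub>M lborel) \<Otimes>\<^sub>M pair_correlation \<Lambda>"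

definition finite_energy ::
    "real \<Rightarrow> 'a::euclidean_space measure \<Rightarrow> (real \<Rightarrow> 'a \<Rightarrow> real) \<Rightarrow> bool" where
  "finite_energy H \<Lambda> g \<longleftrightarrow>
     case_prod g \<in> borel_measurable (borel \<Otimes>\<^sub>M borel) \<and>
     integrable (energy_measure \<Lambda>) (energy_integrand H g)"

text \<open>
  The squared norm of the canonical Hilbert space of the noise, i.e.\ the quadratic form with
  value \<open>E((\<integral>g dW)\<^sup>2)\<close> on elementary functions.
\<close>
definition energy :: "real \<Rightarrow> 'a::euclidean_space measure \<Rightarrow> (real \<Rightarrow> 'a \<Rightarrow> real) \<Rightarrow> real" where
  "energy H \<Lambda> g = H * (2 * H - 1) * integral\<^sup>L (energy_measure \<Lambda>) (energy_integrand H g)"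

definition L2_norm :: "'w measure \<Rightarrow> ('w \<Rightarrow> real) \<Rightarrow> real" where
  "L2_norm P X = sqrt (LINT \<omega>|P. (X \<omega>)\<^sup>2)"

text \<open>
  \<open>X\<close> is (a version of) the Wiener integral of \<open>g\<close> with respect to \<open>W\<close>: the \<open>L\<^sup>2\<close> limit of the
  integrals of elementary functions converging to \<open>g\<close> in the energy norm. Since the Bochner
  integral of a nonintegrable function is 0, finiteness of the energies is demanded explicitly.
\<close>
definition wiener_integral ::
    "'w measure \<Rightarrow> real \<Rightarrow> real \<Rightarrow> 'a::euclidean_space measure \<Rightarrow>
     (real \<Rightarrow> 'a set \<Rightarrow> 'w \<Rightarrow> real) \<Rightarrow> (real \<Rightarrow> 'a \<Rightarrow> real) \<Rightarrow> ('w \<Rightarrow> real) \<Rightarrow> bool" where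
  "wiener_integral P T H \<Lambda> W g X \<longleftrightarrow>
     finite_energy H \<Lambda> g \<and>
     X \<in> borel_measurable P \<and> integrable P (\<lambda>\<omega>. (X \<omega>)\<^sup>2) \<and>
     (\<exists>l :: nat \<Rightarrow> 'a elementary.
        (\<forall>n. elementary T (l n)) \<and>
        (\<forall>n. finite_energy H \<Lambda> (\<lambda>\<tau> z. elem_fun (l n) \<tau> z - g \<tau> z)) \<and>
        (\<lambda>n. energy H \<Lambda> (\<lambda>\<tau> z. elem_fun (l n) \<tau> z - g \<tau> z)) \<longlonglongrightarrow> 0 \<and>
        (\<lambda>n. L2_norm P (\<lambda>\<omega>. elem_integral W (l n) \<omega> - X \<omega>)) \<longlonglongrightarrow> 0)"

definition heat_kernel :: "real \<Rightarrow> 'a::euclidean_space \<Rightarrow> real" where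
  "heat_kernel t x =
     (4 * pi * t) powr (- real DIM('a) / 2) * exp (- (norm x)\<^sup>2 / (4 * t))"

definition heat_solution ::
    "'w measure \<Rightarrow> real \<Rightarrow> real \<Rightarrow> 'a::euclidean_space measure \<Rightarrow>
     (real \<Rightarrow> 'a set \<Rightarrow> 'w \<Rightarrow> real) \<Rightarrow> (real \<Rightarrow> 'a \<Rightarrow> 'w \<Rightarrow> real) \<Rightarrow> bool" where
  "heat_solution P T H \<Lambda> W u \<longleftrightarrow>
     (\<forall>t \<in> {0..T}. \<forall>x.
        wiener_integral P T H \<Lambda> W
          (\<lambda>s y. if 0 \<le> s \<and> s < t then heat_kernel (t - s) (x - y) else 0) (u t x))"

section \<open>The canonical metric\<close>

definition \<Theta> ::
    "real \<Rightarrow> real \<Rightarrow> real \<Rightarrow> real \<Rightarrow> real \<Rightarrow> real ^ 'n \<Rightarrow> real ^ 'n \<Rightarrow> real" where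
  "\<Theta> H \<alpha> M t s x y =
     (let d = real CARD('n);
          \<gamma> = 4 * H - (d - \<alpha>);
          \<beta> = (if \<gamma> = 2 then 1 else 0 :: nat)
      in \<bar>t - s\<bar> powr (2 * H - (d - \<alpha>) / 2) +
         (if x = y then 0
          else (ln (2 * exp 1 * sqrt d * M / norm (x - y))) ^ \<beta> * norm (x - y) powr (min 2 \<gamma>)))"

end

theory Submission
  imports Defs "HOL-Real_Asymp.Real_Asymp"
begin

text \<open>
  The energy is positive semidefinite: on elementary functions it is the second moment of the noise,
  and these are dense enough. Hence its square root is a seminorm, the Wiener integral is an isometry,
  and the squared increment of \<open>u\<close> is the energy of the difference of two heat kernels. The heat kernel
  is a Schwartz function, so this energy can be computed from the spectral measure; with
  \<open>A\<^sub>t\<^sub>s(\<xi>) = \<integral>\<integral> \<bar>\<tau> - \<sigma>\<bar>\<^sup>2\<^sup>H\<^sup>-\<^sup>2 e\<^sub>t(\<tau>) e\<^sub>s(\<sigma>) d\<tau> d\<sigma>\<close> and \<open>e\<^sub>t(r) = 1\<^sub>[\<^sub>0\<^sub>,\<^sub>t\<^sub>)(r) exp (- \<bar>\<xi>\<bar>\<^sup>2 (t - r))\<close> it is a constant times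
  \<open>\<integral> (A\<^sub>t\<^sub>t + A\<^sub>s\<^sub>s - 2 A\<^sub>t\<^sub>s cos (\<xi> \<bullet> (x - y))) d\<mu>\<close>. Since \<open>A\<^sub>t\<^sub>s \<ge> 0\<close>, the increment dominates the purely temporal
  increment \<open>\<integral> (A\<^sub>t\<^sub>t + A\<^sub>s\<^sub>s - 2 A\<^sub>t\<^sub>s) d\<mu>\<close>, and by the triangle inequality it is then comparable to the sum of
  that one and the purely spatial increment \<open>2 \<integral> A\<^sub>s\<^sub>s (1 - cos (\<xi> \<bullet> (x - y))) d\<mu>\<close>.

  For the upper bounds, \<open>A(\<phi>, \<phi>)\<close> is at most a constant times \<open>L\<^sup>2\<^sup>H\<close> if \<open>\<bar>\<phi>\<bar> \<le> 1\<close> has \<open>L\<^sup>1\<close> norm \<open>\<le> L\<close>; the norm of \<open>e\<^sub>t - e\<^sub>s\<close> is at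
  most \<open>2 min \<bar>t - s\<bar> \<bar>\<xi>\<bar>\<^sup>-\<^sup>2\<close> and that of \<open>e\<^sub>s\<close> at most \<open>min s \<bar>\<xi>\<bar>\<^sup>-\<^sup>2\<close>. For the lower bounds, \<open>A\<^sub>t\<^sub>t\<close> is of order
  \<open>(min t \<bar>\<xi>\<bar>\<^sup>-\<^sup>2)\<^sup>2\<^sup>H\<close>, and \<open>A\<^sub>t\<^sub>s\<close> is negligible once \<open>\<bar>\<xi>\<bar>\<^sup>2 \<bar>t - s\<bar>\<close> is large.
\<close>

section \<open>The heat kernel\<close>

text \<open>Two obstacles shape the argument. Finite energy is given for one function at a time, and
  a divergent Bochner integral is 0, so the energy cannot be treated as bilinear, let alone as a
  squared seminorm, until cross terms are integrable. Positivity is therefore proved first, by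
  truncation, and it then bounds the cross terms. The second obstacle is oscillation: with cosines
  under the spectral integral, Fubini would need absolute integrability. The spectral computations
  run in \<open>ennreal\<close>, with \<open>1 - cos\<close> on the side where every term is
  nonnegative; subtraction waits until the finite energies of the heat kernels have made the terms
  finite. The constants are chosen before \<Lambda>, \<mu> and the probability space, so \<mu>
  enters the estimates only through \<open>k1\<close> and \<open>k2\<close>, and integrals with
  explicit powers of |\<xi>| remain. In them a time lag \<delta> matches the frequency
  \<delta>^(-1/2) and a distance \<rho> the frequency 1/\<rho>; both exponents of
  \<open>\<Theta>\<close> are read off from this scaling.\<close>

lemma heat_kernel_prod:
  fixes x :: "'a::euclidean_space"
  assumes "0 < c"
  shows "heat_kernel c x = (\<Prod>b\<in>Basis. normal_density 0 (sqrt (2 * c)) (x \<bullet> b))"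
proof -
  have "(\<Prod>b\<in>(Basis::'a set). normal_density 0 (sqrt (2 * c)) (x \<bullet> b))
      = (\<Prod>b\<in>(Basis::'a set). (4 * pi * c) powr (- 1 / 2) * exp (- (x \<bullet> b)\<^sup>2 / (4 * c)))"
    using assms by (intro prod.cong refl) (simp add: normal_density_def powr_minus powr_half_sqrt field_simps)
  also have "\<dots> = ((4 * pi * c) powr (- 1 / 2)) ^ DIM('a) * exp (\<Sum>b\<in>(Basis::'a set). - (x \<bullet> b)\<^sup>2 / (4 * c))"
    by (simp add: prod.distrib exp_sum)
  also have "((4 * pi * c) powr (- 1 / 2)) ^ DIM('a) = (4 * pi * c) powr (- real DIM('a) / 2)"
    using assms by (subst powr_realpow[symmetric]) (auto simp: powr_powr)
  also have "(\<Sum>b\<in>(Basis::'a set). - (x \<bullet> b)\<^sup>2 / (4 * c)) = - (norm x)\<^sup>2 / (4 * c)"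
  proof -
    have "(norm x)\<^sup>2 = (\<Sum>b\<in>(Basis::'a set). (x \<bullet> b)\<^sup>2)"
      unfolding power2_norm_eq_inner euclidean_inner[of x x] by (simp add: power2_eq_square)
    then show ?thesis by (simp add: sum_divide_distrib sum_negf)
  qed
  finally show ?thesis by (simp add: heat_kernel_def)
qed

lemma heat_kernel_nonneg [simp]: "0 \<le> heat_kernel c x"
  by (simp add: heat_kernel_def)

lemma heat_kernel_measurable [measurable]: "heat_kernel c \<in> borel_measurable borel"
  unfolding heat_kernel_def by measurable

text \<open>The kernel at time c is a product of centred normal densities of variance 2c, so the
  semigroup law reduces to the additivity of variances under convolution, coordinate by
  coordinate.\<close>

lemma nn_integral_heat_kernel_conv:
  fixes u :: "'a::euclidean_space"
  assumes "0 < a" "0 < b"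
  shows "(\<integral>\<^sup>+w. ennreal (heat_kernel a (u - w) * heat_kernel b w) \<partial>lborel) = ennreal (heat_kernel (a + b) u)"
proof -
  have "(\<integral>\<^sup>+w. ennreal (heat_kernel a (u - w) * heat_kernel b w) \<partial>lborel)
     = (\<integral>\<^sup>+w. (\<Prod>i\<in>Basis. ennreal (normal_density 0 (sqrt (2 * a)) (u \<bullet> i - w \<bullet> i) * normal_density 0 (sqrt (2 * b)) (w \<bullet> i))) \<partial>(lborel::'a measure))"
    using assms by (intro nn_integral_cong) (simp add: heat_kernel_prod prod_ennreal prod.distrib inner_diff_left)
  also have "\<dots> = (\<Prod>i\<in>(Basis::'a set). \<integral>\<^sup>+w. ennreal (normal_density 0 (sqrt (2 * a)) (u \<bullet> i - w) * normal_density 0 (sqrt (2 * b)) w) \<partial>lborel)"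
    by (subst nn_integral_lborel_prod[symmetric]) auto
  also have "\<dots> = (\<Prod>i\<in>(Basis::'a set). ennreal (normal_density 0 (sqrt (2 * (a + b))) (u \<bullet> i)))"
  proof (intro prod.cong refl)
    fix i
    show "(\<integral>\<^sup>+w. ennreal (normal_density 0 (sqrt (2 * a)) (u \<bullet> i - w) * normal_density 0 (sqrt (2 * b)) w) \<partial>lborel)
       = ennreal (normal_density 0 (sqrt (2 * (a + b))) (u \<bullet> i))"
      using conv_normal_density_zero_mean[of "sqrt (2*a)" "sqrt (2*b)"] assms
      by (auto dest!: fun_cong[where x="u \<bullet> i"] simp: distrib_left)
  qed
  also have "\<dots> = ennreal (heat_kernel (a + b) u)"
    using assms by (simp add: prod_ennreal heat_kernel_prod)
  finally show ?thesis .
qed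

lemma nn_integral_lborel_shift_reflect:
  fixes h :: "'a::euclidean_space" and F :: "'a \<Rightarrow> ennreal"
  assumes [measurable]: "F \<in> borel_measurable borel"
  shows "(\<integral>\<^sup>+w. F (h - w) \<partial>lborel) = (\<integral>\<^sup>+w. F w \<partial>lborel)"
proof -
  have "lborel = density (distr lborel borel (\<lambda>x. h + (-1) *\<^sub>R x)) (\<lambda>_. \<bar>-1::real\<bar> ^ DIM('a))"
    by (rule lborel_affine) simp
  then have "lborel = distr lborel borel (\<lambda>x. h - x)"
    by (simp add: density_1)
  then have "(\<integral>\<^sup>+w. F w \<partial>lborel) = (\<integral>\<^sup>+w. F w \<partial>distr lborel borel (\<lambda>x. h - x))" by simp
  then show ?thesis by (simp add: nn_integral_distr)
qed

text \<open>The inner integral of the energy in the coordinates v = z - w and w: integrating out the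
  base point w leaves a single kernel of the total elapsed time in v, and that is a test function to
  which the spectral measure applies.\<close>

lemma nn_integral_heat_kernel_semigroup:
  fixes x y :: "'a::euclidean_space"
  assumes "0 < a" "0 < b"
  shows "(\<integral>\<^sup>+w. ennreal (heat_kernel a (x - (v + w)) * heat_kernel b (y - w)) \<partial>lborel)
       = ennreal (heat_kernel (a + b) (x - y - v))"
proof -
  have "(\<integral>\<^sup>+w. ennreal (heat_kernel a (x - (v + w)) * heat_kernel b (y - w)) \<partial>lborel)
     = (\<integral>\<^sup>+w. ennreal (heat_kernel a (x - (v + (y - w))) * heat_kernel b w) \<partial>lborel)"
    by (subst nn_integral_lborel_shift_reflect[of "\<lambda>w. ennreal (heat_kernel a (x - (v + w)) * heat_kernel b (y - w))" y, symmetric]) auto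
  also have "\<dots> = (\<integral>\<^sup>+w. ennreal (heat_kernel a (v + y - x - w) * heat_kernel b w) \<partial>lborel)"
    by (intro nn_integral_cong) (simp add: heat_kernel_def norm_minus_commute algebra_simps)
  also have "\<dots> = ennreal (heat_kernel (a + b) (v + y - x))"
    by (rule nn_integral_heat_kernel_conv[OF assms])
  also have "heat_kernel (a + b) (v + y - x) = heat_kernel (a + b) (x - y - v)"
    by (simp add: heat_kernel_def norm_minus_commute[of "v + y" x] algebra_simps)
  finally show ?thesis .
qed

text \<open>Rescaling by \<open>sqrt (2 * c)\<close> reduces this to the characteristic function of
  the standard normal law; the minus sign in the phase matches the convention of
  \<open>fourier\<close>.\<close>

lemma char_normal:
  assumes "0 < c"
  shows "(CLBINT u. exp (- (\<i> * complex_of_real (u * z))) * complex_of_real (normal_density 0 (sqrt (2 * c)) u))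
     = complex_of_real (exp (- c * z\<^sup>2))"
    and "integrable lborel (\<lambda>u. exp (- (\<i> * complex_of_real (u * z))) * complex_of_real (normal_density 0 (sqrt (2 * c)) u))"
proof -
  let ?s = "sqrt (2 * c)"
  have s: "?s > 0" using assms by simp
  show "integrable lborel (\<lambda>u. exp (- (\<i> * complex_of_real (u * z))) * complex_of_real (normal_density 0 (sqrt (2 * c)) u))"
  proof (rule Bochner_Integration.integrable_bound[where f="normal_density 0 ?s"])
    show "AE x in lborel. norm (exp (- (\<i> * complex_of_real (x * z))) * complex_of_real (normal_density 0 ?s x)) \<le> norm (normal_density 0 ?s x)"
      by (auto simp: norm_mult)
  qed (use s in auto)
  have "complex_of_real (exp (- (?s * z)\<^sup>2 / 2)) = char std_normal_distribution (- ?s * z)"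
    by (simp add: char_std_normal_distribution)
  also have "\<dots> = (CLBINT x. std_normal_density x *\<^sub>R iexp (- ?s * z * x))"
    unfolding char_def by (subst integral_density) auto
  also have "\<dots> = (CLBINT u. (1 / ?s) *\<^sub>R (std_normal_density (u / ?s) *\<^sub>R iexp (- z * u)))"
    using s by (subst lborel_integral_real_affine[where c="1/?s" and t=0]) (auto simp flip: integral_scaleR_right)
  also have "\<dots> = (CLBINT u. exp (- (\<i> * complex_of_real (u * z))) * complex_of_real (normal_density 0 ?s u))"
    using assms by (intro Bochner_Integration.integral_cong refl)
      (auto simp: normal_density_def scaleR_conv_of_real real_sqrt_mult field_simps power_divide simp flip: of_real_mult)
  finally show "(CLBINT u. exp (- (\<i> * complex_of_real (u * z))) * complex_of_real (normal_density 0 (sqrt (2 * c)) u))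
     = complex_of_real (exp (- c * z\<^sup>2))"
    using assms by (simp add: power_mult_distrib)
qed

lemma integral_lborel_prod:
  fixes f :: "'a::euclidean_space \<Rightarrow> real \<Rightarrow> complex"
  assumes f: "\<And>b. b \<in> Basis \<Longrightarrow> integrable lborel (f b)"
  shows "(LINT x|lborel. (\<Prod>b\<in>Basis. f b (x \<bullet> b))) = (\<Prod>b\<in>Basis. (LINT x|lborel. f b x))"
proof -
  interpret product_sigma_finite "\<lambda>_::'a. lborel :: real measure" ..
  have [measurable]: "f b \<in> borel_measurable borel" if "b \<in> Basis" for b
    using borel_measurable_integrable[OF f[OF that]] by simp
  show ?thesis
    by (subst lborel_eq, subst integral_distr) (use f in \<open>auto simp: product_integral_prod[symmetric]\<close>)
qed

text \<open>Translation by h produces the phase, evenness of the kernel absorbs the reflection, and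
  the remaining Gaussian integral factorises over the coordinates.\<close>

lemma fourier_heat_kernel:
  fixes h :: "'a::euclidean_space"
  assumes "0 < c"
  shows "fourier (\<lambda>x. complex_of_real (heat_kernel c (h - x))) \<xi>
    = exp (- (\<i> * complex_of_real (h \<bullet> \<xi>))) * complex_of_real (exp (- c * (norm \<xi>)\<^sup>2))"
proof -
  have *: "exp (- (\<i> * complex_of_real (w \<bullet> \<xi>))) * complex_of_real (heat_kernel c w)
    = (\<Prod>b\<in>Basis. exp (- (\<i> * complex_of_real (w \<bullet> b * (\<xi> \<bullet> b)))) * complex_of_real (normal_density 0 (sqrt (2 * c)) (w \<bullet> b)))" for w :: 'a
    using assms by (simp add: heat_kernel_prod euclidean_inner[of w \<xi>] prod.distrib sum_distrib_left sum_negf[symmetric] exp_sum)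
  have "fourier (\<lambda>x. complex_of_real (heat_kernel c (h - x))) \<xi> =
    (LINT x|lborel. exp (- (\<i> * complex_of_real (x \<bullet> \<xi>))) * complex_of_real (heat_kernel c (h - x)))"
    by (simp add: fourier_def)
  also have "\<dots> = (LINT x|distr lborel borel (\<lambda>w. h + w). exp (- (\<i> * complex_of_real (x \<bullet> \<xi>))) * complex_of_real (heat_kernel c (h - x)))"
    by (simp add: lborel_distr_plus)
  also have "\<dots> = (LINT w|lborel. exp (- (\<i> * complex_of_real ((h + w) \<bullet> \<xi>))) * complex_of_real (heat_kernel c (- w)))"
    by (subst integral_distr) auto
  also have "\<dots> = exp (- (\<i> * complex_of_real (h \<bullet> \<xi>))) * (LINT w|lborel. exp (- (\<i> * complex_of_real (w \<bullet> \<xi>))) * complex_of_real (heat_kernel c w))"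
    by (subst integral_mult_right_zero[symmetric], intro Bochner_Integration.integral_cong refl)
      (simp add: inner_add_left algebra_simps exp_add exp_minus heat_kernel_def exp_diff field_simps)
  also have "(LINT w|lborel. exp (- (\<i> * complex_of_real (w \<bullet> \<xi>))) * complex_of_real (heat_kernel c w))
     = (\<Prod>b\<in>(Basis::'a set). complex_of_real (exp (- c * (\<xi> \<bullet> b)\<^sup>2)))"
    unfolding * using assms by (subst integral_lborel_prod) (simp_all add: char_normal del: of_real_mult)
  also have "\<dots> = complex_of_real (exp (- c * (norm \<xi>)\<^sup>2))"
    unfolding power2_norm_eq_inner euclidean_inner[of \<xi> \<xi>]
    by (simp add: exp_sum sum_distrib_left sum_negf[symmetric] power2_eq_square flip: of_real_prod)
  finally show ?thesis .
qed

section \<open>Polynomials times Gaussians are Schwartz functions\<close>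

lemma real_polynomial_function_directional_derivative:
  fixes p :: "'a::euclidean_space \<Rightarrow> real"
  assumes "real_polynomial_function p"
  shows "\<exists>p'. real_polynomial_function (\<lambda>x. p' x b) \<and> (\<forall>x. (p has_derivative p' x) (at x))"
  using assms
proof induction
  case (linear f)
  then show ?case by (intro exI[of _ "\<lambda>_. f"]) (auto intro: bounded_linear_imp_has_derivative)
next
  case (const c)
  show ?case by (intro exI[of _ "\<lambda>_ _. 0"]) auto
next
  case (add f g)
  then obtain f' g' where "real_polynomial_function (\<lambda>x. f' x b)" "\<forall>x. (f has_derivative f' x) (at x)"
    "real_polynomial_function (\<lambda>x. g' x b)" "\<forall>x. (g has_derivative g' x) (at x)" by blast
  then show ?case by (intro exI[of _ "\<lambda>x v. f' x v + g' x v"]) (auto intro: has_derivative_add)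
next
  case (mult f g)
  then obtain f' g' where "real_polynomial_function (\<lambda>x. f' x b)" "\<forall>x. (f has_derivative f' x) (at x)"
    "real_polynomial_function (\<lambda>x. g' x b)" "\<forall>x. (g has_derivative g' x) (at x)" by blast
  with mult show ?case by (intro exI[of _ "\<lambda>x v. f x * g' x v + f' x v * g x"]) (auto intro!: has_derivative_mult)
qed

lemma real_polynomial_function_growth:
  fixes p :: "'a::euclidean_space \<Rightarrow> real"
  assumes "real_polynomial_function p"
  shows "\<exists>C m. 0 \<le> C \<and> (\<forall>x. \<bar>p x\<bar> \<le> C * (1 + norm x) ^ m)"
  using assms
proof induction
  case (linear f)
  then obtain K where K: "0 < K" "\<And>x. norm (f x) \<le> norm x * K" using bounded_linear.pos_bounded by blast
  have "\<bar>f x\<bar> \<le> K * (1 + norm x) ^ 1" for x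
  proof -
    have "\<bar>f x\<bar> \<le> K * norm x" using K(2)[of x] by (simp add: mult.commute)
    also have "\<dots> \<le> K * (1 + norm x) ^ 1" using K(1) by simp
    finally show ?thesis .
  qed
  with K(1) show ?case by (intro exI[of _ K] exI[of _ 1]) auto
next
  case (const c)
  show ?case by (intro exI[of _ "\<bar>c\<bar>"] exI[of _ 0]) auto
next
  case (add f g)
  then obtain C m C' m' where *: "0 \<le> C" "0 \<le> C'" "\<And>x. \<bar>f x\<bar> \<le> C * (1 + norm x) ^ m" "\<And>x. \<bar>g x\<bar> \<le> C' * (1 + norm x) ^ m'"
    by blast
  have "\<bar>f x + g x\<bar> \<le> (C + C') * (1 + norm x) ^ (m + m')" for x
  proof -
    have "C * (1 + norm x) ^ m \<le> C * (1 + norm x) ^ (m + m')"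
      using * by (intro mult_left_mono power_increasing) auto
    moreover have "C' * (1 + norm x) ^ m' \<le> C' * (1 + norm x) ^ (m + m')"
      using * by (intro mult_left_mono power_increasing) auto
    ultimately show ?thesis using *(3,4)[of x] by (simp add: distrib_right)
  qed
  then show ?case using * by (intro exI[of _ "C + C'"] exI[of _ "m + m'"]) auto
next
  case (mult f g)
  then obtain C m C' m' where *: "0 \<le> C" "0 \<le> C'" "\<And>x. \<bar>f x\<bar> \<le> C * (1 + norm x) ^ m" "\<And>x. \<bar>g x\<bar> \<le> C' * (1 + norm x) ^ m'"
    by blast
  have "\<bar>f x * g x\<bar> \<le> (C * (1 + norm x) ^ m) * (C' * (1 + norm x) ^ m')" for x
    unfolding abs_mult using * by (intro mult_mono) auto
  then show ?case using * by (intro exI[of _ "C * C'"] exI[of _ "m + m'"]) (auto simp: power_add mult_ac)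
qed

text \<open>Since 1 + |x| is at most exp |x|, it suffices to bound m r - a r^2 with r = |h - x|.
  Completing the square gives the constant m^2 / (4 a).\<close>

lemma gaussian_decay:
  fixes h :: "'a::euclidean_space"
  assumes "0 < a"
  shows "\<exists>B. \<forall>x. (1 + norm x) ^ m * exp (- a * (norm (h - x))\<^sup>2) \<le> B"
proof -
  have "(1 + norm x) ^ m * exp (- a * (norm (h - x))\<^sup>2) \<le> exp (m * norm h + (real m)\<^sup>2 / (4 * a))" for x :: 'a
  proof -
    have "(1 + norm x) ^ m * exp (- a * (norm (h - x))\<^sup>2) \<le> exp (norm x) ^ m * exp (- a * (norm (h - x))\<^sup>2)"
      by (intro mult_right_mono power_mono) auto
    also have "\<dots> = exp (m * norm x - a * (norm (h - x))\<^sup>2)"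
      by (simp add: exp_of_nat_mult[symmetric] exp_diff exp_minus field_simps)
    also have "\<dots> \<le> exp (m * norm h + (real m)\<^sup>2 / (4 * a))"
    proof -
      have "norm x \<le> norm h + norm (h - x)" using norm_triangle_ineq4[of h "h - x"] by simp
      then have "m * norm x \<le> m * norm h + m * norm (h - x)"
        by (metis distrib_left mult_left_mono of_nat_0_le_iff)
      moreover have "m * norm (h - x) - a * (norm (h - x))\<^sup>2 \<le> (real m)\<^sup>2 / (4 * a)"
      proof -
        have "0 \<le> (2 * a * norm (h - x) - m)\<^sup>2 / (4 * a)" using assms by auto
        also have "\<dots> = (real m)\<^sup>2 / (4 * a) - (m * norm (h - x) - a * (norm (h - x))\<^sup>2)"
          using assms by (simp add: power2_eq_square field_simps)
        finally show ?thesis by simp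
      qed
      ultimately show ?thesis by auto
    qed
    finally show ?thesis .
  qed
  then show ?thesis by blast
qed

text \<open>The Schwartz condition speaks of all iterated derivatives, so the induction needs a
  class closed under directional derivatives: each of them changes only the polynomial
  factor.\<close>

lemma iter_deriv_gaussian:
  fixes h :: "'a::euclidean_space"
  assumes p: "real_polynomial_function p"
  shows "\<exists>q. real_polynomial_function q \<and>
    iter_deriv bs (\<lambda>x. complex_of_real (p x * exp (- a * (norm (h - x))\<^sup>2))) = (\<lambda>x. complex_of_real (q x * exp (- a * (norm (h - x))\<^sup>2)))"
proof (induction bs)
  case Nil
  show ?case using p by auto
next
  case (Cons b bs)
  then obtain q where q: "real_polynomial_function q" and
    eq: "iter_deriv bs (\<lambda>x. complex_of_real (p x * exp (- a * (norm (h - x))\<^sup>2))) = (\<lambda>x. complex_of_real (q x * exp (- a * (norm (h - x))\<^sup>2)))"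
    by blast
  from real_polynomial_function_directional_derivative[OF q, of b] obtain q' where
    q': "real_polynomial_function (\<lambda>x. q' x b)" "\<And>x. (q has_derivative q' x) (at x)" by blast
  have D: "((\<lambda>x. complex_of_real (q x * exp (- a * (norm (h - x))\<^sup>2))) has_derivative
     (\<lambda>v. complex_of_real ((q' x v + q x * (2 * a * ((h - x) \<bullet> v))) * exp (- a * (norm (h - x))\<^sup>2)))) (at x)" for x
    unfolding power2_norm_eq_inner
    by (rule derivative_eq_intros q'(2) refl | simp add: algebra_simps inner_commute)+
  have "iter_deriv (b # bs) (\<lambda>x. complex_of_real (p x * exp (- a * (norm (h - x))\<^sup>2))) =
     (\<lambda>x. complex_of_real ((q' x b + q x * (2 * a * (h \<bullet> b - x \<bullet> b))) * exp (- a * (norm (h - x))\<^sup>2)))"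
    unfolding iter_deriv.simps eq by (subst frechet_derivative_at[OF D, symmetric]) (simp add: inner_diff_left)
  moreover have "real_polynomial_function (\<lambda>x. q' x b + q x * (2 * a * (h \<bullet> b - x \<bullet> b)))"
    by (intro real_polynomial_function.intros(3,4) real_polynomial_function_diff q' q
        real_polynomial_function.intros(1,2) bounded_linear_inner_left)
  ultimately show ?case by (intro exI conjI)
qed

lemma schwartz_gaussian:
  fixes h :: "'a::euclidean_space"
  assumes a: "0 < a" and p: "real_polynomial_function p"
  shows "schwartz (\<lambda>x. complex_of_real (p x * exp (- a * (norm (h - x))\<^sup>2)))"
  unfolding schwartz_def
proof (intro allI impI conjI)
  fix bs :: "'a list" and k :: nat and x
  obtain q where q: "real_polynomial_function q" and
    eq: "iter_deriv bs (\<lambda>x. complex_of_real (p x * exp (- a * (norm (h - x))\<^sup>2))) = (\<lambda>x. complex_of_real (q x * exp (- a * (norm (h - x))\<^sup>2)))"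
    using iter_deriv_gaussian[OF p] by blast
  \<comment> \<open>The direction 0 is a dummy; only the differentiability of \<open>q\<close> is
    extracted.\<close>
  from real_polynomial_function_directional_derivative[OF q, of 0] obtain q' where
    q': "\<And>x. (q has_derivative q' x) (at x)" by blast
  have "\<exists>D. ((\<lambda>x. complex_of_real (q x * exp (- a * (norm (h - x))\<^sup>2))) has_derivative D) (at x)"
    unfolding power2_norm_eq_inner
    by (rule exI derivative_eq_intros q' refl)+
  then show "iter_deriv bs (\<lambda>x. complex_of_real (p x * exp (- a * (norm (h - x))\<^sup>2))) differentiable at x"
    unfolding eq differentiable_def .
  obtain C m where C: "0 \<le> C" "\<And>x. \<bar>q x\<bar> \<le> C * (1 + norm x) ^ m"
    using real_polynomial_function_growth[OF q] by blast
  obtain B where B: "\<And>x. (1 + norm x) ^ (k + m) * exp (- a * (norm (h - x))\<^sup>2) \<le> B"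
    using gaussian_decay[OF a] by metis
  show "bounded (range (\<lambda>x. norm x ^ k *\<^sub>R iter_deriv bs (\<lambda>x. complex_of_real (p x * exp (- a * (norm (h - x))\<^sup>2))) x))"
    unfolding eq bounded_iff
  proof (intro exI[of _ "C * B"] ballI, clarify)
    fix x
    have "norm (norm x ^ k *\<^sub>R complex_of_real (q x * exp (- a * (norm (h - x))\<^sup>2)))
       = norm x ^ k * (\<bar>q x\<bar> * exp (- a * (norm (h - x))\<^sup>2))"
      by (simp add: norm_mult abs_mult)
    also have "\<dots> \<le> (1 + norm x) ^ k * ((C * (1 + norm x) ^ m) * exp (- a * (norm (h - x))\<^sup>2))"
      using C by (intro mult_mono power_mono) auto
    also have "\<dots> = C * ((1 + norm x) ^ (k + m) * exp (- a * (norm (h - x))\<^sup>2))"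
      by (simp add: power_add)
    also have "\<dots> \<le> C * B" using C B by (intro mult_left_mono) auto
    finally show "norm (norm x ^ k *\<^sub>R complex_of_real (q x * exp (- a * (norm (h - x))\<^sup>2))) \<le> C * B" .
  qed
qed

lemma schwartz_heat_kernel:
  fixes h :: "'a::euclidean_space"
  assumes "0 < c"
  shows "schwartz (\<lambda>x. complex_of_real (heat_kernel c (h - x)))"
proof -
  have "schwartz (\<lambda>x. complex_of_real ((4 * pi * c) powr (- real DIM('a) / 2) * exp (- (1 / (4 * c)) * (norm (h - x))\<^sup>2)))"
    using assms by (intro schwartz_gaussian) auto
  then show ?thesis by (simp add: heat_kernel_def)
qed

section \<open>The fractional kernel in time\<close>

lemma DERIV_abs_powr:
  fixes u q :: real
  assumes "u \<noteq> 0"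
  shows "((\<lambda>u. \<bar>u\<bar> powr q) has_real_derivative q * (sgn u * \<bar>u\<bar> powr (q - 1))) (at u)"
proof (cases "u > 0")
  case True
  have "((\<lambda>u. u powr q) has_real_derivative q * u powr (q - 1)) (at u)"
    using True by (rule has_real_derivative_powr)
  then have "((\<lambda>u. \<bar>u\<bar> powr q) has_real_derivative q * u powr (q - 1)) (at u)"
    by (rule has_field_derivative_transform_within_open[of _ _ _ "{0<..}"]) (use True in auto)
  with True show ?thesis by simp
next
  case False
  with assms have u: "u < 0" by simp
  have "((\<lambda>u. (- u) powr q) has_real_derivative q * (- ((- u) powr (q - 1)))) (at u)"
    using u by (auto intro!: derivative_eq_intros simp: powr_diff field_simps)
  then have "((\<lambda>u. \<bar>u\<bar> powr q) has_real_derivative q * (- ((- u) powr (q - 1)))) (at u)"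
    by (rule has_field_derivative_transform_within_open[of _ _ _ "{..<0}"]) (use u in auto)
  with u show ?thesis by simp
qed

text \<open>The odd power is a primitive of a multiple of the even kernel on both sides of the
  singularity, so integrals across it need no case split on the position of the singular
  point.\<close>

lemma DERIV_sgn_abs_powr:
  fixes u q :: real
  assumes "u \<noteq> 0"
  shows "((\<lambda>u. sgn u * \<bar>u\<bar> powr q) has_real_derivative q * \<bar>u\<bar> powr (q - 1)) (at u)"
proof (cases "u > 0")
  case True
  have "((\<lambda>u. \<bar>u\<bar> powr q) has_real_derivative q * \<bar>u\<bar> powr (q - 1)) (at u)"
    using DERIV_abs_powr[OF assms, of q] True by simp
  then show ?thesis
    by (rule has_field_derivative_transform_within_open[of _ _ _ "{0<..}"]) (use True in auto)
next
  case False
  with assms have u: "u < 0" by simp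
  have "((\<lambda>u. - (\<bar>u\<bar> powr q)) has_real_derivative q * \<bar>u\<bar> powr (q - 1)) (at u)"
    using DERIV_minus[OF DERIV_abs_powr[OF assms, of q]] u by simp
  then show ?thesis
    by (rule has_field_derivative_transform_within_open[of _ _ _ "{..<0}"]) (use u in auto)
qed

lemma continuous_sgn_abs_powr:
  fixes q :: real
  assumes "0 < q"
  shows "continuous_on UNIV (\<lambda>u::real. sgn u * \<bar>u\<bar> powr q)"
proof -
  have "(\<lambda>u::real. sgn u * \<bar>u\<bar> powr q) = (\<lambda>u. max u 0 powr q - max (- u) 0 powr q)"
    using assms by (auto simp: fun_eq_iff sgn_if max_def)
  moreover have "continuous_on UNIV (\<lambda>u::real. max u 0 powr q - max (- u) 0 powr q)"
    using assms by (intro continuous_intros continuous_on_powr') auto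
  ultimately show ?thesis by (simp only:)
qed

text \<open>The kernel may be singular at \<tau>, but its primitive is continuous there because p is
  positive; the fundamental theorem with one exceptional point then applies wherever \<tau>
  lies.\<close>

lemma has_integral_abs_powr:
  fixes p a b \<tau> :: real
  assumes "0 < p" "a \<le> b"
  shows "((\<lambda>\<sigma>. \<bar>\<tau> - \<sigma>\<bar> powr (p - 1)) has_integral
     (sgn (b - \<tau>) * \<bar>b - \<tau>\<bar> powr p - sgn (a - \<tau>) * \<bar>a - \<tau>\<bar> powr p) / p) {a..b}"
proof -
  have "((\<lambda>\<sigma>. \<bar>\<sigma> - \<tau>\<bar> powr (p - 1)) has_integral
     (sgn (b - \<tau>) * \<bar>b - \<tau>\<bar> powr p / p - sgn (a - \<tau>) * \<bar>a - \<tau>\<bar> powr p / p)) {a..b}"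
  proof (rule fundamental_theorem_of_calculus_interior_strong[where S="{\<tau>}"])
    fix \<sigma> assume "\<sigma> \<in> {a<..<b} - {\<tau>}"
    then have ne: "\<sigma> - \<tau> \<noteq> 0" by auto
    have "((\<lambda>\<sigma>. sgn (\<sigma> - \<tau>) * \<bar>\<sigma> - \<tau>\<bar> powr p) has_real_derivative p * \<bar>\<sigma> - \<tau>\<bar> powr (p - 1) * (1 - 0)) (at \<sigma>)"
      by (rule DERIV_chain2[where f="\<lambda>u. sgn u * \<bar>u\<bar> powr p" and g="\<lambda>\<sigma>. \<sigma> - \<tau>", OF DERIV_sgn_abs_powr[OF ne]] derivative_intros)+
    from DERIV_cdivide[OF this, of p] show "((\<lambda>\<sigma>. sgn (\<sigma> - \<tau>) * \<bar>\<sigma> - \<tau>\<bar> powr p / p) has_vector_derivative \<bar>\<sigma> - \<tau>\<bar> powr (p - 1)) (at \<sigma>)"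
      using assms by (simp add: has_real_derivative_iff_has_vector_derivative)
  next
    have "continuous_on {a..b} (\<lambda>\<sigma>. (sgn (\<sigma> - \<tau>) * \<bar>\<sigma> - \<tau>\<bar> powr p) / p)"
      using assms by (intro continuous_on_divide continuous_on_const continuous_on_compose2[OF continuous_sgn_abs_powr[OF \<open>0 < p\<close>]] continuous_on_diff continuous_on_id) auto
    then show "continuous_on {a..b} (\<lambda>\<sigma>. sgn (\<sigma> - \<tau>) * \<bar>\<sigma> - \<tau>\<bar> powr p / p)" by simp
  qed (use assms in auto)
  then show ?thesis by (simp add: abs_minus_commute diff_divide_distrib)
qed

lemma has_integral_sgn_abs_powr:
  fixes p t s :: real
  assumes "0 < p" "0 \<le> t"
  shows "((\<lambda>\<tau>. sgn (s - \<tau>) * \<bar>s - \<tau>\<bar> powr p) has_integral (\<bar>s\<bar> powr (p + 1) - \<bar>s - t\<bar> powr (p + 1)) / (p + 1)) {0..t}"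
proof -
  have "((\<lambda>\<tau>. sgn (s - \<tau>) * \<bar>s - \<tau>\<bar> powr p) has_integral
     (- (\<bar>s - t\<bar> powr (p + 1) / (p + 1)) - (- (\<bar>s - 0\<bar> powr (p + 1) / (p + 1))))) {0..t}"
  proof (rule fundamental_theorem_of_calculus_interior_strong[where S="{s}"])
    fix \<sigma> assume "\<sigma> \<in> {0<..<t} - {s}"
    then have ne: "s - \<sigma> \<noteq> 0" by auto
    have "((\<lambda>\<sigma>. \<bar>s - \<sigma>\<bar> powr (p + 1)) has_real_derivative ((p + 1) * (sgn (s - \<sigma>) * \<bar>s - \<sigma>\<bar> powr (p + 1 - 1))) * (0 - 1)) (at \<sigma>)"
      by (rule DERIV_chain2[where f="\<lambda>u. \<bar>u\<bar> powr (p + 1)" and g="\<lambda>\<sigma>. s - \<sigma>", OF DERIV_abs_powr[OF ne]] derivative_intros)+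
    from DERIV_minus[OF DERIV_cdivide[OF this, of "p + 1"]] show "((\<lambda>\<sigma>. - (\<bar>s - \<sigma>\<bar> powr (p + 1) / (p + 1))) has_vector_derivative sgn (s - \<sigma>) * \<bar>s - \<sigma>\<bar> powr p) (at \<sigma>)"
      using assms by (simp add: has_real_derivative_iff_has_vector_derivative)
  next
    show "continuous_on {0..t} (\<lambda>\<sigma>. - (\<bar>s - \<sigma>\<bar> powr (p + 1) / (p + 1)))"
      using assms by (intro continuous_intros continuous_on_powr') auto
  qed (use assms in auto)
  then show ?thesis by (simp add: diff_divide_distrib)
qed

text \<open>Up to the factor H (2H - 1) this is the inner product of the Hilbert space of fractional
  Brownian motion. As an \<open>ennreal\<close> integral it is always defined, but it represents
  that inner product only for nonnegative arguments, because \<open>ennreal\<close> cuts off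
  negative values.\<close>

definition frac_form :: "real \<Rightarrow> (real \<Rightarrow> real) \<Rightarrow> (real \<Rightarrow> real) \<Rightarrow> ennreal" where
  "frac_form H \<phi> \<psi> = (\<integral>\<^sup>+ \<tau>. \<integral>\<^sup>+ \<sigma>. ennreal (\<bar>\<tau> - \<sigma>\<bar> powr (2 * H - 2) * \<phi> \<tau> * \<psi> \<sigma>) \<partial>lborel \<partial>lborel)"

lemma frac_form_commute:
  assumes [measurable]: "\<phi> \<in> borel_measurable borel" "\<psi> \<in> borel_measurable borel"
  shows "frac_form H \<phi> \<psi> = frac_form H \<psi> \<phi>"
  unfolding frac_form_def
  by (subst lborel_pair.Fubini') (auto intro!: nn_integral_cong simp: abs_minus_commute mult_ac)

lemma nn_integral_has_integral_Icc:
  fixes f :: "real \<Rightarrow> real"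
  assumes "f \<in> borel_measurable borel" "\<And>x. x \<in> {a..b} \<Longrightarrow> 0 \<le> f x" "(f has_integral I) {a..b}"
  shows "(\<integral>\<^sup>+x. ennreal (f x * indicator {a..b} x) \<partial>lborel) = ennreal I"
proof (rule nn_integral_has_integral_lborel)
  have "((\<lambda>x. if x \<in> {a..b} then f x else 0) has_integral I) UNIV"
    using assms(3) by (simp only: has_integral_restrict_UNIV)
  then show "((\<lambda>x. f x * indicator {a..b} x) has_integral I) UNIV"
    by (rule has_integral_eq[rotated]) (auto split: split_indicator)
qed (use assms in \<open>auto split: split_indicator\<close>)

text \<open>Two integrations of |\<tau> - \<sigma>|^(2H - 2) divide by p and by p + 1 with p = 2H -
  1. As p (p + 1) = 2H (2H - 1), the factor 1/2 in the covariance of fractional Brownian motion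
  turns this into H (2H - 1).\<close>

lemma frac_form_indicator:
  assumes H: "1 / 2 < H" "H < 1" and ts: "0 \<le> t" "0 \<le> s"
  shows "frac_form H (indicator {0..t}) (indicator {0..s}) = ennreal (fractional_covariance H t s / (H * (2 * H - 1)))"
proof -
  define p where "p = 2 * H - 1"
  have p: "0 < p" "2 * H - 2 = p - 1" using H by (auto simp: p_def)
  define F where "F \<tau> = (sgn (s - \<tau>) * \<bar>s - \<tau>\<bar> powr p - sgn (0 - \<tau>) * \<bar>0 - \<tau>\<bar> powr p) / p" for \<tau>
  have F: "F \<in> borel_measurable borel" unfolding F_def by measurable
  have "frac_form H (indicator {0..t}) (indicator {0..s}) = (\<integral>\<^sup>+ \<tau>. ennreal (F \<tau> * indicator {0..t} \<tau>) \<partial>lborel)"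
    unfolding frac_form_def
  proof (intro nn_integral_cong)
    fix \<tau> :: real
    have "(\<integral>\<^sup>+ \<sigma>. ennreal (\<bar>\<tau> - \<sigma>\<bar> powr (2 * H - 2) * indicator {0..t} \<tau> * indicator {0..s} \<sigma>) \<partial>lborel)
      = (\<integral>\<^sup>+ \<sigma>. indicator {0..t} \<tau> * ennreal (\<bar>\<tau> - \<sigma>\<bar> powr (p - 1) * indicator {0..s} \<sigma>) \<partial>lborel)"
      by (auto simp: p split: split_indicator)
    also have "\<dots> = indicator {0..t} \<tau> * (\<integral>\<^sup>+ \<sigma>. ennreal (\<bar>\<tau> - \<sigma>\<bar> powr (p - 1) * indicator {0..s} \<sigma>) \<partial>lborel)"
      by (intro nn_integral_cmult) auto
    also have "(\<integral>\<^sup>+ \<sigma>. ennreal (\<bar>\<tau> - \<sigma>\<bar> powr (p - 1) * indicator {0..s} \<sigma>) \<partial>lborel) = ennreal (F \<tau>)"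
      unfolding F_def using p ts by (intro nn_integral_has_integral_Icc has_integral_abs_powr) auto
    finally show "(\<integral>\<^sup>+ \<sigma>. ennreal (\<bar>\<tau> - \<sigma>\<bar> powr (2 * H - 2) * indicator {0..t} \<tau> * indicator {0..s} \<sigma>) \<partial>lborel) = ennreal (F \<tau> * indicator {0..t} \<tau>)"
      by (auto split: split_indicator)
  qed
  also have "\<dots> = ennreal (((\<bar>s\<bar> powr (p + 1) - \<bar>s - t\<bar> powr (p + 1)) / (p + 1) - (\<bar>0\<bar> powr (p + 1) - \<bar>0 - t\<bar> powr (p + 1)) / (p + 1)) / p)"
  proof (rule nn_integral_has_integral_Icc[OF F])
    show "(F has_integral ((\<bar>s\<bar> powr (p + 1) - \<bar>s - t\<bar> powr (p + 1)) / (p + 1) - (\<bar>0\<bar> powr (p + 1) - \<bar>0 - t\<bar> powr (p + 1)) / (p + 1)) / p) {0..t}"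
      unfolding F_def by (intro has_integral_divide has_integral_diff has_integral_sgn_abs_powr p ts)
    show "0 \<le> F x" if "x \<in> {0..t}" for x
      unfolding F_def using has_integral_nonneg[OF has_integral_abs_powr[OF p(1) ts(2), of x]] by simp
  qed
  also have "((\<bar>s\<bar> powr (p + 1) - \<bar>s - t\<bar> powr (p + 1)) / (p + 1) - (\<bar>0\<bar> powr (p + 1) - \<bar>0 - t\<bar> powr (p + 1)) / (p + 1)) / p
     = fractional_covariance H t s / (H * (2 * H - 1))"
    using p ts H unfolding fractional_covariance_def
    by (simp add: p_def field_simps abs_minus_commute)
  finally show ?thesis .
qed

text \<open>Split at distance L from \<tau>. Inside, \<phi> is at most 1 and the kernel integrates
  to 2 L^(2H - 1) / (2H - 1); outside, the kernel is at most L^(2H - 2) and \<phi> has mass at most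
  L. Both parts have the order L^(2H - 1), uniformly in \<tau>.\<close>

lemma nn_integral_abs_powr_le:
  fixes \<phi> :: "real \<Rightarrow> real"
  assumes H: "1 / 2 < H" "H < 1" and L: "0 < L"
    and [measurable]: "\<phi> \<in> borel_measurable borel" and \<phi>: "\<And>r. 0 \<le> \<phi> r" "\<And>r. \<phi> r \<le> 1"
    and int: "(\<integral>\<^sup>+ r. ennreal (\<phi> r) \<partial>lborel) \<le> ennreal L"
  shows "(\<integral>\<^sup>+ \<sigma>. ennreal (\<bar>\<tau> - \<sigma>\<bar> powr (2 * H - 2) * \<phi> \<sigma>) \<partial>lborel) \<le> ennreal ((2 / (2 * H - 1) + 1) * L powr (2 * H - 1))"
proof -
  define p where "p = 2 * H - 1"
  have p: "0 < p" "p < 1" "2 * H - 2 = p - 1" using H by (auto simp: p_def)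
  have "(\<integral>\<^sup>+ \<sigma>. ennreal (\<bar>\<tau> - \<sigma>\<bar> powr (2 * H - 2) * \<phi> \<sigma>) \<partial>lborel)
    \<le> (\<integral>\<^sup>+ \<sigma>. ennreal (\<bar>\<tau> - \<sigma>\<bar> powr (p - 1) * indicator {\<tau> - L..\<tau> + L} \<sigma>) + ennreal (L powr (p - 1)) * ennreal (\<phi> \<sigma>) \<partial>lborel)"
  proof (intro nn_integral_mono)
    fix \<sigma>
    have "\<bar>\<tau> - \<sigma>\<bar> powr (p - 1) * \<phi> \<sigma> \<le> \<bar>\<tau> - \<sigma>\<bar> powr (p - 1) * indicator {\<tau> - L..\<tau> + L} \<sigma> + L powr (p - 1) * \<phi> \<sigma>"
    proof (cases "\<bar>\<tau> - \<sigma>\<bar> \<le> L")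
      case True
      then have "\<sigma> \<in> {\<tau> - L..\<tau> + L}" by auto
      then have "\<bar>\<tau> - \<sigma>\<bar> powr (p - 1) * \<phi> \<sigma> \<le> \<bar>\<tau> - \<sigma>\<bar> powr (p - 1) * indicator {\<tau> - L..\<tau> + L} \<sigma>"
        using \<phi>[of \<sigma>] by (auto intro!: mult_left_le)
      then show ?thesis using \<phi>[of \<sigma>] by (simp add: add_increasing2)
    next
      case False
      then have "\<bar>\<tau> - \<sigma>\<bar> powr (p - 1) \<le> L powr (p - 1)"
        using L p by (intro powr_mono2') auto
      then have "\<bar>\<tau> - \<sigma>\<bar> powr (p - 1) * \<phi> \<sigma> \<le> L powr (p - 1) * \<phi> \<sigma>"
        using \<phi>[of \<sigma>] by (intro mult_right_mono) auto
      then show ?thesis by (simp add: add_increasing)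
    qed
    then show "ennreal (\<bar>\<tau> - \<sigma>\<bar> powr (2 * H - 2) * \<phi> \<sigma>) \<le> ennreal (\<bar>\<tau> - \<sigma>\<bar> powr (p - 1) * indicator {\<tau> - L..\<tau> + L} \<sigma>) + ennreal (L powr (p - 1)) * ennreal (\<phi> \<sigma>)"
      unfolding p(3) using \<phi>[of \<sigma>] by (simp flip: ennreal_plus ennreal_mult)
  qed
  also have "\<dots> = (\<integral>\<^sup>+ \<sigma>. ennreal (\<bar>\<tau> - \<sigma>\<bar> powr (p - 1) * indicator {\<tau> - L..\<tau> + L} \<sigma>) \<partial>lborel)
       + ennreal (L powr (p - 1)) * (\<integral>\<^sup>+ \<sigma>. ennreal (\<phi> \<sigma>) \<partial>lborel)"
    by (simp add: nn_integral_add nn_integral_cmult)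
  also have "(\<integral>\<^sup>+ \<sigma>. ennreal (\<bar>\<tau> - \<sigma>\<bar> powr (p - 1) * indicator {\<tau> - L..\<tau> + L} \<sigma>) \<partial>lborel) = ennreal (2 * L powr p / p)"
    using has_integral_abs_powr[OF p(1), of "\<tau> - L" "\<tau> + L" \<tau>] L
    by (intro nn_integral_has_integral_Icc) auto
  also have "ennreal (2 * L powr p / p) + ennreal (L powr (p - 1)) * (\<integral>\<^sup>+ \<sigma>. ennreal (\<phi> \<sigma>) \<partial>lborel)
     \<le> ennreal (2 * L powr p / p) + ennreal (L powr (p - 1)) * ennreal L"
    by (intro add_mono mult_left_mono int) auto
  also have "\<dots> = ennreal ((2 / p + 1) * L powr p)"
    using L p by (simp flip: ennreal_plus ennreal_mult) (simp add: powr_diff field_simps)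
  finally show ?thesis by (simp add: p_def)
qed

text \<open>The two arguments play different roles: the pointwise bound on \<phi> makes its
  potential uniformly bounded, after which only the mass of \<psi> matters.\<close>

lemma frac_form_le:
  assumes H: "1 / 2 < H" "H < 1" and L: "0 < L"
    and [measurable]: "\<phi> \<in> borel_measurable borel" and \<phi>: "\<And>r. 0 \<le> \<phi> r" "\<And>r. \<phi> r \<le> 1"
    and int: "(\<integral>\<^sup>+ r. ennreal (\<phi> r) \<partial>lborel) \<le> ennreal L"
    and [measurable]: "\<psi> \<in> borel_measurable borel" and \<psi>: "\<And>r. 0 \<le> \<psi> r"
    and int': "(\<integral>\<^sup>+ r. ennreal (\<psi> r) \<partial>lborel) \<le> ennreal L"
  shows "frac_form H \<psi> \<phi> \<le> ennreal ((2 / (2 * H - 1) + 1) * L powr (2 * H))"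
proof -
  have "frac_form H \<psi> \<phi> = (\<integral>\<^sup>+ \<tau>. ennreal (\<psi> \<tau>) * (\<integral>\<^sup>+ \<sigma>. ennreal (\<bar>\<tau> - \<sigma>\<bar> powr (2 * H - 2) * \<phi> \<sigma>) \<partial>lborel) \<partial>lborel)"
    unfolding frac_form_def using \<phi> \<psi>
    by (subst nn_integral_cmult[symmetric]) (auto intro!: nn_integral_cong simp: ennreal_mult[symmetric] mult_ac)
  also have "\<dots> \<le> (\<integral>\<^sup>+ \<tau>. ennreal (\<psi> \<tau>) * ennreal ((2 / (2 * H - 1) + 1) * L powr (2 * H - 1)) \<partial>lborel)"
    using assms by (intro nn_integral_mono mult_left_mono nn_integral_abs_powr_le) auto
  also have "\<dots> = (\<integral>\<^sup>+ \<tau>. ennreal (\<psi> \<tau>) \<partial>lborel) * ennreal ((2 / (2 * H - 1) + 1) * L powr (2 * H - 1))"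
    by (rule nn_integral_multc) auto
  also have "\<dots> \<le> ennreal L * ennreal ((2 / (2 * H - 1) + 1) * L powr (2 * H - 1))"
    by (intro mult_right_mono int') auto
  also have "\<dots> = ennreal ((2 / (2 * H - 1) + 1) * L powr (2 * H))"
    using L H by (simp flip: ennreal_mult) (simp add: powr_diff field_simps)
  finally show ?thesis .
qed

text \<open>With \<kappa> = |\<xi>|^2 this is, up to a phase, the spatial Fourier transform of the
  heat kernel started at time r and observed at time t. The half-open interval agrees with the
  cut-off in \<open>heat_solution\<close>.\<close>

definition decay :: "real \<Rightarrow> real \<Rightarrow> real \<Rightarrow> real" where
  "decay \<kappa> t r = indicator {0..<t} r * exp (- \<kappa> * (t - r))"

lemma decay_measurable [measurable]: "decay \<kappa> t \<in> borel_measurable borel"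
  unfolding decay_def by measurable

lemma decay_nonneg [simp]: "0 \<le> decay \<kappa> t r"
  by (simp add: decay_def)

lemma decay_le_1: "0 \<le> \<kappa> \<Longrightarrow> decay \<kappa> t r \<le> 1"
  by (auto simp: decay_def split: split_indicator)

section \<open>Masses and fractional energies of the exponential profiles\<close>

lemma nn_integral_exp_window_le:
  fixes a t \<kappa> :: real
  assumes "0 < \<kappa>" "a \<le> t"
  shows "(\<integral>\<^sup>+ r. ennreal (indicator {a..<t} r * exp (- \<kappa> * (t - r))) \<partial>lborel) \<le> ennreal (min (t - a) (1 / \<kappa>))"
proof -
  have "(\<integral>\<^sup>+ r. ennreal (indicator {a..<t} r * exp (- \<kappa> * (t - r))) \<partial>lborel) \<le> (\<integral>\<^sup>+ r. indicator {a..t} r \<partial>lborel)"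
    using assms by (intro nn_integral_mono) (auto split: split_indicator)
  also have "\<dots> = ennreal (t - a)" using assms by simp
  finally have 1: "(\<integral>\<^sup>+ r. ennreal (indicator {a..<t} r * exp (- \<kappa> * (t - r))) \<partial>lborel) \<le> ennreal (t - a)" .
  have "(\<integral>\<^sup>+ r. ennreal (indicator {a..<t} r * exp (- \<kappa> * (t - r))) \<partial>lborel)
     = (\<integral>\<^sup>+ r. ennreal (indicator {a..<t} (t - r) * exp (- \<kappa> * r)) \<partial>lborel)"
    by (subst nn_integral_real_affine[where t=t and c="-1"]) auto
  also have "\<dots> \<le> (\<integral>\<^sup>+ r. ennreal (exp (- \<kappa> * r)) * indicator {0..} r \<partial>lborel)"
    by (intro nn_integral_mono) (auto split: split_indicator)
  also have "\<dots> = ennreal (0 - (- exp (- \<kappa> * 0) / \<kappa>))"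
  proof (rule nn_integral_FTC_atLeast)
    show "((\<lambda>r. - exp (- \<kappa> * r) / \<kappa>) has_real_derivative exp (- \<kappa> * x)) (at x)" for x
      using assms by (auto intro!: derivative_eq_intros)
    show "((\<lambda>r. - exp (- \<kappa> * r) / \<kappa>) \<longlongrightarrow> 0) at_top"
      using assms by real_asymp
  qed auto
  finally have 2: "(\<integral>\<^sup>+ r. ennreal (indicator {a..<t} r * exp (- \<kappa> * (t - r))) \<partial>lborel) \<le> ennreal (1 / \<kappa>)"
    by simp
  from 1 2 show ?thesis by (auto simp: min_def)
qed

lemma nn_integral_decay_le:
  assumes "0 < \<kappa>" "0 \<le> t"
  shows "(\<integral>\<^sup>+ r. ennreal (decay \<kappa> t r) \<partial>lborel) \<le> ennreal (min t (1 / \<kappa>))"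
  using nn_integral_exp_window_le[OF assms] by (simp add: decay_def)

text \<open>The difference consists of the sources in [s, t), seen only by the later profile, and of
  the loss 1 - exp (-\<kappa> (t - s)) on the common part. Each has mass at most min (t - s) (1 /
  \<kappa>), the second one because 1 - exp (-x) is at most both 1 and x.\<close>

lemma nn_integral_decay_diff_le:
  assumes \<kappa>: "0 < \<kappa>" and st: "0 \<le> s" "s \<le> t"
  shows "(\<integral>\<^sup>+ r. ennreal \<bar>decay \<kappa> t r - decay \<kappa> s r\<bar> \<partial>lborel) \<le> ennreal (2 * min (t - s) (1 / \<kappa>))"
proof -
  define \<delta> where "\<delta> = t - s"
  have \<delta>: "0 \<le> \<delta>" using st by (simp add: \<delta>_def)
  have "\<bar>decay \<kappa> t r - decay \<kappa> s r\<bar> = indicator {s..<t} r * exp (- \<kappa> * (t - r)) + (1 - exp (- \<kappa> * \<delta>)) * decay \<kappa> s r" for r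
  proof (cases "0 \<le> r \<and> r < s")
    case True
    have "exp (- \<kappa> * (t - r)) = exp (- \<kappa> * \<delta>) * exp (- \<kappa> * (s - r))"
      by (simp add: \<delta>_def algebra_simps flip: exp_add)
    moreover have "exp (- \<kappa> * \<delta>) * exp (- \<kappa> * (s - r)) \<le> exp (- \<kappa> * (s - r))"
      using \<delta> \<kappa> by (intro mult_left_le_one_le) auto
    ultimately show ?thesis using True st by (simp add: decay_def algebra_simps)
  qed (use st in \<open>auto simp: decay_def split: split_indicator\<close>)
  then have "(\<integral>\<^sup>+ r. ennreal \<bar>decay \<kappa> t r - decay \<kappa> s r\<bar> \<partial>lborel)
    = (\<integral>\<^sup>+ r. ennreal (indicator {s..<t} r * exp (- \<kappa> * (t - r))) + ennreal (1 - exp (- \<kappa> * \<delta>)) * ennreal (decay \<kappa> s r) \<partial>lborel)"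
    using \<delta> \<kappa> by (intro nn_integral_cong) (simp flip: ennreal_plus ennreal_mult)
  also have "\<dots> = (\<integral>\<^sup>+ r. ennreal (indicator {s..<t} r * exp (- \<kappa> * (t - r))) \<partial>lborel)
      + ennreal (1 - exp (- \<kappa> * \<delta>)) * (\<integral>\<^sup>+ r. ennreal (decay \<kappa> s r) \<partial>lborel)"
    by (simp add: nn_integral_add nn_integral_cmult)
  also have "\<dots> \<le> ennreal (min (t - s) (1 / \<kappa>)) + ennreal (1 - exp (- \<kappa> * \<delta>)) * ennreal (1 / \<kappa>)"
    using nn_integral_decay_le[OF \<kappa> st(1)]
    by (intro add_mono mult_left_mono nn_integral_exp_window_le \<kappa> st) (auto elim!: order_trans simp: ennreal_leI)
  also have "\<dots> \<le> ennreal (min (t - s) (1 / \<kappa>)) + ennreal (min (t - s) (1 / \<kappa>))"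
  proof -
    have "1 - exp (- \<kappa> * \<delta>) \<le> \<kappa> * \<delta>" using exp_ge_add_one_self[of "- \<kappa> * \<delta>"] by simp
    then have "(1 - exp (- \<kappa> * \<delta>)) * (1 / \<kappa>) \<le> min (t - s) (1 / \<kappa>)"
      using \<kappa> by (simp add: \<delta>_def field_simps)
    then show ?thesis using \<kappa> \<delta> by (intro add_left_mono) (auto simp flip: ennreal_mult intro!: ennreal_leI)
  qed
  also have "\<dots> = ennreal (2 * min (t - s) (1 / \<kappa>))"
    using \<kappa> st by (simp flip: ennreal_plus)
  finally show ?thesis .
qed

lemma frac_form_decay_le:
  assumes H: "1 / 2 < H" "H < 1" and \<kappa>: "0 < \<kappa>" and st: "0 \<le> s" "0 \<le> t" and L: "0 < L" "min t (1 / \<kappa>) \<le> L" "min s (1 / \<kappa>) \<le> L"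
  shows "frac_form H (decay \<kappa> t) (decay \<kappa> s) \<le> ennreal ((2 / (2 * H - 1) + 1) * L powr (2 * H))"
proof (rule frac_form_le[OF H L(1)])
  show "(\<integral>\<^sup>+ r. ennreal (decay \<kappa> t r) \<partial>lborel) \<le> ennreal L"
    by (rule order_trans[OF nn_integral_decay_le[OF \<kappa> st(2)] ennreal_leI[OF L(2)]])
  show "(\<integral>\<^sup>+ r. ennreal (decay \<kappa> s r) \<partial>lborel) \<le> ennreal L"
    by (rule order_trans[OF nn_integral_decay_le[OF \<kappa> st(1)] ennreal_leI[OF L(3)]])
qed (use \<kappa> in \<open>auto intro: decay_le_1\<close>)

lemma frac_form_decay_diff_le:
  assumes H: "1 / 2 < H" "H < 1" and \<kappa>: "0 < \<kappa>" and st: "0 \<le> s" "s < t"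
  shows "frac_form H (\<lambda>r. \<bar>decay \<kappa> t r - decay \<kappa> s r\<bar>) (\<lambda>r. \<bar>decay \<kappa> t r - decay \<kappa> s r\<bar>)
    \<le> ennreal ((2 / (2 * H - 1) + 1) * (2 * min (t - s) (1 / \<kappa>)) powr (2 * H))"
proof (rule frac_form_le[OF H])
  have "\<bar>decay \<kappa> t r - decay \<kappa> s r\<bar> \<le> 1" for r
    using decay_le_1[of \<kappa> t r] decay_le_1[of \<kappa> s r] decay_nonneg[of \<kappa> t r] decay_nonneg[of \<kappa> s r] \<kappa> by linarith
  then show "\<And>r. \<bar>decay \<kappa> t r - decay \<kappa> s r\<bar> \<le> 1" .
qed (use \<kappa> st nn_integral_decay_diff_le[OF \<kappa>, of s t] in auto)

text \<open>During the last L time units before t the profile stays above 1/e, because \<kappa> L is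
  at most 1, and the kernel stays above L^(2H - 2), because its exponent is negative; the square of
  these times has area L^2.\<close>

lemma frac_form_decay_ge:
  assumes H: "1 / 2 < H" "H < 1" and \<kappa>: "0 < \<kappa>" and L: "0 < L" "L \<le> t" "L \<le> 1 / \<kappa>"
  shows "ennreal (exp (- 2) * L powr (2 * H)) \<le> frac_form H (decay \<kappa> t) (decay \<kappa> t)"
proof -
  let ?I = "{t - L..<t}"
  have d: "exp (- 1) \<le> decay \<kappa> t r" if "r \<in> ?I" for r
  proof -
    have "\<kappa> * (t - r) \<le> \<kappa> * (1 / \<kappa>)" using that L \<kappa> by (intro mult_left_mono) auto
    then show ?thesis using that L \<kappa> by (auto simp: decay_def)
  qed
  have "ennreal (exp (- 2) * L powr (2 * H)) = ennreal (exp (- 2) * L powr (2 * H - 2)) * (ennreal L * ennreal L)"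
    using L by (simp flip: ennreal_mult) (simp add: powr_diff powr_numeral field_simps power2_eq_square)
  also have "\<dots> = (\<integral>\<^sup>+ \<tau>. \<integral>\<^sup>+ \<sigma>. ennreal (exp (- 2) * L powr (2 * H - 2)) * (indicator ?I \<tau> * indicator ?I \<sigma>) \<partial>lborel \<partial>lborel)"
    using L by (simp add: nn_integral_cmult nn_integral_multc mult_ac)
  also have "\<dots> \<le> frac_form H (decay \<kappa> t) (decay \<kappa> t)"
    unfolding frac_form_def
  \<comment> \<open>The comparison holds only off the diagonal: at \<sigma> = \<tau> the kernel is
    \<open>0 powr\<close> a negative exponent, which is 0 instead of infinity.\<close>
  proof (rule nn_integral_mono, rule nn_integral_mono_AE)
    fix \<tau>
    show "AE \<sigma> in lborel. ennreal (exp (- 2) * L powr (2 * H - 2)) * (indicator ?I \<tau> * indicator ?I \<sigma>)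
      \<le> ennreal (\<bar>\<tau> - \<sigma>\<bar> powr (2 * H - 2) * decay \<kappa> t \<tau> * decay \<kappa> t \<sigma>)"
      using AE_lborel_singleton[of \<tau>]
    proof eventually_elim
      case (elim \<sigma>)
      show ?case
      proof (cases "\<tau> \<in> ?I \<and> \<sigma> \<in> ?I")
        case True
        then have "L powr (2 * H - 2) \<le> \<bar>\<tau> - \<sigma>\<bar> powr (2 * H - 2)"
          using elim H L by (intro powr_mono2') auto
        moreover have "exp (- 2) = exp (- 1) * exp (- 1 :: real)" by (simp flip: exp_add)
        ultimately have "exp (- 2) * L powr (2 * H - 2) = (L powr (2 * H - 2) * exp (- 1)) * exp (- 1)"
          and "(L powr (2 * H - 2) * exp (- 1)) * exp (- 1) \<le> (\<bar>\<tau> - \<sigma>\<bar> powr (2 * H - 2) * decay \<kappa> t \<tau>) * decay \<kappa> t \<sigma>"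
          using d True by (simp, intro mult_mono) auto
        then have "exp (- 2) * L powr (2 * H - 2) \<le> \<bar>\<tau> - \<sigma>\<bar> powr (2 * H - 2) * decay \<kappa> t \<tau> * decay \<kappa> t \<sigma>"
          by (simp only:)
        with True show ?thesis by (auto intro!: ennreal_leI)
      qed (auto split: split_indicator)
    qed
  qed
  finally show ?thesis .
qed

text \<open>Cut the source times of the later profile at the midpoint of s and t, with \<delta> = (t
  - s) / 2. After it, every pair of source times is at least \<delta> apart and the kernel is at
  most \<delta>^(2H - 2). Before it, the later profile is exp (-\<kappa> \<delta>) times the profile
  observed at the midpoint. Scaling out \<kappa>^(-2H) leaves a function of \<kappa> (t - s)
  alone.\<close>

lemma frac_form_decay_separated_le:
  assumes H: "1 / 2 < H" "H < 1" and \<kappa>: "0 < \<kappa>" and st: "0 \<le> s" "s < t"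
  shows "frac_form H (decay \<kappa> t) (decay \<kappa> s) \<le>
    ennreal (\<kappa> powr (- 2 * H) * ((\<kappa> * (t - s) / 2) powr (2 * H - 2) + (2 / (2 * H - 1) + 1) * exp (- \<kappa> * (t - s) / 2)))"
proof -
  define \<delta> where "\<delta> = (t - s) / 2"
  have \<delta>: "0 < \<delta>" and t: "t - \<delta> = s + \<delta>" using st by (auto simp: \<delta>_def field_simps)
  have le: "\<bar>\<tau> - \<sigma>\<bar> powr (2 * H - 2) * decay \<kappa> t \<tau> * decay \<kappa> s \<sigma>
     \<le> \<delta> powr (2 * H - 2) * decay \<kappa> t \<tau> * decay \<kappa> s \<sigma> + exp (- \<kappa> * \<delta>) * (\<bar>\<tau> - \<sigma>\<bar> powr (2 * H - 2) * decay \<kappa> (t - \<delta>) \<tau> * decay \<kappa> s \<sigma>)" for \<tau> \<sigma>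
  proof (cases "\<tau> < t - \<delta>")
    case True
    have "decay \<kappa> t \<tau> = exp (- \<kappa> * \<delta>) * decay \<kappa> (t - \<delta>) \<tau>"
      using True \<delta> by (auto simp: decay_def algebra_simps simp flip: exp_add split: split_indicator)
    then show ?thesis by simp
  next
    case False
    show ?thesis
    proof (cases "\<sigma> < s")
      case True
      then have "\<bar>\<tau> - \<sigma>\<bar> powr (2 * H - 2) \<le> \<delta> powr (2 * H - 2)"
        using False \<delta> H t by (intro powr_mono2') auto
      then show ?thesis by (intro add_increasing2 mult_right_mono) auto
    qed (simp add: decay_def)
  qed
  have "frac_form H (decay \<kappa> t) (decay \<kappa> s) \<le>
    (\<integral>\<^sup>+ \<tau>. \<integral>\<^sup>+ \<sigma>. ennreal (\<delta> powr (2 * H - 2)) * (ennreal (decay \<kappa> t \<tau>) * ennreal (decay \<kappa> s \<sigma>)) +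
       ennreal (exp (- \<kappa> * \<delta>)) * ennreal (\<bar>\<tau> - \<sigma>\<bar> powr (2 * H - 2) * decay \<kappa> (t - \<delta>) \<tau> * decay \<kappa> s \<sigma>) \<partial>lborel \<partial>lborel)"
    unfolding frac_form_def
    by (intro nn_integral_mono) (use le in \<open>auto simp flip: ennreal_plus ennreal_mult simp: mult.assoc intro!: ennreal_leI\<close>)
  also have "\<dots> = ennreal (\<delta> powr (2 * H - 2)) * ((\<integral>\<^sup>+ \<tau>. ennreal (decay \<kappa> t \<tau>) \<partial>lborel) * (\<integral>\<^sup>+ \<sigma>. ennreal (decay \<kappa> s \<sigma>) \<partial>lborel))
      + ennreal (exp (- \<kappa> * \<delta>)) * frac_form H (decay \<kappa> (t - \<delta>)) (decay \<kappa> s)"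
    unfolding frac_form_def by (simp add: nn_integral_add nn_integral_cmult nn_integral_multc)
  also have "\<dots> \<le> ennreal (\<delta> powr (2 * H - 2)) * (ennreal (1 / \<kappa>) * ennreal (1 / \<kappa>))
      + ennreal (exp (- \<kappa> * \<delta>)) * ennreal ((2 / (2 * H - 1) + 1) * (1 / \<kappa>) powr (2 * H))"
    using nn_integral_decay_le[OF \<kappa>, of t] nn_integral_decay_le[OF \<kappa>, of s] st \<kappa> \<delta> t
    by (intro add_mono mult_left_mono mult_mono frac_form_decay_le H \<kappa>)
       (auto elim!: order_trans simp: ennreal_leI)
  also have "\<dots> = ennreal (\<delta> powr (2 * H - 2) * (1 / \<kappa> * (1 / \<kappa>)) + exp (- \<kappa> * \<delta>) * ((2 / (2 * H - 1) + 1) * (1 / \<kappa>) powr (2 * H)))"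
    using \<kappa> H by (simp flip: ennreal_plus ennreal_mult)
  also have "\<delta> powr (2 * H - 2) * (1 / \<kappa> * (1 / \<kappa>)) + exp (- \<kappa> * \<delta>) * ((2 / (2 * H - 1) + 1) * (1 / \<kappa>) powr (2 * H))
     = \<kappa> powr (- 2 * H) * ((\<kappa> * (t - s) / 2) powr (2 * H - 2) + (2 / (2 * H - 1) + 1) * exp (- \<kappa> * (t - s) / 2))"
  proof -
    have 1: "\<kappa> * (t - s) / 2 = \<kappa> * \<delta>" "- \<kappa> * (t - s) / 2 = - \<kappa> * \<delta>" by (simp_all add: \<delta>_def)
    have 2: "(1 / \<kappa>) powr (2 * H) = \<kappa> powr (- 2 * H)" using \<kappa> by (simp add: powr_minus powr_divide field_simps)
    have "\<kappa> powr (- 2 * H) * (\<kappa> * \<delta>) powr (2 * H - 2) = \<kappa> powr (- 2 * H) * \<kappa> powr (2 * H - 2) * \<delta> powr (2 * H - 2)"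
      using \<kappa> \<delta> by (simp add: powr_mult)
    also have "\<kappa> powr (- 2 * H) * \<kappa> powr (2 * H - 2) = \<kappa> powr (- 2)" by (simp flip: powr_add)
    also have "\<dots> = 1 / \<kappa> * (1 / \<kappa>)" using \<kappa> by (simp add: powr_minus powr_numeral power2_eq_square field_simps)
    finally have 3: "\<kappa> powr (- 2 * H) * (\<kappa> * \<delta>) powr (2 * H - 2) = 1 / \<kappa> * (1 / \<kappa>) * \<delta> powr (2 * H - 2)" .
    show ?thesis unfolding 1 2 distrib_left 3 by (simp only: mult_ac)
  qed
  finally show ?thesis .
qed

text \<open>Both terms of the separated bound vanish as \<kappa> (t - s) grows. The target is a
  quarter of exp (-2) \<kappa>^(-2H), the lower bound for the diagonal term of the later time, so
  that two cross terms consume only half of it; K at least 1 ensures 1 / \<kappa> <= t - s, under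
  which that lower bound is available.\<close>

lemma frac_form_separation:
  assumes H: "1 / 2 < H" "H < 1"
  shows "\<exists>K\<ge>1. \<forall>\<kappa> s t. 0 \<le> s \<longrightarrow> s < t \<longrightarrow> K \<le> \<kappa> * (t - s) \<longrightarrow>
     frac_form H (decay \<kappa> t) (decay \<kappa> s) \<le> ennreal (exp (- 2) / 4 * \<kappa> powr (- 2 * H))"
proof -
  define C where "C = 2 / (2 * H - 1) + 1"
  have "((\<lambda>\<eta>. (\<eta> / 2) powr (2 * H - 2) + C * exp (- \<eta> / 2)) \<longlongrightarrow> 0) at_top"
    using H by real_asymp
  then have "\<forall>\<^sub>F \<eta> in at_top. (\<eta> / 2) powr (2 * H - 2) + C * exp (- \<eta> / 2) < exp (- 2) / 4"
    by (rule order_tendstoD) simp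
  then obtain K0 where K0: "\<And>\<eta>. K0 \<le> \<eta> \<Longrightarrow> (\<eta> / 2) powr (2 * H - 2) + C * exp (- \<eta> / 2) < exp (- 2) / 4"
    by (auto simp: eventually_at_top_linorder)
  show ?thesis
  proof (intro exI[of _ "max 1 K0"] conjI allI impI)
    fix \<kappa> s t :: real
    assume a: "0 \<le> s" "s < t" "max 1 K0 \<le> \<kappa> * (t - s)"
    then have "0 < \<kappa> * (t - s)" by linarith
    with \<open>s < t\<close> have \<kappa>: "0 < \<kappa>" by (simp add: zero_less_mult_iff)
    have "frac_form H (decay \<kappa> t) (decay \<kappa> s) \<le> ennreal (\<kappa> powr (- 2 * H) * ((\<kappa> * (t - s) / 2) powr (2 * H - 2) + C * exp (- \<kappa> * (t - s) / 2)))"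
      unfolding C_def by (rule frac_form_decay_separated_le) (use a H \<kappa> in auto)
    also have "\<dots> \<le> ennreal (exp (- 2) / 4 * \<kappa> powr (- 2 * H))"
      using K0[of "\<kappa> * (t - s)"] a by (intro ennreal_leI) (simp add: mult.commute[of "exp (- 2) / 4"] mult_left_mono del: times_divide_eq_right times_divide_eq_left)
    finally show "frac_form H (decay \<kappa> t) (decay \<kappa> s) \<le> ennreal (exp (- 2) / 4 * \<kappa> powr (- 2 * H))" .
  qed simp
qed

section \<open>Radial integrals\<close>

text \<open>Polar coordinates without spheres: the image measure of the norm is determined by its
  values on half-lines, which are ball volumes v a^d, and d v r^(d - 1) is their derivative.\<close>

lemma distr_norm_lborel:
  "distr (lborel :: 'a::euclidean_space measure) borel norm
   = density lborel (\<lambda>r. ennreal (real DIM('a) * unit_ball_vol (real DIM('a)) * r ^ (DIM('a) - 1)) * indicator {0..} r)"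
    (is "?M = ?N")
proof (rule measure_eqI_generator_eq)
  let ?d = "DIM('a)" and ?v = "unit_ball_vol (real DIM('a))"
  show "Int_stable (range (\<lambda>a::real. {..a}))"
    by (auto simp: Int_stable_def)
  have *: "emeasure ?M {..a} = ennreal (if 0 \<le> a then ?v * a ^ ?d else 0)" for a
  proof -
    have "norm -` {..a} = (cball 0 a :: 'a set)" by auto
    then show ?thesis
      by (auto simp: emeasure_distr emeasure_cball)
  qed
  have **: "emeasure ?N {..a} = ennreal (if 0 \<le> a then ?v * a ^ ?d else 0)" for a
  proof (cases "0 \<le> a")
    case True
    have "emeasure ?N {..a} = (\<integral>\<^sup>+r. ennreal (real ?d * ?v * r ^ (?d - 1)) * indicator {0..a} r \<partial>lborel)"
      by (subst emeasure_density) (auto intro!: nn_integral_cong split: split_indicator)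
    also have "\<dots> = ennreal (?v * a ^ ?d - ?v * 0 ^ ?d)"
      by (rule nn_integral_FTC_Icc) (use True in \<open>auto intro!: derivative_eq_intros mult_nonneg_nonneg\<close>)
    finally show ?thesis using True by (simp add: power_0_left)
  next
    case False
    have "emeasure ?N {..a} = (\<integral>\<^sup>+r. 0 \<partial>(lborel::real measure))"
      by (subst emeasure_density, simp_all) (use False in \<open>auto intro!: nn_integral_zero' AE_I2 split: split_indicator\<close>)
    with False show ?thesis by simp
  qed
  show "emeasure ?M X = emeasure ?N X" if "X \<in> range (\<lambda>a. {..a})" for X
    using that * ** by auto
  show "sets ?M = sigma_sets UNIV (range (\<lambda>a. {..a}))" "sets ?N = sigma_sets UNIV (range (\<lambda>a. {..a}))"
    by (simp_all add: borel_eq_atMost)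
  show "range (\<lambda>i::nat. {..real i}) \<subseteq> range (\<lambda>a. {..a})" by auto
  show "(\<Union>i::nat. {..real i}) = UNIV" by (auto intro: real_arch_simple)
  show "emeasure ?M {..real i} \<noteq> \<infinity>" for i unfolding * by simp
qed auto

lemma nn_integral_radial:
  fixes F :: "real \<Rightarrow> ennreal"
  assumes [measurable]: "F \<in> borel_measurable borel"
  shows "(\<integral>\<^sup>+x. F (norm (x::'a::euclidean_space)) \<partial>lborel)
   = ennreal (real DIM('a) * unit_ball_vol (real DIM('a))) * (\<integral>\<^sup>+r. ennreal (r powr (real DIM('a) - 1)) * F r * indicator {0..} r \<partial>lborel)"
proof -
  have "(\<integral>\<^sup>+x. F (norm (x::'a)) \<partial>lborel) = (\<integral>\<^sup>+r. F r \<partial>distr (lborel :: 'a measure) borel norm)"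
    by (simp add: nn_integral_distr)
  also have "\<dots> = (\<integral>\<^sup>+r. ennreal (real DIM('a) * unit_ball_vol (real DIM('a)) * r ^ (DIM('a) - 1)) * indicator {0..} r * F r \<partial>lborel)"
    unfolding distr_norm_lborel by (subst nn_integral_density) auto
  also have "\<dots> = (\<integral>\<^sup>+r. ennreal (real DIM('a) * unit_ball_vol (real DIM('a))) * (ennreal (r powr (real DIM('a) - 1)) * F r * indicator {0..} r) \<partial>lborel)"
  \<comment> \<open>The origin has to be excluded in dimension one, where \<open>r ^ 0\<close> is 1
    but \<open>0 powr 0\<close> is 0.\<close>
  proof (intro nn_integral_cong_AE, use AE_lborel_singleton[of "0::real"] in eventually_elim)
    fix r :: real assume "r \<noteq> 0"
    then have "r ^ (DIM('a) - 1) = r powr (real DIM('a) - 1)" if "0 \<le> r"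
      using that by (simp add: powr_realpow[symmetric] of_nat_diff)
    then show "ennreal (real DIM('a) * unit_ball_vol (real DIM('a)) * r ^ (DIM('a) - 1)) * indicator {0..} r * F r
       = ennreal (real DIM('a) * unit_ball_vol (real DIM('a))) * (ennreal (r powr (real DIM('a) - 1)) * F r * indicator {0..} r)"
      by (auto simp: ennreal_mult' mult_ac split: split_indicator)
  qed
  finally show ?thesis by (simp add: nn_integral_cmult)
qed

lemma nn_integral_norm_powr:
  assumes [measurable]: "A \<in> sets borel" and A: "A \<subseteq> {0..}" and I: "((\<lambda>r. r powr (q + real DIM('a) - 1)) has_integral I) A"
  shows "(\<integral>\<^sup>+x. ennreal (norm (x::'a::euclidean_space) powr q * indicator A (norm x)) \<partial>lborel)
    = ennreal (real DIM('a) * unit_ball_vol (real DIM('a)) * I)"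
proof -
  have "(\<integral>\<^sup>+x. ennreal (norm (x::'a::euclidean_space) powr q * indicator A (norm x)) \<partial>lborel) =
    ennreal (real DIM('a) * unit_ball_vol (real DIM('a))) * (\<integral>\<^sup>+r. ennreal (r powr (real DIM('a) - 1)) * ennreal (r powr q * indicator A r) * indicator {0..} r \<partial>lborel)"
    by (rule nn_integral_radial) auto
  also have "(\<integral>\<^sup>+r. ennreal (r powr (real DIM('a) - 1)) * ennreal (r powr q * indicator A r) * indicator {0..} r \<partial>lborel)
     = (\<integral>\<^sup>+r. ennreal (r powr (q + real DIM('a) - 1) * indicator A r) \<partial>lborel)"
    using A by (intro nn_integral_cong) (auto simp: ennreal_mult[symmetric] powr_add[symmetric] algebra_simps split: split_indicator)
  also have "\<dots> = ennreal I"
  proof (rule nn_integral_has_integral_lborel)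
    have "((\<lambda>x. if x \<in> A then x powr (q + real DIM('a) - 1) else 0) has_integral I) UNIV"
      using I by (simp only: has_integral_restrict_UNIV)
    then show "((\<lambda>x. x powr (q + real DIM('a) - 1) * indicator A x) has_integral I) UNIV"
      by (rule has_integral_eq[rotated]) (auto split: split_indicator)
  qed auto
  finally show ?thesis
    by (simp add: ennreal_mult' [symmetric] unit_ball_vol_nonneg)
qed

lemma nn_integral_norm_powr_near:
  assumes "- real DIM('a) < q" "0 \<le> R"
  shows "(\<integral>\<^sup>+x. ennreal (norm (x::'a::euclidean_space) powr q * indicator {0..R} (norm x)) \<partial>lborel)
    = ennreal (real DIM('a) * unit_ball_vol (real DIM('a)) * (R powr (q + real DIM('a)) / (q + real DIM('a))))"
  using assms has_integral_powr_from_0[of "q + real DIM('a) - 1" R]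
  by (intro nn_integral_norm_powr) auto

lemma nn_integral_norm_powr_far:
  assumes "q < - real DIM('a)" "0 < R"
  shows "(\<integral>\<^sup>+x. ennreal (norm (x::'a::euclidean_space) powr q * indicator {R..} (norm x)) \<partial>lborel)
    = ennreal (real DIM('a) * unit_ball_vol (real DIM('a)) * (R powr (q + real DIM('a)) / - (q + real DIM('a))))"
proof -
  have eq: "R powr (q + real DIM('a)) / - (q + real DIM('a)) = - (R powr (q + real DIM('a)) / (q + real DIM('a)))"
    by (rule minus_divide_right[symmetric])
  show ?thesis
    unfolding eq using assms has_integral_powr_to_inf[of "q + real DIM('a) - 1" R]
    by (intro nn_integral_norm_powr) auto
qed

lemma nn_integral_norm_powr_critical:
  assumes "q = - real DIM('a)" "0 < A" "A \<le> B"
  shows "(\<integral>\<^sup>+x. ennreal (norm (x::'a::euclidean_space) powr q * indicator {A..B} (norm x)) \<partial>lborel)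
    = ennreal (real DIM('a) * unit_ball_vol (real DIM('a)) * ln (B / A))"
proof (rule nn_integral_norm_powr)
  have "((\<lambda>r. r powr (- 1)) has_integral ln B - ln A) {A..B}"
    using assms by (intro fundamental_theorem_of_calculus)
      (auto simp: has_real_derivative_iff_has_vector_derivative[symmetric] powr_minus intro!: derivative_eq_intros simp: field_simps)
  then show "((\<lambda>r. r powr (q + real DIM('a) - 1)) has_integral ln (B / A)) {A..B}"
    using assms by (simp add: ln_div)
qed (use assms in auto)

text \<open>Split at |\<xi>| = \<delta>^(-1/2), where the two entries of the minimum agree. Low
  frequencies converge because \<alpha> < d, high ones because d - \<alpha> < 4H, and by scaling
  both contribute the same power of \<delta>.\<close>

lemma spectral_time_integral_le:
  assumes "0 \<le> \<alpha>" "\<alpha> < real DIM('a)" "real DIM('a) - \<alpha> < 4 * H" "0 < H"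
  shows "\<exists>C>0. \<forall>\<delta>>0. (\<integral>\<^sup>+\<xi>. ennreal (norm (\<xi>::'a::euclidean_space) powr (- \<alpha>) * min \<delta> (1 / (norm \<xi>)\<^sup>2) powr (2 * H)) \<partial>lborel)
     \<le> ennreal (C * \<delta> powr (2 * H - (real DIM('a) - \<alpha>) / 2))"
proof -
  let ?d = "real DIM('a)" and ?v = "real DIM('a) * unit_ball_vol (real DIM('a))"
  define C where "C = ?v / (?d - \<alpha>) + ?v / (\<alpha> + 4 * H - ?d)"
  have v: "0 < ?v" by simp
  then have C: "C > 0" using assms unfolding C_def by (intro add_pos_pos divide_pos_pos) auto
  have "(\<integral>\<^sup>+\<xi>. ennreal (norm (\<xi>::'a) powr (- \<alpha>) * min \<delta> (1 / (norm \<xi>)\<^sup>2) powr (2 * H)) \<partial>lborel)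
     \<le> ennreal (C * \<delta> powr (2 * H - (?d - \<alpha>) / 2))" if \<delta>: "0 < \<delta>" for \<delta>
  proof -
    define R where "R = \<delta> powr (- 1 / 2)"
    have R: "R > 0" using \<delta> by (simp add: R_def)
    have "(\<integral>\<^sup>+\<xi>. ennreal (norm (\<xi>::'a) powr (- \<alpha>) * min \<delta> (1 / (norm \<xi>)\<^sup>2) powr (2 * H)) \<partial>lborel)
      \<le> (\<integral>\<^sup>+\<xi>. ennreal (\<delta> powr (2 * H)) * ennreal (norm (\<xi>::'a) powr (- \<alpha>) * indicator {0..R} (norm \<xi>)) + ennreal (norm \<xi> powr (- \<alpha> - 4 * H) * indicator {R..} (norm \<xi>)) \<partial>lborel)"
    proof (intro nn_integral_mono)
      fix \<xi> :: 'a
      have "norm \<xi> powr (- \<alpha>) * min \<delta> (1 / (norm \<xi>)\<^sup>2) powr (2 * H) \<le>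
        \<delta> powr (2 * H) * (norm \<xi> powr (- \<alpha>) * indicator {0..R} (norm \<xi>)) + norm \<xi> powr (- \<alpha> - 4 * H) * indicator {R..} (norm \<xi>)"
      proof (cases "norm \<xi> \<le> R")
        case True
        have "norm \<xi> powr (- \<alpha>) * min \<delta> (1 / (norm \<xi>)\<^sup>2) powr (2 * H) \<le> norm \<xi> powr (- \<alpha>) * \<delta> powr (2 * H)"
          using \<delta> assms by (intro mult_left_mono powr_mono2) auto
        with True show ?thesis by (simp add: add_increasing2 mult_ac)
      next
        case False
        then have pos: "norm \<xi> > 0" using R by linarith
        have "min \<delta> (1 / (norm \<xi>)\<^sup>2) powr (2 * H) \<le> (1 / (norm \<xi>)\<^sup>2) powr (2 * H)"
          using \<delta> assms by (intro powr_mono2) auto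
        also have "(1 / (norm \<xi>)\<^sup>2) powr (2 * H) = (norm \<xi> powr (- 2)) powr (2 * H)"
          using pos by (simp add: powr_minus powr_numeral field_simps)
        also have "\<dots> = norm \<xi> powr (- 4 * H)" by (simp add: powr_powr)
        finally have "norm \<xi> powr (- \<alpha>) * min \<delta> (1 / (norm \<xi>)\<^sup>2) powr (2 * H) \<le> norm \<xi> powr (- \<alpha>) * norm \<xi> powr (- 4 * H)"
          by (rule mult_left_mono) auto
        also have "\<dots> = norm \<xi> powr (- \<alpha> - 4 * H)" by (simp flip: powr_add)
        finally show ?thesis using False by simp
      qed
      then show "ennreal (norm \<xi> powr (- \<alpha>) * min \<delta> (1 / (norm \<xi>)\<^sup>2) powr (2 * H)) \<le>
        ennreal (\<delta> powr (2 * H)) * ennreal (norm \<xi> powr (- \<alpha>) * indicator {0..R} (norm \<xi>)) + ennreal (norm \<xi> powr (- \<alpha> - 4 * H) * indicator {R..} (norm \<xi>))"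
        by (simp flip: ennreal_plus ennreal_mult)
    qed
    also have "\<dots> = ennreal (\<delta> powr (2 * H)) * ennreal (?v * (R powr (- \<alpha> + ?d) / (- \<alpha> + ?d))) + ennreal (?v * (R powr (- \<alpha> - 4 * H + ?d) / - (- \<alpha> - 4 * H + ?d)))"
      using assms R by (simp add: nn_integral_add nn_integral_cmult nn_integral_norm_powr_near nn_integral_norm_powr_far)
    also have "\<dots> = ennreal (\<delta> powr (2 * H) * (?v * (R powr (- \<alpha> + ?d) / (- \<alpha> + ?d))) + ?v * (R powr (- \<alpha> - 4 * H + ?d) / - (- \<alpha> - 4 * H + ?d)))"
      using assms v by (simp flip: ennreal_plus ennreal_mult)
    also have "\<delta> powr (2 * H) * (?v * (R powr (- \<alpha> + ?d) / (- \<alpha> + ?d))) + ?v * (R powr (- \<alpha> - 4 * H + ?d) / - (- \<alpha> - 4 * H + ?d)) = C * \<delta> powr (2 * H - (?d - \<alpha>) / 2)"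
    proof -
      have "R powr (- \<alpha> - 4 * H + ?d) = \<delta> powr (2 * H - (?d - \<alpha>) / 2)"
      proof -
        have "- 1 / 2 * (- \<alpha> - 4 * H + ?d) = 2 * H - (?d - \<alpha>) / 2" by (simp add: field_simps)
        then show ?thesis by (simp only: R_def powr_powr)
      qed
      moreover have "\<delta> powr (2 * H) * R powr (- \<alpha> + ?d) = \<delta> powr (2 * H - (?d - \<alpha>) / 2)"
      proof -
        have "2 * H + - 1 / 2 * (- \<alpha> + ?d) = 2 * H - (?d - \<alpha>) / 2" by (simp add: field_simps)
        then show ?thesis by (simp only: R_def powr_powr powr_add[symmetric])
      qed
      moreover have "\<delta> powr (2 * H) * (?v * (R powr (- \<alpha> + ?d) / (- \<alpha> + ?d))) = ?v / (?d - \<alpha>) * (\<delta> powr (2 * H) * R powr (- \<alpha> + ?d))"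
        by simp
      moreover have "?v * (R powr (- \<alpha> - 4 * H + ?d) / - (- \<alpha> - 4 * H + ?d)) = ?v / (\<alpha> + 4 * H - ?d) * R powr (- \<alpha> - 4 * H + ?d)"
      proof -
        have "- (- \<alpha> - 4 * H + ?d) = \<alpha> + 4 * H - ?d" by simp
        then show ?thesis by (simp only: times_divide_eq_left times_divide_eq_right)
      qed
      ultimately show ?thesis by (simp only: C_def distrib_right)
    qed
    finally show ?thesis .
  qed
  with C show ?thesis by blast
qed

text \<open>The indicator selects |\<xi>| >= sqrt (K / \<delta>), the range in which the cross terms
  of the temporal increment are negligible. There the integrand is a pure power of |\<xi>|, so the
  integral is an exact multiple of the power of \<delta>.\<close>

lemma spectral_time_integral_ge:
  assumes "0 \<le> \<alpha>" "real DIM('a) - \<alpha> < 4 * H" "0 < K"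
  shows "\<exists>c>0. \<forall>\<delta>>0. ennreal (c * \<delta> powr (2 * H - (real DIM('a) - \<alpha>) / 2)) \<le>
    (\<integral>\<^sup>+\<xi>. ennreal (norm (\<xi>::'a::euclidean_space) powr (- \<alpha>) * (indicator {K..} ((norm \<xi>)\<^sup>2 * \<delta>) * ((norm \<xi>)\<^sup>2) powr (- 2 * H))) \<partial>lborel)"
proof -
  let ?d = "real DIM('a)" and ?v = "real DIM('a) * unit_ball_vol (real DIM('a))"
  define q where "q = - \<alpha> - 4 * H"
  define c where "c = ?v * (K powr ((q + ?d) / 2) / - (q + ?d))"
  have q: "q + ?d < 0" using assms by (simp add: q_def)
  then have c: "c > 0" using assms unfolding c_def by (intro mult_pos_pos divide_pos_pos) auto
  have "ennreal (c * \<delta> powr (2 * H - (?d - \<alpha>) / 2)) \<le>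
    (\<integral>\<^sup>+\<xi>. ennreal (norm (\<xi>::'a) powr (- \<alpha>) * (indicator {K..} ((norm \<xi>)\<^sup>2 * \<delta>) * ((norm \<xi>)\<^sup>2) powr (- 2 * H))) \<partial>lborel)" if \<delta>: "0 < \<delta>" for \<delta>
  proof -
    define R where "R = sqrt (K / \<delta>)"
    have R: "R > 0" using \<delta> assms by (simp add: R_def)
    have "(\<integral>\<^sup>+\<xi>. ennreal (norm (\<xi>::'a) powr (- \<alpha>) * (indicator {K..} ((norm \<xi>)\<^sup>2 * \<delta>) * ((norm \<xi>)\<^sup>2) powr (- 2 * H))) \<partial>lborel)
      = (\<integral>\<^sup>+\<xi>. ennreal (norm (\<xi>::'a) powr q * indicator {R..} (norm \<xi>)) \<partial>lborel)"
    proof (intro nn_integral_cong arg_cong[where f=ennreal])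
      fix \<xi> :: 'a
      have "(K \<le> (norm \<xi>)\<^sup>2 * \<delta>) = (R \<le> norm \<xi>)"
      proof -
        have "(K \<le> (norm \<xi>)\<^sup>2 * \<delta>) = (K / \<delta> \<le> (norm \<xi>)\<^sup>2)" using \<delta> by (simp add: pos_divide_le_eq)
        also have "\<dots> = (R \<le> norm \<xi>)" using real_sqrt_le_iff[of "K / \<delta>" "(norm \<xi>)\<^sup>2"] by (simp add: R_def)
        finally show ?thesis .
      qed
      moreover have "norm \<xi> powr (- \<alpha>) * ((norm \<xi>)\<^sup>2) powr (- 2 * H) = norm \<xi> powr q"
        by (simp add: q_def powr_powr flip: powr_numeral powr_add)
      ultimately show "norm \<xi> powr (- \<alpha>) * (indicator {K..} ((norm \<xi>)\<^sup>2 * \<delta>) * ((norm \<xi>)\<^sup>2) powr (- 2 * H)) = norm \<xi> powr q * indicator {R..} (norm \<xi>)"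
        by (auto split: split_indicator)
    qed
    also have "\<dots> = ennreal (?v * (R powr (q + ?d) / - (q + ?d)))"
      using q R by (intro nn_integral_norm_powr_far) auto
    also have "?v * (R powr (q + ?d) / - (q + ?d)) = c * \<delta> powr (2 * H - (?d - \<alpha>) / 2)"
    proof -
      have "R powr (q + ?d) = K powr ((q + ?d) / 2) * \<delta> powr (- ((q + ?d) / 2))"
        using \<delta> assms by (simp add: R_def powr_half_sqrt[symmetric] powr_powr powr_divide powr_minus field_simps)
      moreover have "- ((q + ?d) / 2) = 2 * H - (?d - \<alpha>) / 2" by (simp add: q_def field_simps)
      ultimately show ?thesis by (simp add: c_def)
    qed
    finally show ?thesis by simp
  qed
  with c show ?thesis by blast
qed

text \<open>The spatial part of \<open>\<Theta>\<close> once D is the diameter 2 sqrt d M of the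
  cube. The factor e inside the logarithm keeps it at least 1 for all \<rho> <= D.\<close>

definition modulus :: "real \<Rightarrow> real \<Rightarrow> real \<Rightarrow> real" where
  "modulus D \<gamma> \<rho> = (if \<gamma> = 2 then ln (exp 1 * D / \<rho>) else 1) * \<rho> powr (min 2 \<gamma>)"

lemma modulus_log:
  fixes \<rho> D :: real
  assumes "0 < \<rho>" "\<rho> \<le> D"
  shows "ln (exp 1 * D / \<rho>) = 1 + ln (D / \<rho>)" "0 \<le> ln (D / \<rho>)"
proof -
  have "D > 0" using assms by simp
  then show "ln (exp 1 * D / \<rho>) = 1 + ln (D / \<rho>)"
    using assms ln_mult[of "exp 1" "D / \<rho>"] by simp
  show "0 \<le> ln (D / \<rho>)" using assms by (intro ln_ge_zero) simp
qed

text \<open>Contributions of order \<rho>^2 and \<rho>^\<gamma> are absorbed in this way: on a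
  bounded range the surplus power of \<rho> is traded for a power of D.\<close>

lemma powr_le_modulus:
  assumes \<rho>: "0 < \<rho>" "\<rho> \<le> D" and e: "min 2 \<gamma> \<le> e"
  shows "\<rho> powr e \<le> D powr (e - min 2 \<gamma>) * modulus D \<gamma> \<rho>"
proof -
  have "\<rho> powr e = \<rho> powr (e - min 2 \<gamma>) * \<rho> powr min 2 \<gamma>" by (simp flip: powr_add)
  also have "\<dots> \<le> D powr (e - min 2 \<gamma>) * (1 * \<rho> powr min 2 \<gamma>)"
    using \<rho> e by (auto intro!: mult_mono powr_mono2)
  also have "\<dots> \<le> D powr (e - min 2 \<gamma>) * modulus D \<gamma> \<rho>"
    unfolding modulus_def using modulus_log[OF \<rho>] by (intro mult_left_mono mult_right_mono) auto
  finally show ?thesis .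
qed

text \<open>In polar coordinates the integrand is r^(1 - \<gamma>). The integral is governed by the
  outer radius 1 / \<rho> if \<gamma> < 2 and by the inner radius 1 / D if \<gamma> > 2; at \<gamma>
  = 2 all scales contribute equally, and this is the origin of the logarithm.\<close>

lemma nn_integral_norm_powr_annulus_le:
  assumes D: "0 < D" and q: "q = - real DIM('a) - \<gamma>"
  shows "\<exists>C>0. \<forall>\<rho>. 0 < \<rho> \<longrightarrow> \<rho> \<le> D \<longrightarrow>
    (\<integral>\<^sup>+\<xi>. ennreal (norm (\<xi>::'a::euclidean_space) powr (2 + q) * indicator {1 / D..1 / \<rho>} (norm \<xi>)) \<partial>lborel)
      \<le> ennreal (C * (modulus D \<gamma> \<rho> / \<rho>\<^sup>2))"
proof -
  let ?v = "real DIM('a) * unit_ball_vol (real DIM('a))"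
  have v: "0 < ?v" by simp
  consider "\<gamma> < 2" | "\<gamma> = 2" | "\<gamma> > 2" by linarith
  then show ?thesis
  proof cases
    case 1
    have "(\<integral>\<^sup>+\<xi>. ennreal (norm (\<xi>::'a) powr (2 + q) * indicator {1 / D..1 / \<rho>} (norm \<xi>)) \<partial>lborel)
      \<le> ennreal (?v / (2 - \<gamma>) * (modulus D \<gamma> \<rho> / \<rho>\<^sup>2))" if \<rho>: "0 < \<rho>" "\<rho> \<le> D" for \<rho>
    proof -
      have "(\<integral>\<^sup>+\<xi>. ennreal (norm (\<xi>::'a) powr (2 + q) * indicator {1 / D..1 / \<rho>} (norm \<xi>)) \<partial>lborel)
        \<le> (\<integral>\<^sup>+\<xi>. ennreal (norm (\<xi>::'a) powr (2 + q) * indicator {0..1 / \<rho>} (norm \<xi>)) \<partial>lborel)"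
        by (intro nn_integral_mono ennreal_leI) (auto split: split_indicator)
      also have "\<dots> = ennreal (?v * ((1 / \<rho>) powr (2 + q + real DIM('a)) / (2 + q + real DIM('a))))"
        using 1 \<rho> by (intro nn_integral_norm_powr_near) (auto simp: q)
      also have "?v * ((1 / \<rho>) powr (2 + q + real DIM('a)) / (2 + q + real DIM('a))) = ?v / (2 - \<gamma>) * (modulus D \<gamma> \<rho> / \<rho>\<^sup>2)"
        using 1 \<rho> by (simp add: modulus_def q powr_divide powr_diff powr_numeral)
      finally show ?thesis by simp
    qed
    then show ?thesis using v 1 by (intro exI[of _ "?v / (2 - \<gamma>)"]) auto
  next
    case 2
    have "(\<integral>\<^sup>+\<xi>. ennreal (norm (\<xi>::'a) powr (2 + q) * indicator {1 / D..1 / \<rho>} (norm \<xi>)) \<partial>lborel)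
      \<le> ennreal (?v * (modulus D \<gamma> \<rho> / \<rho>\<^sup>2))" if \<rho>: "0 < \<rho>" "\<rho> \<le> D" for \<rho>
    proof -
      have "(\<integral>\<^sup>+\<xi>. ennreal (norm (\<xi>::'a) powr (2 + q) * indicator {1 / D..1 / \<rho>} (norm \<xi>)) \<partial>lborel)
        = ennreal (?v * ln ((1 / \<rho>) / (1 / D)))"
        using 2 \<rho> by (intro nn_integral_norm_powr_critical) (auto simp: q field_simps)
      also have "\<dots> \<le> ennreal (?v * (modulus D \<gamma> \<rho> / \<rho>\<^sup>2))"
        using 2 \<rho> v modulus_log[OF \<rho>] by (intro ennreal_leI mult_left_mono) (auto simp: modulus_def powr_numeral)
      finally show ?thesis .
    qed
    then show ?thesis using v by blast
  next
    case 3
    define C where "C = ?v * ((1 / D) powr (2 - \<gamma>) / (\<gamma> - 2))"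
    have "(\<integral>\<^sup>+\<xi>. ennreal (norm (\<xi>::'a) powr (2 + q) * indicator {1 / D..1 / \<rho>} (norm \<xi>)) \<partial>lborel)
      \<le> ennreal (C * (modulus D \<gamma> \<rho> / \<rho>\<^sup>2))" if \<rho>: "0 < \<rho>" "\<rho> \<le> D" for \<rho>
    proof -
      have "(\<integral>\<^sup>+\<xi>. ennreal (norm (\<xi>::'a) powr (2 + q) * indicator {1 / D..1 / \<rho>} (norm \<xi>)) \<partial>lborel)
        \<le> (\<integral>\<^sup>+\<xi>. ennreal (norm (\<xi>::'a) powr (2 + q) * indicator {1 / D..} (norm \<xi>)) \<partial>lborel)"
        by (intro nn_integral_mono ennreal_leI) (auto split: split_indicator)
      also have "\<dots> = ennreal (?v * ((1 / D) powr (2 + q + real DIM('a)) / - (2 + q + real DIM('a))))"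
        using 3 D by (intro nn_integral_norm_powr_far) (auto simp: q)
      also have "\<dots> = ennreal (C * (modulus D \<gamma> \<rho> / \<rho>\<^sup>2))"
        using 3 \<rho> by (simp add: modulus_def q C_def powr_numeral)
      finally show ?thesis .
    qed
    moreover have "C > 0" unfolding C_def using 3 D v by (intro mult_pos_pos divide_pos_pos) auto
    ultimately show ?thesis by blast
  qed
qed

text \<open>Three zones. Above 1 / \<rho> the oscillation factor is bounded by 1, below it by
  |\<xi>|^2 \<rho>^2. The further cut at 1 / D keeps away from the origin, where |\<xi>|^(-4H) may
  be too singular and the bound T^(2H) takes its place.\<close>

lemma spectral_space_integral_le:
  assumes \<alpha>: "0 \<le> \<alpha>" "\<alpha> < real DIM('a)" and \<gamma>: "\<gamma> = 4 * H - (real DIM('a) - \<alpha>)" "0 < \<gamma>"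
    and H: "0 < H" and D: "0 < D" and T: "0 < T"
  shows "\<exists>C>0. \<forall>\<rho>. 0 < \<rho> \<longrightarrow> \<rho> \<le> D \<longrightarrow>
    (\<integral>\<^sup>+\<xi>. ennreal (norm (\<xi>::'a::euclidean_space) powr (- \<alpha>) * (min T (1 / (norm \<xi>)\<^sup>2) powr (2 * H) * min 1 ((norm \<xi>)\<^sup>2 * \<rho>\<^sup>2))) \<partial>lborel)
      \<le> ennreal (C * modulus D \<gamma> \<rho>)"
proof -
  let ?d = "real DIM('a)" and ?v = "real DIM('a) * unit_ball_vol (real DIM('a))"
  have v: "0 < ?v" by simp
  define q where "q = - \<alpha> - 4 * H"
  have q: "q = - ?d - \<gamma>" using \<gamma> by (simp add: q_def)
  obtain C2 where C2: "C2 > 0" "\<And>\<rho>. 0 < \<rho> \<Longrightarrow> \<rho> \<le> D \<Longrightarrow>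
    (\<integral>\<^sup>+\<xi>. ennreal (norm (\<xi>::'a) powr (2 + q) * indicator {1 / D..1 / \<rho>} (norm \<xi>)) \<partial>lborel)
      \<le> ennreal (C2 * (modulus D \<gamma> \<rho> / \<rho>\<^sup>2))"
    using nn_integral_norm_powr_annulus_le[OF D q] by blast
  define A1 where "A1 = T powr (2 * H) * (?v * ((1 / D) powr (2 - \<alpha> + ?d) / (2 - \<alpha> + ?d)))"
  have A1: "A1 \<ge> 0" unfolding A1_def using \<alpha> v by (intro mult_nonneg_nonneg divide_nonneg_nonneg) auto
  define C where "C = A1 * D powr (2 - min 2 \<gamma>) + C2 + ?v / \<gamma> * D powr (\<gamma> - min 2 \<gamma>)"
  have C: "C > 0" using A1 C2 v \<gamma> D unfolding C_def by (intro add_nonneg_pos add_pos_pos mult_pos_pos divide_pos_pos) (auto intro!: add_nonneg_pos mult_nonneg_nonneg)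
  have "(\<integral>\<^sup>+\<xi>. ennreal (norm (\<xi>::'a) powr (- \<alpha>) * (min T (1 / (norm \<xi>)\<^sup>2) powr (2 * H) * min 1 ((norm \<xi>)\<^sup>2 * \<rho>\<^sup>2))) \<partial>lborel)
      \<le> ennreal (C * modulus D \<gamma> \<rho>)" if \<rho>: "0 < \<rho>" "\<rho> \<le> D" for \<rho>
  proof -
    have m0: "0 \<le> modulus D \<gamma> \<rho>" using modulus_log[OF \<rho>] by (simp add: modulus_def)
    let ?f1 = "\<lambda>\<xi>::'a. ennreal (norm \<xi> powr (2 - \<alpha>) * indicator {0..1 / D} (norm \<xi>))"
    let ?f2 = "\<lambda>\<xi>::'a. ennreal (norm \<xi> powr (2 + q) * indicator {1 / D..1 / \<rho>} (norm \<xi>))"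
    let ?f3 = "\<lambda>\<xi>::'a. ennreal (norm \<xi> powr q * indicator {1 / \<rho>..} (norm \<xi>))"
    have "(\<integral>\<^sup>+\<xi>. ennreal (norm (\<xi>::'a) powr (- \<alpha>) * (min T (1 / (norm \<xi>)\<^sup>2) powr (2 * H) * min 1 ((norm \<xi>)\<^sup>2 * \<rho>\<^sup>2))) \<partial>lborel)
      \<le> (\<integral>\<^sup>+\<xi>. ennreal (T powr (2 * H) * \<rho>\<^sup>2) * ?f1 \<xi> + (ennreal (\<rho>\<^sup>2) * ?f2 \<xi> + ?f3 \<xi>) \<partial>lborel)"
    proof (intro nn_integral_mono_AE, use AE_lborel_singleton[of "0::'a"] in eventually_elim)
      fix \<xi> :: 'a assume "\<xi> \<noteq> 0"
      then have n: "0 < norm \<xi>" by simp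
      let ?m = "min T (1 / (norm \<xi>)\<^sup>2) powr (2 * H)" and ?k = "min 1 ((norm \<xi>)\<^sup>2 * \<rho>\<^sup>2)"
      have m1: "?m \<le> T powr (2 * H)" using T H by (intro powr_mono2) auto
      have m2: "?m \<le> norm \<xi> powr (- 4 * H)"
      proof -
        have "?m \<le> (1 / (norm \<xi>)\<^sup>2) powr (2 * H)" using T H by (intro powr_mono2) auto
        also have "\<dots> = (norm \<xi> powr (- 2)) powr (2 * H)"
          using n by (simp add: powr_minus powr_numeral field_simps)
        also have "\<dots> = norm \<xi> powr (- 4 * H)" by (simp add: powr_powr)
        finally show ?thesis .
      qed
      have n2: "(norm \<xi>)\<^sup>2 = norm \<xi> powr 2" using n by (simp add: powr_numeral)
      have "norm \<xi> powr (- \<alpha>) * (?m * ?k) \<le> (T powr (2 * H) * \<rho>\<^sup>2) * (norm \<xi> powr (2 - \<alpha>) * indicator {0..1 / D} (norm \<xi>))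
        + (\<rho>\<^sup>2 * (norm \<xi> powr (2 + q) * indicator {1 / D..1 / \<rho>} (norm \<xi>)) + norm \<xi> powr q * indicator {1 / \<rho>..} (norm \<xi>))"
      proof -
        consider "norm \<xi> \<le> 1 / D" | "1 / D \<le> norm \<xi>" "norm \<xi> \<le> 1 / \<rho>" | "1 / \<rho> \<le> norm \<xi>" by linarith
        then show ?thesis
        proof cases
          case 1
          have "norm \<xi> powr (- \<alpha>) * (?m * ?k) \<le> norm \<xi> powr (- \<alpha>) * (T powr (2 * H) * ((norm \<xi>)\<^sup>2 * \<rho>\<^sup>2))"
            using m1 by (intro mult_left_mono mult_mono) auto
          also have "\<dots> = (T powr (2 * H) * \<rho>\<^sup>2) * norm \<xi> powr (2 - \<alpha>)"
            unfolding n2 by (simp add: powr_diff powr_minus field_simps)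
          finally show ?thesis using 1 by (simp add: add_increasing2)
        next
          case 2
          have "norm \<xi> powr (- \<alpha>) * (?m * ?k) \<le> norm \<xi> powr (- \<alpha>) * (norm \<xi> powr (- 4 * H) * ((norm \<xi>)\<^sup>2 * \<rho>\<^sup>2))"
            using m2 by (intro mult_left_mono mult_mono) auto
          also have "\<dots> = \<rho>\<^sup>2 * norm \<xi> powr (2 + q)"
            unfolding n2 q_def by (simp add: powr_diff powr_add powr_minus field_simps)
          finally show ?thesis using 2 by (simp add: add_increasing add_increasing2)
        next
          case 3
          have "norm \<xi> powr (- \<alpha>) * (?m * ?k) \<le> norm \<xi> powr (- \<alpha>) * (norm \<xi> powr (- 4 * H) * 1)"
            using m2 by (intro mult_left_mono mult_mono) auto
          also have "\<dots> = norm \<xi> powr q"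
            unfolding q_def by (simp flip: powr_add)
          finally show ?thesis using 3 by (simp add: add_increasing)
        qed
      qed
      then show "ennreal (norm \<xi> powr (- \<alpha>) * (?m * ?k)) \<le> ennreal (T powr (2 * H) * \<rho>\<^sup>2) * ?f1 \<xi> + (ennreal (\<rho>\<^sup>2) * ?f2 \<xi> + ?f3 \<xi>)"
        by (simp flip: ennreal_plus ennreal_mult)
    qed
    also have "\<dots> = ennreal (T powr (2 * H) * \<rho>\<^sup>2) * (\<integral>\<^sup>+\<xi>. ?f1 \<xi> \<partial>lborel) + (ennreal (\<rho>\<^sup>2) * (\<integral>\<^sup>+\<xi>. ?f2 \<xi> \<partial>lborel) + (\<integral>\<^sup>+\<xi>. ?f3 \<xi> \<partial>lborel))"
      by (simp add: nn_integral_add nn_integral_cmult)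
    also have "\<dots> \<le> ennreal (T powr (2 * H) * \<rho>\<^sup>2) * ennreal (?v * ((1 / D) powr (2 - \<alpha> + ?d) / (2 - \<alpha> + ?d)))
       + (ennreal (\<rho>\<^sup>2) * ennreal (C2 * (modulus D \<gamma> \<rho> / \<rho>\<^sup>2)) + ennreal (?v * ((1 / \<rho>) powr (q + ?d) / - (q + ?d))))"
    proof (intro add_mono mult_left_mono C2 \<rho>)
      show "(\<integral>\<^sup>+\<xi>. ?f1 \<xi> \<partial>lborel) \<le> ennreal (?v * ((1 / D) powr (2 - \<alpha> + ?d) / (2 - \<alpha> + ?d)))"
        using \<alpha> D by (subst nn_integral_norm_powr_near) auto
      show "(\<integral>\<^sup>+\<xi>. ?f3 \<xi> \<partial>lborel) \<le> ennreal (?v * ((1 / \<rho>) powr (q + ?d) / - (q + ?d)))"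
        using \<gamma> q \<rho> by (subst nn_integral_norm_powr_far) auto
    qed auto
    also have "\<dots> = ennreal (A1 * \<rho> powr 2 + C2 * modulus D \<gamma> \<rho> + ?v / \<gamma> * \<rho> powr \<gamma>)"
    proof -
      have "(1 / \<rho>) powr (q + ?d) / - (q + ?d) = \<rho> powr \<gamma> / \<gamma>"
        using \<rho> by (simp add: q powr_minus powr_divide field_simps)
      then have "ennreal (?v * ((1 / \<rho>) powr (q + ?d) / - (q + ?d))) = ennreal (?v / \<gamma> * \<rho> powr \<gamma>)" by simp
      moreover have "ennreal (T powr (2 * H) * \<rho>\<^sup>2) * ennreal (?v * ((1 / D) powr (2 - \<alpha> + ?d) / (2 - \<alpha> + ?d))) = ennreal (A1 * \<rho> powr 2)"
        using \<rho> by (subst ennreal_mult'[symmetric]) (auto simp: A1_def powr_numeral mult_ac)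
      moreover have "ennreal (\<rho>\<^sup>2) * ennreal (C2 * (modulus D \<gamma> \<rho> / \<rho>\<^sup>2)) = ennreal (C2 * modulus D \<gamma> \<rho>)"
        using \<rho> by (subst ennreal_mult'[symmetric]) auto
      moreover have "0 \<le> A1 * \<rho> powr 2" "0 \<le> C2 * modulus D \<gamma> \<rho>" "0 \<le> ?v / \<gamma> * \<rho> powr \<gamma>"
        using A1 \<gamma> v C2(1) m0 by auto
      ultimately show ?thesis by (simp only: ennreal_plus add_nonneg_nonneg add.assoc)
    qed
    also have "\<dots> \<le> ennreal (C * modulus D \<gamma> \<rho>)"
    proof (rule ennreal_leI)
      have "A1 * \<rho> powr 2 \<le> A1 * (D powr (2 - min 2 \<gamma>) * modulus D \<gamma> \<rho>)"
        using \<rho> A1 by (intro mult_left_mono powr_le_modulus) auto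
      moreover have "?v / \<gamma> * \<rho> powr \<gamma> \<le> ?v / \<gamma> * (D powr (\<gamma> - min 2 \<gamma>) * modulus D \<gamma> \<rho>)"
        using \<rho> \<gamma> v by (intro mult_left_mono powr_le_modulus) auto
      ultimately show "A1 * \<rho> powr 2 + C2 * modulus D \<gamma> \<rho> + ?v / \<gamma> * \<rho> powr \<gamma> \<le> C * modulus D \<gamma> \<rho>"
        unfolding C_def distrib_right mult.assoc by linarith
    qed
    finally show ?thesis .
  qed
  with C show ?thesis by blast
qed

section \<open>Bounds for 1 - cos and the lower bound for the spatial integral\<close>

lemma one_minus_cos_le: "1 - cos x \<le> 2 * min 1 (x\<^sup>2)" for x :: real
proof -
  have "1 - cos x = 2 * (sin (x / 2))\<^sup>2"
    using cos_double_sin[of "x / 2"] by simp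
  also have "(sin (x / 2))\<^sup>2 \<le> (x / 2)\<^sup>2"
    by (rule abs_le_square_iff[THEN iffD1]) (rule abs_sin_x_le_abs_x)
  finally have "1 - cos x \<le> 2 * x\<^sup>2" by (simp add: power_divide) (use zero_le_power2[of x] in linarith)
  moreover have "1 - cos x \<le> 2" using cos_ge_minus_one[of x] by linarith
  ultimately show ?thesis by (simp add: min_def)
qed

lemma one_minus_cos_ge:
  fixes x :: real
  assumes "0 \<le> x" "x \<le> 1"
  shows "x\<^sup>2 / 16 \<le> 1 - cos x"
proof -
  have "x / 4 \<le> sin (x / 2)"
  proof -
    have "\<bar>sin (x / 2) - x / 2\<bar> \<le> (x / 2) ^ 3 / 6"
      using Maclaurin_sin_bound[of "x / 2" 3] assms by (simp add: numeral_3_eq_3 sin_coeff_def fact_numeral)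
    moreover have "(x / 2) ^ 3 \<le> (x / 2) * 1"
      unfolding power3_eq_cube mult.assoc using assms by (intro mult_left_mono mult_le_one) auto
    ultimately show ?thesis using assms by linarith
  qed
  then have "(x / 4)\<^sup>2 \<le> (sin (x / 2))\<^sup>2"
    using assms by (intro power_mono) auto
  moreover have "1 - cos x = 2 * (sin (x / 2))\<^sup>2"
    using cos_double_sin[of "x / 2"] by simp
  moreover have "(x / 4)\<^sup>2 = x\<^sup>2 / 16" by (simp add: power_divide)
  ultimately show ?thesis using zero_le_power2[of x] by linarith
qed

text \<open>The factor 1 - cos (\<xi> . h) can vanish for \<xi> orthogonal to h, so the mass is
  collected on a ball centred on the ray through h. Centre 3R/2 and radius R/4 give R <= |\<xi>| <=
  2R and R |h| <= \<xi> . h <= 1, where 1 - cos is of the order (R |h|)^2 and all other factors are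
  comparable to powers of R.\<close>

lemma spectral_ball_ge:
  assumes \<alpha>: "0 \<le> \<alpha>" "\<alpha> < real DIM('a::euclidean_space)" and \<gamma>: "\<gamma> = 4 * H - (real DIM('a) - \<alpha>)"
    and H: "0 < H" and R0: "0 < R0" and t: "0 < t"
  shows "\<exists>c>0. \<forall>(h::'a) R. h \<noteq> 0 \<longrightarrow> R0 \<le> R \<longrightarrow> 2 * R * norm h \<le> 1 \<longrightarrow>
    ennreal (c * (R powr (2 - \<gamma>) * (norm h)\<^sup>2)) \<le>
    (\<integral>\<^sup>+\<xi>. ennreal (norm \<xi> powr (- \<alpha>) * (min t (1 / (norm \<xi>)\<^sup>2) powr (2 * H) * (1 - cos (\<xi> \<bullet> h))))
        * indicator (ball ((3 / 2 * R / norm h) *\<^sub>R h) (R / 4)) \<xi> \<partial>lborel)"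
proof -
  let ?d = "real DIM('a)"
  define \<omega> where "\<omega> = unit_ball_vol ?d"
  \<comment> \<open>Chosen so that \<open>a / R\<^sup>2\<close> lies below both entries of the
    minimum on the ball: t R0^2 <= t R^2 for the first, |\<xi>| <= 2R for the second.\<close>
  define a where "a = min (t * R0\<^sup>2) (1 / 4)"
  have a: "a > 0" using t R0 by (simp add: a_def)
  define c where "c = 2 powr (- \<alpha>) * (a powr (2 * H) * (1 / 16)) * (\<omega> * (1 / 4) powr ?d)"
  have c: "c > 0" unfolding c_def \<omega>_def using a by (intro mult_pos_pos) auto
  have "ennreal (c * (R powr (2 - \<gamma>) * (norm h)\<^sup>2)) \<le>
    (\<integral>\<^sup>+\<xi>. ennreal (norm \<xi> powr (- \<alpha>) * (min t (1 / (norm \<xi>)\<^sup>2) powr (2 * H) * (1 - cos (\<xi> \<bullet> h))))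
        * indicator (ball ((3 / 2 * R / norm h) *\<^sub>R h) (R / 4)) \<xi> \<partial>lborel)"
    if h: "h \<noteq> 0" and R: "R0 \<le> R" "2 * R * norm h \<le> 1" for h :: 'a and R
  proof -
    let ?B = "ball ((3 / 2 * R / norm h) *\<^sub>R h) (R / 4)"
    let ?K = "(2 * R) powr (- \<alpha>) * ((a / R\<^sup>2) powr (2 * H) * ((R * norm h)\<^sup>2 / 16))"
    have Rp: "0 < R" using R R0 by simp
    have "c * (R powr (2 - \<gamma>) * (norm h)\<^sup>2) = ?K * (\<omega> * (R / 4) ^ DIM('a))"
    proof -
      have "R powr (2 - \<gamma>) = R powr (- \<alpha>) * (R powr (- 4 * H) * R powr 2) * R powr ?d"
        unfolding \<gamma> by (simp add: algebra_simps flip: powr_add)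
      moreover have "(a / R\<^sup>2) powr (2 * H) = a powr (2 * H) * R powr (- 4 * H)"
      proof -
        have "(a / R\<^sup>2) powr (2 * H) = a powr (2 * H) / (R powr 2) powr (2 * H)"
          using a Rp by (simp add: powr_divide powr_numeral)
        then show ?thesis by (simp add: powr_powr powr_minus divide_inverse)
      qed
      moreover have "(R / 4) ^ DIM('a) = R powr ?d * (1 / 4) powr ?d"
        using Rp by (simp add: powr_realpow power_divide)
      moreover have "(2 * R) powr (- \<alpha>) = 2 powr (- \<alpha>) * R powr (- \<alpha>)" using Rp by (intro powr_mult)
      moreover have "(R * norm h)\<^sup>2 = R powr 2 * (norm h)\<^sup>2" using Rp by (simp add: power_mult_distrib powr_numeral)
      ultimately show ?thesis unfolding c_def by (simp only: mult_ac times_divide_eq_right times_divide_eq_left mult_1_left mult_1_right)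
    qed
    then have "ennreal (c * (R powr (2 - \<gamma>) * (norm h)\<^sup>2)) = ennreal ?K * emeasure lborel ?B"
    proof -
      have "ennreal (?K * (\<omega> * (R / 4) ^ DIM('a))) = ennreal ?K * ennreal (\<omega> * (R / 4) ^ DIM('a))"
        by (rule ennreal_mult') simp
      moreover have "emeasure lborel ?B = ennreal (\<omega> * (R / 4) ^ DIM('a))"
        unfolding \<omega>_def using Rp by (intro emeasure_ball) simp
      ultimately show ?thesis using \<open>c * (R powr (2 - \<gamma>) * (norm h)\<^sup>2) = ?K * (\<omega> * (R / 4) ^ DIM('a))\<close> by (simp only:)
    qed
    also have "\<dots> = (\<integral>\<^sup>+\<xi>. ennreal ?K * indicator ?B \<xi> \<partial>lborel)"
      by (rule nn_integral_cmult_indicator[symmetric]) simp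
    also have "\<dots> \<le> (\<integral>\<^sup>+\<xi>. ennreal (norm \<xi> powr (- \<alpha>) * (min t (1 / (norm \<xi>)\<^sup>2) powr (2 * H) * (1 - cos (\<xi> \<bullet> h)))) * indicator ?B \<xi> \<partial>lborel)"
    proof (intro nn_integral_mono)
      fix \<xi> :: 'a
      have "?K \<le> norm \<xi> powr (- \<alpha>) * (min t (1 / (norm \<xi>)\<^sup>2) powr (2 * H) * (1 - cos (\<xi> \<bullet> h)))" if "\<xi> \<in> ?B"
      proof -
        define z where "z = (3 / 2 * R / norm h) *\<^sub>R h"
        have z: "norm (\<xi> - z) < R / 4" using that by (simp add: z_def dist_norm norm_minus_commute)
        have nz: "norm z = 3 / 2 * R" using h Rp by (simp add: z_def)
        have n1: "norm \<xi> \<le> 2 * R" using norm_triangle_ineq[of "\<xi> - z" z] z nz Rp by simp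
        have n2: "R \<le> norm \<xi>" using norm_triangle_ineq2[of z "z - \<xi>"] z nz Rp by (simp add: norm_minus_commute)
        have zh: "z \<bullet> h = 3 / 2 * R * norm h"
          using h by (simp add: z_def power2_norm_eq_inner[symmetric] power2_eq_square)
        have "\<bar>(\<xi> - z) \<bullet> h\<bar> \<le> norm (\<xi> - z) * norm h" by (rule Cauchy_Schwarz_ineq2)
        also have "\<dots> \<le> R / 4 * norm h" using z by (intro mult_right_mono) auto
        finally have "\<bar>\<xi> \<bullet> h - 3 / 2 * R * norm h\<bar> \<le> R / 4 * norm h" by (simp add: inner_diff_left zh)
        moreover have "0 \<le> R * norm h" using Rp by simp
        ultimately have xh: "R * norm h \<le> \<xi> \<bullet> h" "\<xi> \<bullet> h \<le> 1" using R(2) by linarith+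
        have "(R * norm h)\<^sup>2 / 16 \<le> (\<xi> \<bullet> h)\<^sup>2 / 16"
          using xh Rp by (intro divide_right_mono power_mono) auto
        also have "\<dots> \<le> 1 - cos (\<xi> \<bullet> h)"
          using xh \<open>0 \<le> R * norm h\<close> by (intro one_minus_cos_ge) linarith+
        finally have 1: "(R * norm h)\<^sup>2 / 16 \<le> 1 - cos (\<xi> \<bullet> h)" .
        have "a / R\<^sup>2 \<le> min t (1 / (norm \<xi>)\<^sup>2)"
        proof (rule min.boundedI)
          have "a \<le> t * R\<^sup>2"
          proof -
            have "t * R0\<^sup>2 \<le> t * R\<^sup>2" using t R R0 by (intro mult_left_mono power_mono) auto
            then show ?thesis by (simp add: a_def)
          qed
          then show "a / R\<^sup>2 \<le> t" using Rp by (simp add: pos_divide_le_eq)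
          have "(norm \<xi>)\<^sup>2 \<le> (2 * R)\<^sup>2" using n1 by (intro power_mono) auto
          then have "1 / (2 * R)\<^sup>2 \<le> 1 / (norm \<xi>)\<^sup>2" using n2 Rp order.strict_trans2[OF Rp n2] by (intro divide_left_mono) (auto intro!: mult_pos_pos)
          moreover have "a / R\<^sup>2 \<le> (1 / 4) / R\<^sup>2" by (intro divide_right_mono) (auto simp: a_def)
          ultimately show "a / R\<^sup>2 \<le> 1 / (norm \<xi>)\<^sup>2" by (simp add: power_mult_distrib)
        qed
        then have 2: "(a / R\<^sup>2) powr (2 * H) \<le> min t (1 / (norm \<xi>)\<^sup>2) powr (2 * H)"
          using a H by (intro powr_mono2) auto
        have 3: "(2 * R) powr (- \<alpha>) \<le> norm \<xi> powr (- \<alpha>)"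
          using \<alpha> n1 n2 Rp by (intro powr_mono2') auto
        from 1 2 3 show ?thesis by (intro mult_mono) auto
      qed
      then show "ennreal ?K * indicator ?B \<xi> \<le> ennreal (norm \<xi> powr (- \<alpha>) * (min t (1 / (norm \<xi>)\<^sup>2) powr (2 * H) * (1 - cos (\<xi> \<bullet> h)))) * indicator ?B \<xi>"
        by (auto split: split_indicator intro!: ennreal_leI)
    qed
    finally show ?thesis .
  qed
  with c show ?thesis by blast
qed

text \<open>A ball of scale R contributes R^(2 - \<gamma>) |h|^2. For \<gamma> < 2 the largest
  admissible scale 1 / (2 |h|) suffices, for \<gamma> > 2 the fixed scale \<open>R0\<close>. At
  \<gamma> = 2 every scale contributes the same amount, and a disjoint dyadic family of about log (D
  / |h|) balls produces the logarithm.\<close>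

lemma spectral_space_integral_ge:
  assumes \<alpha>: "0 \<le> \<alpha>" "\<alpha> < real DIM('a)" and \<gamma>: "\<gamma> = 4 * H - (real DIM('a) - \<alpha>)"
    and H: "0 < H" and D: "0 < D" and t: "0 < t"
  shows "\<exists>c>0. \<forall>h::'a::euclidean_space. h \<noteq> 0 \<longrightarrow> norm h \<le> D \<longrightarrow> ennreal (c * modulus D \<gamma> (norm h)) \<le>
    (\<integral>\<^sup>+\<xi>. ennreal (norm \<xi> powr (- \<alpha>) * (min t (1 / (norm \<xi>)\<^sup>2) powr (2 * H) * (1 - cos (\<xi> \<bullet> h)))) \<partial>lborel)"
proof -
  let ?f = "\<lambda>h \<xi>. ennreal (norm \<xi> powr (- \<alpha>) * (min t (1 / (norm \<xi>)\<^sup>2) powr (2 * H) * (1 - cos (\<xi> \<bullet> h))))"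
  let ?B = "\<lambda>(h::'a) R. ball ((3 / 2 * R / norm h) *\<^sub>R h) (R / 4)"
  \<comment> \<open>The largest scale that is admissible simultaneously for all |h| <= D.\<close>
  define R0 where "R0 = 1 / (2 * D)"
  have R0: "R0 > 0" using D by (simp add: R0_def)
  obtain c where c: "c > 0" and ball: "\<And>(h::'a) R. h \<noteq> 0 \<Longrightarrow> R0 \<le> R \<Longrightarrow> 2 * R * norm h \<le> 1 \<Longrightarrow>
    ennreal (c * (R powr (2 - \<gamma>) * (norm h)\<^sup>2)) \<le> (\<integral>\<^sup>+\<xi>. ?f h \<xi> * indicator (?B h R) \<xi> \<partial>lborel)"
    using spectral_ball_ge[OF \<alpha> \<gamma> H R0 t] by blast
  have le: "(\<integral>\<^sup>+\<xi>. ?f h \<xi> * indicator A \<xi> \<partial>lborel) \<le> (\<integral>\<^sup>+\<xi>. ?f h \<xi> \<partial>lborel)" for h :: 'a and A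
    by (intro nn_integral_mono) (auto split: split_indicator)
  consider "\<gamma> < 2" | "\<gamma> = 2" | "\<gamma> > 2" by linarith
  then show ?thesis
  proof cases
    case 1
    have "ennreal (c * 2 powr (\<gamma> - 2) * modulus D \<gamma> (norm h)) \<le> (\<integral>\<^sup>+\<xi>. ?f h \<xi> \<partial>lborel)" if h: "h \<noteq> 0" "norm h \<le> D" for h :: 'a
    proof -
      let ?R = "1 / (2 * norm h)"
      have "2 powr (\<gamma> - 2) * modulus D \<gamma> (norm h) = ?R powr (2 - \<gamma>) * (norm h)\<^sup>2"
        using h 1 by (simp add: modulus_def powr_divide powr_mult powr_diff powr_numeral)
      then have "ennreal (c * 2 powr (\<gamma> - 2) * modulus D \<gamma> (norm h)) = ennreal (c * (?R powr (2 - \<gamma>) * (norm h)\<^sup>2))"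
        by (simp add: mult.assoc)
      also have "\<dots> \<le> (\<integral>\<^sup>+\<xi>. ?f h \<xi> * indicator (?B h ?R) \<xi> \<partial>lborel)"
        using h D by (intro ball) (auto simp: R0_def field_simps)
      finally show ?thesis using le by (rule order_trans)
    qed
    with c show ?thesis by (intro exI[of _ "c * 2 powr (\<gamma> - 2)"]) auto
  next
    case 3
    have "ennreal (c * R0 powr (2 - \<gamma>) * modulus D \<gamma> (norm h)) \<le> (\<integral>\<^sup>+\<xi>. ?f h \<xi> \<partial>lborel)" if h: "h \<noteq> 0" "norm h \<le> D" for h :: 'a
    proof -
      have "ennreal (c * R0 powr (2 - \<gamma>) * modulus D \<gamma> (norm h)) = ennreal (c * (R0 powr (2 - \<gamma>) * (norm h)\<^sup>2))"
        using 3 h by (simp add: modulus_def powr_numeral mult.assoc)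
      also have "\<dots> \<le> (\<integral>\<^sup>+\<xi>. ?f h \<xi> * indicator (?B h R0) \<xi> \<partial>lborel)"
        using h D by (intro ball) (auto simp: R0_def field_simps)
      finally show ?thesis using le by (rule order_trans)
    qed
    with c R0 show ?thesis by (intro exI[of _ "c * R0 powr (2 - \<gamma>)"]) auto
  next
    case 2
    have "ennreal (c / 2 * modulus D \<gamma> (norm h)) \<le> (\<integral>\<^sup>+\<xi>. ?f h \<xi> \<partial>lborel)" if h: "h \<noteq> 0" "norm h \<le> D" for h :: 'a
    proof -
      let ?\<rho> = "norm h"
      have \<rho>: "0 < ?\<rho>" using h by simp
      \<comment> \<open>The scale R0 2^k satisfies the admissibility condition exactly as long as
        2^k <= D / |h|, so the indices 0, ..., N give N + 1 balls.\<close>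
      define N where "N = nat \<lfloor>log 2 (D / ?\<rho>)\<rfloor>"
      have L0: "0 \<le> log 2 (D / ?\<rho>)" using modulus_log(2)[OF \<rho> h(2)] by (simp add: log_def)
      have N: "real N \<le> log 2 (D / ?\<rho>)" "log 2 (D / ?\<rho>) < real N + 1"
        using L0 by (auto simp: N_def) 
      have pN: "2 ^ k \<le> D / ?\<rho>" if "k \<le> N" for k
      proof -
        have "real k \<le> log 2 (D / ?\<rho>)" using that N by linarith
        then have "2 powr real k \<le> D / ?\<rho>" using D \<rho> by (subst (asm) le_log_iff) auto
        then show ?thesis by (simp add: powr_realpow)
      qed
      define R where "R k = R0 * 2 ^ k" for k :: nat
      have Rk: "R0 \<le> R k" "2 * R k * ?\<rho> \<le> 1" if "k \<le> N" for k
      proof -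
        show "R0 \<le> R k" using R0 by (simp add: R_def)
        show "2 * R k * ?\<rho> \<le> 1" using pN[OF that] D \<rho> by (simp add: R_def R0_def field_simps)
      qed
      have Rp: "R k > 0" for k using R0 by (simp add: R_def)
      \<comment> \<open>The centres lie on one ray at distance 3/2 (R k - R j), which is at least
        3/4 R k, whereas the radii add up to at most 3/8 R k.\<close>
      have disj: "?B h (R j) \<inter> ?B h (R k) = {}" if "j < k" for j k
      proof (rule disjoint_ballI)
        have "2 * 2 ^ j \<le> (2::real) ^ k" using that power_increasing[of "Suc j" k "2::real"] by simp
        then have "2 * R j \<le> R k" using R0 by (simp add: R_def)
        moreover have "dist ((3 / 2 * R j / ?\<rho>) *\<^sub>R h) ((3 / 2 * R k / ?\<rho>) *\<^sub>R h) = \<bar>3 / 2 * R j - 3 / 2 * R k\<bar>"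
          using \<rho> by (simp add: dist_norm flip: scaleR_diff_left) (simp add: field_simps flip: abs_mult_pos)
        ultimately show "R j / 4 + R k / 4 \<le> dist ((3 / 2 * R j / ?\<rho>) *\<^sub>R h) ((3 / 2 * R k / ?\<rho>) *\<^sub>R h)"
          using Rp[of j] by linarith
      qed
      \<comment> \<open>N + 1 exceeds both 1 and ln (D / |h|) up to equality; averaging the two
        bounds dominates (1 + ln (D / |h|)) / 2, whence the factor 1/2.\<close>
      have "c / 2 * modulus D \<gamma> ?\<rho> \<le> (\<Sum>k\<le>N. c * (R k powr (2 - \<gamma>) * ?\<rho>\<^sup>2))"
      proof -
        have "ln (D / ?\<rho>) \<le> log 2 (D / ?\<rho>)"
        proof -
          have "ln (D / ?\<rho>) * ln 2 \<le> ln (D / ?\<rho>)" using modulus_log(2)[OF \<rho> h(2)] ln_2_less_1 by (intro mult_left_le) auto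
          then show ?thesis by (simp add: log_def field_simps)
        qed
        moreover have "x \<le> y \<Longrightarrow> y < n + 1 \<Longrightarrow> 0 \<le> n \<Longrightarrow> (1 + x) / 2 \<le> n + 1" for x y n :: real
          by (simp add: field_simps)
        ultimately have "(1 + ln (D / ?\<rho>)) / 2 \<le> real N + 1" using N(2) of_nat_0_le_iff by blast
        then have "(c * ?\<rho>\<^sup>2) * ((1 + ln (D / ?\<rho>)) / 2) \<le> (c * ?\<rho>\<^sup>2) * (real N + 1)"
          using c by (intro mult_left_mono) auto
        then show ?thesis using 2 R0 \<rho> modulus_log[OF \<rho> h(2)]
          by (simp add: modulus_def R_def powr_numeral algebra_simps)
      qed
      then have "ennreal (c / 2 * modulus D \<gamma> ?\<rho>) \<le> ennreal (\<Sum>k\<le>N. c * (R k powr (2 - \<gamma>) * ?\<rho>\<^sup>2))"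
        by (rule ennreal_leI)
      also have "\<dots> = (\<Sum>k\<le>N. ennreal (c * (R k powr (2 - \<gamma>) * ?\<rho>\<^sup>2)))"
        using c by (intro sum_ennreal[symmetric]) auto
      also have "\<dots> \<le> (\<Sum>k\<le>N. \<integral>\<^sup>+\<xi>. ?f h \<xi> * indicator (?B h (R k)) \<xi> \<partial>lborel)"
        using Rk h by (intro sum_mono ball) auto
      also have "\<dots> = (\<integral>\<^sup>+\<xi>. (\<Sum>k\<le>N. ?f h \<xi> * indicator (?B h (R k)) \<xi>) \<partial>lborel)"
      proof (rule nn_integral_sum[symmetric])
        have [measurable]: "?B h (R k) \<in> sets borel" for k by (intro borel_open open_ball)
        show "(\<lambda>\<xi>. ?f h \<xi> * indicator (?B h (R k)) \<xi>) \<in> borel_measurable lborel" for k by measurable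
      qed
      also have "\<dots> \<le> (\<integral>\<^sup>+\<xi>. ?f h \<xi> \<partial>lborel)"
      proof (intro nn_integral_mono)
        fix \<xi> :: 'a
        have d: "disjoint_family_on (\<lambda>k. ?B h (R k)) {..N}"
          unfolding disjoint_family_on_def
        proof (intro ballI impI)
          fix j k :: nat assume "j \<noteq> k"
          then consider "j < k" | "k < j" by linarith
          then show "?B h (R j) \<inter> ?B h (R k) = {}" using disj[of j k] disj[of k j] by cases (simp_all only: Int_commute)
        qed
        have "(indicator (\<Union>k\<in>{..N}. ?B h (R k)) \<xi> :: ennreal) = (\<Sum>k\<le>N. indicator (?B h (R k)) \<xi>)"
          by (rule indicator_UN_disjoint[OF _ d]) simp
        then have "(\<Sum>k\<le>N. ?f h \<xi> * indicator (?B h (R k)) \<xi>) = ?f h \<xi> * indicator (\<Union>k\<in>{..N}. ?B h (R k)) \<xi>"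
          by (simp only: sum_distrib_left)
        also have "\<dots> \<le> ?f h \<xi>" by (auto split: split_indicator)
        finally show "(\<Sum>k\<le>N. ?f h \<xi> * indicator (?B h (R k)) \<xi>) \<le> ?f h \<xi>" .
      qed
      finally show ?thesis .
    qed
    with c show ?thesis by (intro exI[of _ "c / 2"]) auto
  qed
qed

section \<open>Positivity of the fractional kernel\<close>

text \<open>The value at distance 1 of the convolution of |u|^(-p) with itself: the constant in the
  composition formula for Riesz kernels.\<close>

definition riesz_constant :: "real \<Rightarrow> ennreal" where
  "riesz_constant p = (\<integral>\<^sup>+ u. ennreal (\<bar>u\<bar> powr (- p) * \<bar>1 - u\<bar> powr (- p)) \<partial>lborel)"

text \<open>The bound p < 1 makes the singularities at 0 and 1 integrable, and 2p > 1 the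
  tail.\<close>

lemma riesz_constant_finite:
  assumes p: "1 / 2 < p" "p < 1"
  shows "riesz_constant p < \<infinity>"
proof -
  let ?n = "\<lambda>u::real. 2 powr p * (\<bar>u\<bar> powr (- p) * indicator {0..1/2} \<bar>u\<bar>)"
  let ?f = "\<lambda>u::real. \<bar>u\<bar> powr (- 2 * p) * indicator {1/2..} \<bar>u\<bar>"
  \<comment> \<open>Symmetry between u and v = 1 - u halves the work. If one of them is small the
    other is at least 1/2 in absolute value; if neither is, the inequality 2ab <= a^2 + b^2
    separates the product into functions of one variable.\<close>
  have pw: "\<bar>u\<bar> powr (- p) * \<bar>v\<bar> powr (- p) \<le> ?n u + ?n v + ?f u + ?f v" if uv: "u + v = 1" for u v :: real
  proof -
    have big: "x powr (- p) \<le> 2 powr p" if "1 / 2 \<le> x" for x :: real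
    proof -
      have "x powr (- p) \<le> (1 / 2) powr (- p)" using that p by (intro powr_mono2') auto
      then show ?thesis by (simp add: powr_minus powr_divide)
    qed
    have nn: "0 \<le> ?n w" "0 \<le> ?f w" for w by simp_all
    consider "\<bar>u\<bar> \<le> 1 / 2" | "\<bar>v\<bar> \<le> 1 / 2" | "1 / 2 < \<bar>u\<bar>" "1 / 2 < \<bar>v\<bar>" by linarith
    then show ?thesis
    proof cases
      case 1
      then have "1 / 2 \<le> \<bar>v\<bar>" using uv by linarith
      then have "\<bar>u\<bar> powr (- p) * \<bar>v\<bar> powr (- p) \<le> \<bar>u\<bar> powr (- p) * 2 powr p"
        by (intro mult_left_mono big) auto
      also have "\<dots> = ?n u" using 1 by simp
      finally show ?thesis using nn[of u] nn[of v] by linarith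
    next
      case 2
      then have "1 / 2 \<le> \<bar>u\<bar>" using uv by linarith
      then have "\<bar>u\<bar> powr (- p) * \<bar>v\<bar> powr (- p) \<le> 2 powr p * \<bar>v\<bar> powr (- p)"
        by (intro mult_right_mono big) auto
      also have "\<dots> = ?n v" using 2 by simp
      finally show ?thesis using nn[of u] nn[of v] by linarith
    next
      case 3
      have sq: "x powr (- p) * x powr (- p) = x powr (- 2 * p)" for x :: real by (simp flip: powr_add)
      have "\<bar>u\<bar> powr (- p) * \<bar>v\<bar> powr (- p) \<le> \<bar>u\<bar> powr (- p) * \<bar>u\<bar> powr (- p) + \<bar>v\<bar> powr (- p) * \<bar>v\<bar> powr (- p)"
      proof -
        have "2 * (\<bar>u\<bar> powr (- p) * \<bar>v\<bar> powr (- p)) \<le> \<bar>u\<bar> powr (- p) * \<bar>u\<bar> powr (- p) + \<bar>v\<bar> powr (- p) * \<bar>v\<bar> powr (- p)"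
          using sum_squares_bound[of "\<bar>u\<bar> powr (- p)" "\<bar>v\<bar> powr (- p)"] by (simp only: power2_eq_square mult.assoc)
        moreover have "0 \<le> \<bar>u\<bar> powr (- p) * \<bar>v\<bar> powr (- p)" by simp
        ultimately show ?thesis by linarith
      qed
      also have "\<dots> = ?f u + ?f v" using 3 by (simp add: sq)
      finally show ?thesis using nn[of u] nn[of v] by linarith
    qed
  qed
  have near: "(\<integral>\<^sup>+ u. ennreal (\<bar>u\<bar> powr (- p) * indicator {0..1/2} \<bar>u\<bar>) \<partial>lborel) < \<infinity>"
    using nn_integral_norm_powr_near[where 'a=real, of "- p" "1/2"] p by simp
  have far: "(\<integral>\<^sup>+ u. ennreal (?f u) \<partial>lborel) < \<infinity>"
    using nn_integral_norm_powr_far[where 'a=real, of "- 2 * p" "1/2"] p by simp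
  have near': "(\<integral>\<^sup>+ u. ennreal (?n u) \<partial>lborel) < \<infinity>"
    using near by (simp add: ennreal_mult nn_integral_cmult ennreal_mult_less_top)
  have refl: "(\<integral>\<^sup>+ u. F (1 - u) \<partial>lborel) = (\<integral>\<^sup>+ u. F u \<partial>lborel)" if "F \<in> borel_measurable borel" for F :: "real \<Rightarrow> ennreal"
    using nn_integral_lborel_shift_reflect[OF that, of 1] .
  have "riesz_constant p \<le> (\<integral>\<^sup>+ u. ennreal (?n u) + ennreal (?n (1 - u)) + ennreal (?f u) + ennreal (?f (1 - u)) \<partial>lborel)"
    unfolding riesz_constant_def
    by (intro nn_integral_mono) (use pw[of _ "1 - _"] in \<open>simp flip: ennreal_plus\<close>)
  also have "\<dots> = (\<integral>\<^sup>+ u. ennreal (?n u) \<partial>lborel) + (\<integral>\<^sup>+ u. ennreal (?n (1 - u)) \<partial>lborel) + (\<integral>\<^sup>+ u. ennreal (?f u) \<partial>lborel) + (\<integral>\<^sup>+ u. ennreal (?f (1 - u)) \<partial>lborel)"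
    by (simp add: nn_integral_add)
  also have "(\<integral>\<^sup>+ u. ennreal (?n (1 - u)) \<partial>lborel) = (\<integral>\<^sup>+ u. ennreal (?n u) \<partial>lborel)"
    by (rule refl) measurable
  also have "(\<integral>\<^sup>+ u. ennreal (?f (1 - u)) \<partial>lborel) = (\<integral>\<^sup>+ u. ennreal (?f u) \<partial>lborel)"
    by (rule refl) measurable
  also have "(\<integral>\<^sup>+ u. ennreal (?n u) \<partial>lborel) + (\<integral>\<^sup>+ u. ennreal (?n u) \<partial>lborel) + (\<integral>\<^sup>+ u. ennreal (?f u) \<partial>lborel) + (\<integral>\<^sup>+ u. ennreal (?f u) \<partial>lborel) < \<infinity>"
    using near' far by (simp add: ennreal_add_less_top)
  finally show ?thesis .
qed

lemma riesz_constant_pos: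
  assumes p: "0 \<le> p"
  shows "riesz_constant p \<noteq> 0"
proof -
  have "(1::ennreal) = (\<integral>\<^sup>+ u. indicator {0<..<1::real} u \<partial>lborel)" by simp
  also have "\<dots> \<le> riesz_constant p"
    unfolding riesz_constant_def
  proof (intro nn_integral_mono)
    fix u :: real
    have "1 \<le> x powr (- p)" if "0 < x" "x < 1" for x :: real
      using powr_mono2'[of "- p" x 1] that p by simp
    then have "1 * 1 \<le> \<bar>u\<bar> powr (- p) * \<bar>1 - u\<bar> powr (- p)" if "0 < u" "u < 1"
      using that by (intro mult_mono) auto
    then show "indicator {0<..<1} u \<le> ennreal (\<bar>u\<bar> powr (- p) * \<bar>1 - u\<bar> powr (- p))"
      by (auto split: split_indicator simp: ennreal_ge_1)
  qed
  finally show ?thesis by auto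
qed

text \<open>The substitution r = \<tau> + (\<sigma> - \<tau>) u moves the singularities to 0 and 1,
  and homogeneity gives the power. For p = 3/2 - H the exponent 1 - 2p is 2H - 2, so this exhibits a
  square root of the fractional kernel.\<close>

lemma riesz_composition:
  assumes "\<tau> \<noteq> \<sigma>"
  shows "(\<integral>\<^sup>+ r. ennreal (\<bar>\<tau> - r\<bar> powr (- p) * \<bar>\<sigma> - r\<bar> powr (- p)) \<partial>lborel) = riesz_constant p * ennreal (\<bar>\<tau> - \<sigma>\<bar> powr (1 - 2 * p))"
proof -
  define \<delta> where "\<delta> = \<sigma> - \<tau>"
  have \<delta>: "\<delta> \<noteq> 0" using assms by (simp add: \<delta>_def)
  have "(\<integral>\<^sup>+ r. ennreal (\<bar>\<tau> - r\<bar> powr (- p) * \<bar>\<sigma> - r\<bar> powr (- p)) \<partial>lborel)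
    = ennreal \<bar>\<delta>\<bar> * (\<integral>\<^sup>+ u. ennreal (\<bar>\<tau> - (\<tau> + \<delta> * u)\<bar> powr (- p) * \<bar>\<sigma> - (\<tau> + \<delta> * u)\<bar> powr (- p)) \<partial>lborel)"
    using \<delta> by (intro nn_integral_real_affine) auto
  also have "(\<integral>\<^sup>+ u. ennreal (\<bar>\<tau> - (\<tau> + \<delta> * u)\<bar> powr (- p) * \<bar>\<sigma> - (\<tau> + \<delta> * u)\<bar> powr (- p)) \<partial>lborel)
    = (\<integral>\<^sup>+ u. ennreal (\<bar>\<delta>\<bar> powr (- 2 * p)) * ennreal (\<bar>u\<bar> powr (- p) * \<bar>1 - u\<bar> powr (- p)) \<partial>lborel)"
  proof (intro nn_integral_cong)
    fix u
    have "\<sigma> - (\<tau> + \<delta> * u) = \<delta> * (1 - u)" by (simp add: \<delta>_def algebra_simps)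
    then have "\<bar>\<tau> - (\<tau> + \<delta> * u)\<bar> powr (- p) * \<bar>\<sigma> - (\<tau> + \<delta> * u)\<bar> powr (- p) = (\<bar>\<delta>\<bar> powr (- p) * \<bar>\<delta>\<bar> powr (- p)) * (\<bar>u\<bar> powr (- p) * \<bar>1 - u\<bar> powr (- p))"
      by (simp add: abs_mult powr_mult)
    also have "\<bar>\<delta>\<bar> powr (- p) * \<bar>\<delta>\<bar> powr (- p) = \<bar>\<delta>\<bar> powr (- 2 * p)" by (simp flip: powr_add)
    finally show "ennreal (\<bar>\<tau> - (\<tau> + \<delta> * u)\<bar> powr (- p) * \<bar>\<sigma> - (\<tau> + \<delta> * u)\<bar> powr (- p)) = ennreal (\<bar>\<delta>\<bar> powr (- 2 * p)) * ennreal (\<bar>u\<bar> powr (- p) * \<bar>1 - u\<bar> powr (- p))"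
      by (simp add: ennreal_mult)
  qed
  also have "\<dots> = ennreal (\<bar>\<delta>\<bar> powr (- 2 * p)) * riesz_constant p"
    unfolding riesz_constant_def by (rule nn_integral_cmult) auto
  also have "ennreal \<bar>\<delta>\<bar> * (ennreal (\<bar>\<delta>\<bar> powr (- 2 * p)) * riesz_constant p) = riesz_constant p * ennreal (\<bar>\<delta>\<bar> * \<bar>\<delta>\<bar> powr (- 2 * p))"
    by (simp add: ennreal_mult mult_ac)
  also have "\<bar>\<delta>\<bar> * \<bar>\<delta>\<bar> powr (- 2 * p) = \<bar>\<tau> - \<sigma>\<bar> powr (1 - 2 * p)"
    using \<delta> by (simp add: powr_diff powr_minus \<delta>_def abs_minus_commute field_simps)
  finally show ?thesis .
qed

text \<open>By the composition formula the form is, up to a constant, the L^2 inner product of two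
  Riesz potentials, which makes its positivity visible.\<close>

lemma frac_form_riesz:
  assumes [measurable]: "\<phi> \<in> borel_measurable borel" "\<psi> \<in> borel_measurable borel"
    and nn: "\<And>r. 0 \<le> \<phi> r" "\<And>r. 0 \<le> \<psi> r"
  shows "riesz_constant (3 / 2 - H) * frac_form H \<phi> \<psi> =
    (\<integral>\<^sup>+ r. (\<integral>\<^sup>+ \<tau>. ennreal (\<bar>\<tau> - r\<bar> powr (H - 3 / 2) * \<phi> \<tau>) \<partial>lborel) * (\<integral>\<^sup>+ \<sigma>. ennreal (\<bar>\<sigma> - r\<bar> powr (H - 3 / 2) * \<psi> \<sigma>) \<partial>lborel) \<partial>lborel)"
proof -
  let ?p = "3 / 2 - H"
  let ?k = "\<lambda>\<tau> \<sigma> r. ennreal (\<bar>\<tau> - r\<bar> powr (- ?p) * \<bar>\<sigma> - r\<bar> powr (- ?p))"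
  have "riesz_constant ?p * frac_form H \<phi> \<psi> = (\<integral>\<^sup>+ \<tau>. \<integral>\<^sup>+ \<sigma>. riesz_constant ?p * ennreal (\<bar>\<tau> - \<sigma>\<bar> powr (2 * H - 2) * \<phi> \<tau> * \<psi> \<sigma>) \<partial>lborel \<partial>lborel)"
    unfolding frac_form_def by (simp add: nn_integral_cmult)
  also have "\<dots> = (\<integral>\<^sup>+ \<tau>. \<integral>\<^sup>+ \<sigma>. \<integral>\<^sup>+ r. ?k \<tau> \<sigma> r * ennreal (\<phi> \<tau> * \<psi> \<sigma>) \<partial>lborel \<partial>lborel \<partial>lborel)"
  proof (rule nn_integral_cong, rule nn_integral_cong_AE)
    fix \<tau>
    show "AE \<sigma> in lborel. riesz_constant ?p * ennreal (\<bar>\<tau> - \<sigma>\<bar> powr (2 * H - 2) * \<phi> \<tau> * \<psi> \<sigma>) = (\<integral>\<^sup>+ r. ?k \<tau> \<sigma> r * ennreal (\<phi> \<tau> * \<psi> \<sigma>) \<partial>lborel)"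
      using AE_lborel_singleton[of \<tau>]
    proof eventually_elim
      case (elim \<sigma>)
      have "(\<integral>\<^sup>+ r. ?k \<tau> \<sigma> r * ennreal (\<phi> \<tau> * \<psi> \<sigma>) \<partial>lborel) = (\<integral>\<^sup>+ r. ?k \<tau> \<sigma> r \<partial>lborel) * ennreal (\<phi> \<tau> * \<psi> \<sigma>)"
        by (rule nn_integral_multc) measurable
      also have "(\<integral>\<^sup>+ r. ?k \<tau> \<sigma> r \<partial>lborel) = riesz_constant ?p * ennreal (\<bar>\<tau> - \<sigma>\<bar> powr (1 - 2 * ?p))"
        using elim by (intro riesz_composition) auto
      also have "1 - 2 * ?p = 2 * H - 2" by simp
      finally show ?case using nn by (simp add: ennreal_mult mult_ac)
    qed
  qed
  also have "\<dots> = (\<integral>\<^sup>+ \<tau>. \<integral>\<^sup>+ r. \<integral>\<^sup>+ \<sigma>. ?k \<tau> \<sigma> r * ennreal (\<phi> \<tau> * \<psi> \<sigma>) \<partial>lborel \<partial>lborel \<partial>lborel)"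
    by (intro nn_integral_cong lborel_pair.Fubini') measurable
  also have "\<dots> = (\<integral>\<^sup>+ r. \<integral>\<^sup>+ \<tau>. \<integral>\<^sup>+ \<sigma>. ?k \<tau> \<sigma> r * ennreal (\<phi> \<tau> * \<psi> \<sigma>) \<partial>lborel \<partial>lborel \<partial>lborel)"
    by (intro lborel_pair.Fubini') measurable
  also have "\<dots> = (\<integral>\<^sup>+ r. \<integral>\<^sup>+ \<tau>. \<integral>\<^sup>+ \<sigma>. ennreal (\<bar>\<tau> - r\<bar> powr (H - 3 / 2) * \<phi> \<tau>) * ennreal (\<bar>\<sigma> - r\<bar> powr (H - 3 / 2) * \<psi> \<sigma>) \<partial>lborel \<partial>lborel \<partial>lborel)"
    using nn by (intro nn_integral_cong) (simp add: ennreal_mult[symmetric] mult_ac)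
  also have "\<dots> = (\<integral>\<^sup>+ r. (\<integral>\<^sup>+ \<tau>. ennreal (\<bar>\<tau> - r\<bar> powr (H - 3 / 2) * \<phi> \<tau>) \<partial>lborel) * (\<integral>\<^sup>+ \<sigma>. ennreal (\<bar>\<sigma> - r\<bar> powr (H - 3 / 2) * \<psi> \<sigma>) \<partial>lborel) \<partial>lborel)"
    by (simp add: nn_integral_cmult nn_integral_multc)
  finally show ?thesis .
qed

lemma ennreal_two_mult_le: "2 * (a * b) \<le> a * a + b * (b :: ennreal)"
proof (cases a; cases b)
  fix x y :: real assume "0 \<le> x" "a = ennreal x" "0 \<le> y" "b = ennreal y"
  then show ?thesis
    using sum_squares_bound[of x y] by (auto simp: power2_eq_square mult.assoc ennreal_mult[symmetric] ennreal_plus[symmetric] simp flip: ennreal_numeral simp del: ennreal_plus intro!: ennreal_leI)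
qed (auto simp: ennreal_top_mult ennreal_mult_top)

text \<open>This is 2ab <= a^2 + b^2 for the two potentials, integrated; it is stated additively to
  avoid truncated subtraction in \<open>ennreal\<close>. The Riesz constant can be cancelled because
  it is finite and nonzero. Applied to two profiles at a fixed \<xi>, it says that the integrand of
  the temporal increment is nonnegative.\<close>

lemma frac_form_amgm:
  assumes H: "1 / 2 < H" "H < 1" and [measurable]: "\<phi> \<in> borel_measurable borel" "\<psi> \<in> borel_measurable borel"
    and nn: "\<And>r. 0 \<le> \<phi> r" "\<And>r. 0 \<le> \<psi> r"
  shows "frac_form H \<phi> \<psi> + frac_form H \<psi> \<phi> \<le> frac_form H \<phi> \<phi> + frac_form H \<psi> \<psi>"
proof -
  let ?c = "riesz_constant (3 / 2 - H)"
  let ?P = "\<lambda>\<phi> r. (\<integral>\<^sup>+ \<tau>. ennreal (\<bar>\<tau> - r\<bar> powr (H - 3 / 2) * \<phi> \<tau>) \<partial>lborel)"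
  have "?c * (frac_form H \<phi> \<psi> + frac_form H \<psi> \<phi>) = ?c * frac_form H \<phi> \<psi> + ?c * frac_form H \<phi> \<psi>"
    by (simp add: frac_form_commute[of \<psi> \<phi>] distrib_left)
  also have "\<dots> = (\<integral>\<^sup>+ r. ?P \<phi> r * ?P \<psi> r \<partial>lborel) + (\<integral>\<^sup>+ r. ?P \<phi> r * ?P \<psi> r \<partial>lborel)"
    using nn by (simp only: frac_form_riesz[OF assms(3,4)])
  also have "\<dots> = (\<integral>\<^sup>+ r. ?P \<phi> r * ?P \<psi> r + ?P \<phi> r * ?P \<psi> r \<partial>lborel)"
    by (rule nn_integral_add[symmetric]) measurable
  also have "\<dots> = (\<integral>\<^sup>+ r. 2 * (?P \<phi> r * ?P \<psi> r) \<partial>lborel)"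
    by (simp only: mult_2)
  also have "\<dots> \<le> (\<integral>\<^sup>+ r. ?P \<phi> r * ?P \<phi> r + ?P \<psi> r * ?P \<psi> r \<partial>lborel)"
    by (intro nn_integral_mono ennreal_two_mult_le)
  also have "\<dots> = ?c * (frac_form H \<phi> \<phi> + frac_form H \<psi> \<psi>)"
    using nn by (simp add: frac_form_riesz nn_integral_add distrib_left)
  finally have le: "?c * (frac_form H \<phi> \<psi> + frac_form H \<psi> \<phi>) \<le> ?c * (frac_form H \<phi> \<phi> + frac_form H \<psi> \<psi>)" .
  have "?c < \<infinity>" "?c \<noteq> 0" using H riesz_constant_finite riesz_constant_pos by auto
  with le show ?thesis by (subst (asm) ennreal_mult_le_mult_iff) (auto simp: less_top)
qed


section \<open>The energy measure\<close>

lemma tempered_measure_cball_finite: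
  assumes "tempered_measure \<Lambda>"
  shows "emeasure \<Lambda> (cball 0 R) < \<infinity>"
proof -
  have [measurable_cong]: "sets \<Lambda> = sets borel" using assms by (simp add: tempered_measure_def)
  obtain k where k: "(\<integral>\<^sup>+ x. ennreal (1 / (1 + norm x) ^ k) \<partial>\<Lambda>) < \<infinity>"
    using assms by (auto simp: tempered_measure_def)
  show ?thesis
  proof (cases "0 \<le> R")
    case True
    have "emeasure \<Lambda> (cball 0 R) = (\<integral>\<^sup>+ x. indicator (cball 0 R) x \<partial>\<Lambda>)" by simp
    also have "\<dots> \<le> (\<integral>\<^sup>+ x. ennreal ((1 + R) ^ k) * ennreal (1 / (1 + norm x) ^ k) \<partial>\<Lambda>)"
    proof (intro nn_integral_mono)
      fix x :: 'a
      have "1 \<le> (1 + R) ^ k * (1 / (1 + norm x) ^ k)" if "norm x \<le> R"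
        using that by (simp add: pos_le_divide_eq power_mono zero_less_power add_pos_nonneg)
      then show "indicator (cball 0 R) x \<le> ennreal ((1 + R) ^ k) * ennreal (1 / (1 + norm x) ^ k)"
        using True by (auto split: split_indicator simp flip: ennreal_mult simp: ennreal_ge_1)
    qed
    also have "\<dots> = ennreal ((1 + R) ^ k) * (\<integral>\<^sup>+ x. ennreal (1 / (1 + norm x) ^ k) \<partial>\<Lambda>)"
      by (rule nn_integral_cmult) measurable
    also have "\<dots> < \<infinity>" using k by (simp add: ennreal_mult_less_top)
    finally show ?thesis .
  qed simp
qed

lemma tempered_measure_sigma_finite:
  fixes \<Lambda> :: "'a::euclidean_space measure"
  assumes "tempered_measure \<Lambda>"
  shows "sigma_finite_measure \<Lambda>"
proof
  have s: "sets \<Lambda> = sets borel" "space \<Lambda> = UNIV" using assms by (auto simp: tempered_measure_def dest: sets_eq_imp_space_eq)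
  show "\<exists>A. countable A \<and> A \<subseteq> sets \<Lambda> \<and> \<Union>A = space \<Lambda> \<and> (\<forall>a\<in>A. emeasure \<Lambda> a \<noteq> \<infinity>)"
    using tempered_measure_cball_finite[OF assms]
    by (intro exI[of _ "range (\<lambda>n::nat. cball 0 (real n))"]) (auto simp: s real_arch_simple less_top[symmetric])
qed

lemma sets_pair_correlation [simp, measurable_cong]: "sets (pair_correlation \<Lambda>) = sets (borel \<Otimes>\<^sub>M borel)"
  by (simp add: pair_correlation_def)

lemma space_pair_correlation [simp]: "space (pair_correlation \<Lambda>) = UNIV"
  by (simp add: pair_correlation_def space_pair_measure)

lemma sets_energy_measure [simp, measurable_cong]:
  "sets (energy_measure \<Lambda>) = sets ((borel \<Otimes>\<^sub>M borel) \<Otimes>\<^sub>M (borel \<Otimes>\<^sub>M borel))"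
  unfolding energy_measure_def by (intro sets_pair_measure_cong) simp_all

lemma space_energy_measure [simp]: "space (energy_measure \<Lambda>) = UNIV"
  by (simp add: energy_measure_def space_pair_measure)

lemma nn_integral_pair_correlation:
  fixes \<Lambda> :: "'a::euclidean_space measure"
  assumes \<Lambda>: "sets \<Lambda> = sets borel" and [measurable]: "F \<in> borel_measurable (borel \<Otimes>\<^sub>M borel)"
  shows "(\<integral>\<^sup>+ x. F x \<partial>pair_correlation \<Lambda>) = (\<integral>\<^sup>+ v. \<integral>\<^sup>+ w. F (v + w, w) \<partial>lborel \<partial>\<Lambda>)"
proof -
  note [measurable_cong] = \<Lambda>
  have "(\<integral>\<^sup>+ x. F x \<partial>pair_correlation \<Lambda>) = (\<integral>\<^sup>+ x. F (fst x + snd x, snd x) \<partial>(\<Lambda> \<Otimes>\<^sub>M lborel))"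
    unfolding pair_correlation_def by (subst nn_integral_distr) (auto simp: case_prod_beta)
  also have "\<dots> = (\<integral>\<^sup>+ v. \<integral>\<^sup>+ w. F (v + w, w) \<partial>lborel \<partial>\<Lambda>)"
    by (subst lborel.nn_integral_fst[symmetric]) auto
  finally show ?thesis .
qed

text \<open>If v + w lies in A and w in B, both bounded, then v is confined to a ball as well, and a
  tempered measure is finite on balls.\<close>

lemma pair_correlation_Times_finite:
  fixes \<Lambda> :: "'a::euclidean_space measure"
  assumes \<Lambda>: "tempered_measure \<Lambda>" and A: "A \<in> sets borel" "B \<in> sets borel" "bounded A" "bounded B"
  shows "emeasure (pair_correlation \<Lambda>) (A \<times> B) < \<infinity>"
proof -
  note [measurable] = A(1,2)
  have s: "sets \<Lambda> = sets borel" using \<Lambda> by (simp add: tempered_measure_def)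
  obtain R where R: "\<And>x. x \<in> A \<Longrightarrow> norm x \<le> R" using A(3) by (auto simp: bounded_iff)
  obtain R' where R': "\<And>x. x \<in> B \<Longrightarrow> norm x \<le> R'" using A(4) by (auto simp: bounded_iff)
  note [measurable_cong] = s
  let ?f = "\<lambda>(v, w). (v + w, w)"
  have sub: "?f -` (A \<times> B) \<inter> space (\<Lambda> \<Otimes>\<^sub>M lborel) \<subseteq> cball 0 (R + R') \<times> cball 0 R'"
  proof
    fix x assume "x \<in> ?f -` (A \<times> B) \<inter> space (\<Lambda> \<Otimes>\<^sub>M lborel)"
    then have "fst x + snd x \<in> A" "snd x \<in> B" by (auto split: prod.splits)
    then have "norm (fst x + snd x) \<le> R" "norm (snd x) \<le> R'" using R R' by auto
    then show "x \<in> cball 0 (R + R') \<times> cball 0 R'"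
      using norm_triangle_ineq4[of "fst x + snd x" "snd x"] by (simp add: mem_Times_iff)
  qed
  have "emeasure (pair_correlation \<Lambda>) (A \<times> B) = emeasure (\<Lambda> \<Otimes>\<^sub>M lborel) (?f -` (A \<times> B) \<inter> space (\<Lambda> \<Otimes>\<^sub>M lborel))"
    unfolding pair_correlation_def by (rule emeasure_distr) measurable
  also have "\<dots> \<le> emeasure (\<Lambda> \<Otimes>\<^sub>M lborel) (cball 0 (R + R') \<times> cball (0::'a) R')"
    by (rule emeasure_mono[OF sub]) (auto simp: s intro!: pair_measureI)
  also have "\<dots> = emeasure \<Lambda> (cball 0 (R + R')) * emeasure lborel (cball 0 R' :: 'a set)"
    by (rule lborel.emeasure_pair_measure_Times) (auto simp: s)
  also have "\<dots> < \<infinity>"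
    using tempered_measure_cball_finite[OF \<Lambda>, of "R + R'"] emeasure_lborel_cball_finite[of "0::'a" R'] by (simp add: ennreal_mult_less_top)
  finally show ?thesis .
qed

lemma pair_correlation_sigma_finite:
  fixes \<Lambda> :: "'a::euclidean_space measure"
  assumes "tempered_measure \<Lambda>"
  shows "sigma_finite_measure (pair_correlation \<Lambda>)"
proof
  let ?C = "\<lambda>n::nat. cball (0::'a) (real n)"
  have "\<exists>n. x \<in> ?C n \<times> ?C n" for x
  proof -
    obtain n where "max (norm (fst x)) (norm (snd x)) \<le> real n" using real_arch_simple by blast
    then show ?thesis by (intro exI[of _ n]) (auto simp: mem_Times_iff)
  qed
  then have "(\<Union>n. ?C n \<times> ?C n) = UNIV" by (simp only: set_eq_iff UN_iff UNIV_I simp_thms bex_UNIV)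
  moreover have "emeasure (pair_correlation \<Lambda>) (?C n \<times> ?C n) \<noteq> \<infinity>" for n
    using pair_correlation_Times_finite[OF assms, of "?C n" "?C n"] by (simp add: less_top[symmetric])
  moreover have "?C n \<times> ?C n \<in> sets (pair_correlation \<Lambda>)" for n by simp
  ultimately show "\<exists>A. countable A \<and> A \<subseteq> sets (pair_correlation \<Lambda>) \<and> \<Union>A = space (pair_correlation \<Lambda>) \<and> (\<forall>a\<in>A. emeasure (pair_correlation \<Lambda>) a \<noteq> \<infinity>)"
    by (intro exI[of _ "range (\<lambda>n. ?C n \<times> ?C n)"] conjI ballI) (simp_all only: space_pair_correlation image_subset_iff, auto)
qed

lemma nn_integral_energy_measure:
  fixes \<Lambda> :: "'a::euclidean_space measure"
  assumes \<Lambda>: "tempered_measure \<Lambda>" and [measurable]: "F \<in> borel_measurable ((borel \<Otimes>\<^sub>M borel) \<Otimes>\<^sub>M (borel \<Otimes>\<^sub>M borel))"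
  shows "(\<integral>\<^sup>+ x. F x \<partial>energy_measure \<Lambda>)
     = (\<integral>\<^sup>+ \<tau>. \<integral>\<^sup>+ \<sigma>. \<integral>\<^sup>+ x. F ((\<tau>, \<sigma>), x) \<partial>pair_correlation \<Lambda> \<partial>lborel \<partial>lborel)"
proof -
  interpret pc: sigma_finite_measure "pair_correlation \<Lambda>" by (rule pair_correlation_sigma_finite[OF \<Lambda>])
  have "(\<integral>\<^sup>+ x. F x \<partial>energy_measure \<Lambda>) = (\<integral>\<^sup>+ p. \<integral>\<^sup>+ x. F (p, x) \<partial>pair_correlation \<Lambda> \<partial>(lborel \<Otimes>\<^sub>M lborel))"
    unfolding energy_measure_def by (subst pc.nn_integral_fst[symmetric]) auto
  also have "\<dots> = (\<integral>\<^sup>+ \<tau>. \<integral>\<^sup>+ \<sigma>. \<integral>\<^sup>+ x. F ((\<tau>, \<sigma>), x) \<partial>pair_correlation \<Lambda> \<partial>lborel \<partial>lborel)"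
    by (subst lborel.nn_integral_fst[symmetric]) auto
  finally show ?thesis .
qed

text \<open>Polarised form of \<open>energy_integrand\<close>. Symmetry of its integral in g and h
  is not established, so expansions carry both orders.\<close>

definition cross :: "real \<Rightarrow> (real \<Rightarrow> 'a \<Rightarrow> real) \<Rightarrow> (real \<Rightarrow> 'a \<Rightarrow> real) \<Rightarrow> (real \<times> real) \<times> ('a \<times> 'a) \<Rightarrow> real" where
  "cross H g h x = \<bar>fst (fst x) - snd (fst x)\<bar> powr (2 * H - 2) * g (fst (fst x)) (fst (snd x)) * h (snd (fst x)) (snd (snd x))"

lemma energy_integrand_eq_cross: "energy_integrand H g = cross H g g"
  by (simp add: fun_eq_iff energy_integrand_def cross_def)

abbreviation spacetime_measurable :: "(real \<Rightarrow> 'a::euclidean_space \<Rightarrow> real) \<Rightarrow> bool" where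
  "spacetime_measurable g \<equiv> case_prod g \<in> borel_measurable (borel \<Otimes>\<^sub>M borel)"

lemma cross_measurable [measurable]:
  assumes "spacetime_measurable g" "spacetime_measurable h"
  shows "cross H g h \<in> borel_measurable ((borel \<Otimes>\<^sub>M borel) \<Otimes>\<^sub>M (borel \<Otimes>\<^sub>M borel))"
proof -
  have [measurable]: "(\<lambda>x. g (fst (fst x)) (fst (snd x))) \<in> borel_measurable ((borel \<Otimes>\<^sub>M borel) \<Otimes>\<^sub>M (borel \<Otimes>\<^sub>M borel))"
    using measurable_compose[OF _ assms(1), of "\<lambda>x. (fst (fst x), fst (snd x))" "(borel \<Otimes>\<^sub>M borel) \<Otimes>\<^sub>M (borel \<Otimes>\<^sub>M borel)"] by simp
  have [measurable]: "(\<lambda>x. h (snd (fst x)) (snd (snd x))) \<in> borel_measurable ((borel \<Otimes>\<^sub>M borel) \<Otimes>\<^sub>M (borel \<Otimes>\<^sub>M borel))"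
    using measurable_compose[OF _ assms(2), of "\<lambda>x. (snd (fst x), snd (snd x))" "(borel \<Otimes>\<^sub>M borel) \<Otimes>\<^sub>M (borel \<Otimes>\<^sub>M borel)"] by simp
  show ?thesis unfolding cross_def[abs_def] by measurable
qed

text \<open>For rectangles the time and space integrals separate: the first is the fractional
  covariance up to H (2H - 1), the second the mass of A x B under the pair measure. This is the
  noise covariance.\<close>

lemma nn_integral_cross_rectangles:
  fixes \<Lambda> :: "'a::euclidean_space measure"
  assumes H: "1 / 2 < H" "H < 1" and ts: "0 \<le> t" "0 \<le> s"
    and \<Lambda>: "tempered_measure \<Lambda>" and [measurable]: "A \<in> sets borel" "B \<in> sets borel"
  shows "(\<integral>\<^sup>+ x. ennreal (cross H (\<lambda>\<tau> z. indicator {0..t} \<tau> * indicator A z) (\<lambda>\<tau> z. indicator {0..s} \<tau> * indicator B z) x) \<partial>energy_measure \<Lambda>)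
     = ennreal (fractional_covariance H t s / (H * (2 * H - 1))) * emeasure (pair_correlation \<Lambda>) (A \<times> B)"
proof -
  have [measurable]: "(\<lambda>x. ennreal (cross H (\<lambda>\<tau> z. indicator {0..t} \<tau> * indicator A z) (\<lambda>\<tau> z. indicator {0..s} \<tau> * indicator B z) x)) \<in> borel_measurable ((borel \<Otimes>\<^sub>M borel) \<Otimes>\<^sub>M (borel \<Otimes>\<^sub>M borel))"
    unfolding cross_def by measurable
  have "(\<integral>\<^sup>+ x. ennreal (cross H (\<lambda>\<tau> z. indicator {0..t} \<tau> * indicator A z) (\<lambda>\<tau> z. indicator {0..s} \<tau> * indicator B z) x) \<partial>energy_measure \<Lambda>)
    = (\<integral>\<^sup>+ \<tau>. \<integral>\<^sup>+ \<sigma>. \<integral>\<^sup>+ x. ennreal (\<bar>\<tau> - \<sigma>\<bar> powr (2 * H - 2) * indicator {0..t} \<tau> * indicator {0..s} \<sigma>) * indicator (A \<times> B) x \<partial>pair_correlation \<Lambda> \<partial>lborel \<partial>lborel)"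
    by (subst nn_integral_energy_measure[OF \<Lambda>]) (auto intro!: nn_integral_cong simp: cross_def split: split_indicator)
  also have "\<dots> = frac_form H (indicator {0..t}) (indicator {0..s}) * emeasure (pair_correlation \<Lambda>) (A \<times> B)"
    by (simp add: nn_integral_cmult_indicator nn_integral_multc frac_form_def)
  finally show ?thesis using frac_form_indicator[OF H ts] by simp
qed

section \<open>Positive quadratic forms on simple functions\<close>

definition indicator_comb :: "(real \<times> 'b set) list \<Rightarrow> 'b \<Rightarrow> real" where
  "indicator_comb l x = (\<Sum>(c, E)\<leftarrow>l. c * indicator E x)"

lemma indicator_comb_simps [simp]:
  "indicator_comb [] x = 0" "indicator_comb ((c, E) # l) x = c * indicator E x + indicator_comb l x"
  "indicator_comb (l @ l') x = indicator_comb l x + indicator_comb l' x"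
  by (simp_all add: indicator_comb_def)

lemma indicator_comb_scale: "indicator_comb (map (\<lambda>(c, E). (a * c, E)) l) x = a * indicator_comb l x"
  by (induction l) (auto simp: algebra_simps)

lemma indicator_comb_measurable:
  assumes "\<And>c E. (c, E) \<in> set l \<Longrightarrow> E \<in> sets M"
  shows "indicator_comb l \<in> borel_measurable M"
  using assms
proof (induction l)
  case (Cons p l)
  obtain c E where p: "p = (c, E)" by (cases p)
  have "E \<in> sets M" "indicator_comb l \<in> borel_measurable M" using Cons by (auto simp: p)
  then show ?case unfolding p by (simp add: borel_measurable_indicator borel_measurable_add borel_measurable_times cong: measurable_cong)
qed (simp cong: measurable_cong)

lemma indicator_comb_bounded: "\<bar>indicator_comb l x\<bar> \<le> (\<Sum>(c, E)\<leftarrow>l. \<bar>c\<bar>)"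
proof (induction l)
  case (Cons p l)
  obtain c E where p: "p = (c, E)" by (cases p)
  have "\<bar>c * indicator E x\<bar> \<le> \<bar>c\<bar>" by (auto split: split_indicator)
  with Cons show ?case by (simp add: p)
qed simp

text \<open>
  Positivity of the form \<open>g \<mapsto> \<integral> g(p\<^sub>1) g(p\<^sub>2) dN\<close> on combinations of indicators of a generator extends
  to simple functions by a Dynkin argument. The distance has to be quadratic: the approximants
  produced by that argument come without a uniform bound.
\<close>
locale two_projections = finite_measure N for N :: "'z measure" +
  fixes M :: "'b measure" and p1 p2 :: "'z \<Rightarrow> 'b" and G :: "'b set set"
  assumes p1 [measurable]: "p1 \<in> N \<rightarrow>\<^sub>M M" and p2 [measurable]: "p2 \<in> N \<rightarrow>\<^sub>M M"
    and G: "Int_stable G" "G \<subseteq> Pow (space M)" "sets M = sigma_sets (space M) G" "space M \<in> G"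
begin

definition sq_dist :: "('b \<Rightarrow> real) \<Rightarrow> ennreal" where
  "sq_dist h = (\<integral>\<^sup>+ x. ennreal ((h (p1 x))\<^sup>2 + (h (p2 x))\<^sup>2) \<partial>N)"

definition approximable :: "('b \<Rightarrow> real) \<Rightarrow> bool" where
  "approximable g \<longleftrightarrow> (\<forall>\<epsilon>>0. \<exists>l. (\<forall>(c, E)\<in>set l. E \<in> G) \<and> sq_dist (\<lambda>y. g y - indicator_comb l y) < ennreal \<epsilon>)"

lemma sets_G: "E \<in> G \<Longrightarrow> E \<in> sets M"
  using G by auto

lemma comb_measurable [measurable]: "\<forall>(c, E)\<in>set l. E \<in> G \<Longrightarrow> indicator_comb l \<in> borel_measurable M"
  by (rule indicator_comb_measurable) (auto intro: sets_G)

lemma sq_dist_add: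
  assumes [measurable]: "f \<in> borel_measurable M" "g \<in> borel_measurable M"
  shows "sq_dist (\<lambda>y. f y + g y) \<le> 2 * sq_dist f + 2 * sq_dist g"
proof -
  have s: "(a + b)\<^sup>2 \<le> 2 * a\<^sup>2 + 2 * b\<^sup>2" for a b :: real
    using sum_squares_bound[of a b] by (simp add: power2_sum)
  have "sq_dist (\<lambda>y. f y + g y) \<le> (\<integral>\<^sup>+ x. 2 * ennreal ((f (p1 x))\<^sup>2 + (f (p2 x))\<^sup>2) + 2 * ennreal ((g (p1 x))\<^sup>2 + (g (p2 x))\<^sup>2) \<partial>N)"
    unfolding sq_dist_def
  proof (intro nn_integral_mono)
    fix x
    have "(f (p1 x) + g (p1 x))\<^sup>2 + (f (p2 x) + g (p2 x))\<^sup>2 \<le> 2 * ((f (p1 x))\<^sup>2 + (f (p2 x))\<^sup>2) + 2 * ((g (p1 x))\<^sup>2 + (g (p2 x))\<^sup>2)"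
      using s[of "f (p1 x)" "g (p1 x)"] s[of "f (p2 x)" "g (p2 x)"] unfolding distrib_left by linarith
    then have "ennreal ((f (p1 x) + g (p1 x))\<^sup>2 + (f (p2 x) + g (p2 x))\<^sup>2) \<le> ennreal (2 * ((f (p1 x))\<^sup>2 + (f (p2 x))\<^sup>2) + 2 * ((g (p1 x))\<^sup>2 + (g (p2 x))\<^sup>2))"
      by (rule ennreal_leI)
    also have "\<dots> = 2 * ennreal ((f (p1 x))\<^sup>2 + (f (p2 x))\<^sup>2) + 2 * ennreal ((g (p1 x))\<^sup>2 + (g (p2 x))\<^sup>2)"
      by (simp add: ennreal_mult' distrib_left)
    finally show "ennreal ((f (p1 x) + g (p1 x))\<^sup>2 + (f (p2 x) + g (p2 x))\<^sup>2) \<le> 2 * ennreal ((f (p1 x))\<^sup>2 + (f (p2 x))\<^sup>2) + 2 * ennreal ((g (p1 x))\<^sup>2 + (g (p2 x))\<^sup>2)" .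
  qed
  also have "\<dots> = 2 * sq_dist f + 2 * sq_dist g"
  proof -
    have 1: "(\<lambda>x. ennreal ((f (p1 x))\<^sup>2 + (f (p2 x))\<^sup>2)) \<in> borel_measurable N" "(\<lambda>x. ennreal ((g (p1 x))\<^sup>2 + (g (p2 x))\<^sup>2)) \<in> borel_measurable N"
      by measurable
    show ?thesis unfolding sq_dist_def nn_integral_cmult[OF 1(1), symmetric] nn_integral_cmult[OF 1(2), symmetric]
      by (intro nn_integral_add borel_measurable_times_ennreal borel_measurable_const 1)
  qed
  finally show ?thesis .
qed

lemma approximable_comb: "\<forall>(c, E)\<in>set l. E \<in> G \<Longrightarrow> approximable (indicator_comb l)"
  unfolding approximable_def sq_dist_def by (intro allI impI exI[of _ l]) auto

lemma approximable_close:
  assumes [measurable]: "f \<in> borel_measurable M"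
    and "\<And>\<epsilon>. 0 < \<epsilon> \<Longrightarrow> \<exists>g. g \<in> borel_measurable M \<and> approximable g \<and> sq_dist (\<lambda>y. f y - g y) < ennreal \<epsilon>"
  shows "approximable f"
  unfolding approximable_def
proof (intro allI impI)
  fix \<epsilon> :: real assume \<epsilon>: "0 < \<epsilon>"
  \<comment> \<open>Squared distances satisfy the triangle inequality only with a factor 2 on each
    term, so each error gets a quarter of the allowance.\<close>
  have \<epsilon>4: "0 < \<epsilon> / 4" using \<epsilon> by simp
  obtain g where [measurable]: "g \<in> borel_measurable M" and g: "approximable g" "sq_dist (\<lambda>y. f y - g y) < ennreal (\<epsilon> / 4)"
    using assms(2)[OF \<epsilon>4] by blast
  obtain l where l: "\<forall>(c, E)\<in>set l. E \<in> G" "sq_dist (\<lambda>y. g y - indicator_comb l y) < ennreal (\<epsilon> / 4)"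
    using g(1) \<epsilon>4 unfolding approximable_def by blast
  note [measurable] = comb_measurable[OF l(1)]
  have "sq_dist (\<lambda>y. f y - indicator_comb l y) = sq_dist (\<lambda>y. (f y - g y) + (g y - indicator_comb l y))" by simp
  also have "\<dots> \<le> 2 * sq_dist (\<lambda>y. f y - g y) + 2 * sq_dist (\<lambda>y. g y - indicator_comb l y)"
    by (rule sq_dist_add) measurable
  also have "\<dots> < 2 * ennreal (\<epsilon> / 4) + 2 * ennreal (\<epsilon> / 4)"
    using g(2) l(2) by (intro add_strict_mono ennreal_mult_strict_left_mono) auto
  also have "\<dots> = ennreal \<epsilon>"
    using \<epsilon> by (simp flip: ennreal_plus ennreal_mult ennreal_numeral)
  finally show "\<exists>l. (\<forall>(c, E)\<in>set l. E \<in> G) \<and> sq_dist (\<lambda>y. f y - indicator_comb l y) < ennreal \<epsilon>"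
    using l(1) by blast
qed

lemma approximable_add:
  assumes [measurable]: "f \<in> borel_measurable M" "g \<in> borel_measurable M" and f: "approximable f" and g: "approximable g"
  shows "approximable (\<lambda>y. f y + g y)"
  unfolding approximable_def
proof (intro allI impI)
  fix \<epsilon> :: real assume \<epsilon>: "0 < \<epsilon>"
  have \<epsilon>4: "0 < \<epsilon> / 4" using \<epsilon> by simp
  obtain l where l: "\<forall>(c, E)\<in>set l. E \<in> G" "sq_dist (\<lambda>y. f y - indicator_comb l y) < ennreal (\<epsilon> / 4)"
    using f \<epsilon>4 unfolding approximable_def by blast
  obtain l' where l': "\<forall>(c, E)\<in>set l'. E \<in> G" "sq_dist (\<lambda>y. g y - indicator_comb l' y) < ennreal (\<epsilon> / 4)"
    using g \<epsilon>4 unfolding approximable_def by blast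
  note [measurable] = comb_measurable[OF l(1)] comb_measurable[OF l'(1)]
  have "sq_dist (\<lambda>y. f y + g y - indicator_comb (l @ l') y) = sq_dist (\<lambda>y. (f y - indicator_comb l y) + (g y - indicator_comb l' y))"
    by (simp add: algebra_simps)
  also have "\<dots> \<le> 2 * sq_dist (\<lambda>y. f y - indicator_comb l y) + 2 * sq_dist (\<lambda>y. g y - indicator_comb l' y)"
    by (rule sq_dist_add) measurable
  also have "\<dots> < 2 * ennreal (\<epsilon> / 4) + 2 * ennreal (\<epsilon> / 4)"
    using l(2) l'(2) by (intro add_strict_mono ennreal_mult_strict_left_mono) auto
  also have "\<dots> = ennreal \<epsilon>"
    using \<epsilon> by (simp flip: ennreal_plus ennreal_mult ennreal_numeral)
  finally show "\<exists>l. (\<forall>(c, E)\<in>set l. E \<in> G) \<and> sq_dist (\<lambda>y. f y + g y - indicator_comb l y) < ennreal \<epsilon>"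
    using l(1) l'(1) by (intro exI[of _ "l @ l'"]) auto
qed

lemma approximable_cmult:
  assumes [measurable]: "f \<in> borel_measurable M" and f: "approximable f"
  shows "approximable (\<lambda>y. a * f y)"
  unfolding approximable_def
proof (intro allI impI)
  fix \<epsilon> :: real assume \<epsilon>: "0 < \<epsilon>"
  \<comment> \<open>Dividing by 1 + a^2 covers a = 0 and leaves the final inequality strict.\<close>
  have "0 < \<epsilon> / (1 + a\<^sup>2)" using \<epsilon> by (simp add: add_pos_nonneg)
  then obtain l where l: "\<forall>(c, E)\<in>set l. E \<in> G" "sq_dist (\<lambda>y. f y - indicator_comb l y) < ennreal (\<epsilon> / (1 + a\<^sup>2))"
    using f unfolding approximable_def by blast
  note [measurable] = comb_measurable[OF l(1)]
  have "sq_dist (\<lambda>y. a * f y - indicator_comb (map (\<lambda>(c, E). (a * c, E)) l) y) = ennreal (a\<^sup>2) * sq_dist (\<lambda>y. f y - indicator_comb l y)"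
    unfolding sq_dist_def
    by (subst nn_integral_cmult[symmetric]) (auto intro!: nn_integral_cong simp: indicator_comb_scale ennreal_mult[symmetric] distrib_left power_mult_distrib[symmetric] right_diff_distrib)
  also have "\<dots> \<le> ennreal (a\<^sup>2) * ennreal (\<epsilon> / (1 + a\<^sup>2))"
    using l(2) by (intro mult_left_mono) auto
  also have "\<dots> < ennreal \<epsilon>"
    using \<epsilon> by (auto simp: ennreal_mult[symmetric] add_pos_nonneg pos_divide_less_eq algebra_simps intro!: ennreal_lessI)
  finally show "\<exists>l. (\<forall>(c, E)\<in>set l. E \<in> G) \<and> sq_dist (\<lambda>y. a * f y - indicator_comb l y) < ennreal \<epsilon>"
    using l(1) by (intro exI[of _ "map (\<lambda>(c, E). (a * c, E)) l"]) auto
qed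

lemma approximable_sum:
  assumes "finite I" "\<And>i. i \<in> I \<Longrightarrow> f i \<in> borel_measurable M" "\<And>i. i \<in> I \<Longrightarrow> approximable (f i)"
  shows "approximable (\<lambda>y. \<Sum>i\<in>I. f i y)"
  using assms
proof (induction I rule: finite_induct)
  case empty
  show ?case using approximable_comb[of "[]"] by (simp cong: measurable_cong add: indicator_comb_def[abs_def])
next
  case (insert i I)
  then show ?case by (simp add: approximable_add)
qed

lemma approximable_indicator:
  assumes "A \<in> sets M"
  shows "approximable (indicator A)"
proof -
  have "A \<in> sigma_sets (space M) G" using assms G(3) by simp
  with G(1,2) show ?thesis
  proof (induction rule: sigma_sets_induct_disjoint)
    case (basic A)
    then have "approximable (indicator_comb [(1, A)])" by (intro approximable_comb) simp
    then show ?case by (simp add: indicator_comb_def[abs_def])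
  next
    case empty
    then show ?case using approximable_comb[of "[]"] by (simp add: indicator_comb_def[abs_def])
  next
    case (compl A)
    then have A: "A \<in> sets M" using G(3) by simp
    have "approximable (indicator_comb [(1, space M)])" using G(4) by (intro approximable_comb) simp
    then have 1: "approximable (indicator (space M))" by (simp add: indicator_comb_def[abs_def])
    have "approximable (\<lambda>y. indicator (space M) y + (-1) * indicator A y)"
      using compl A 1 by (intro approximable_add approximable_cmult) auto
    moreover have "(\<lambda>y. indicator (space M) y + (-1) * indicator A y :: real) = indicator (space M - A)"
      using sets.sets_into_space[OF A] by (auto simp: fun_eq_iff split: split_indicator)
    ultimately show ?case by simp
  next
    case (union A)
    then have A [measurable]: "A i \<in> sets M" for i using G(3) by auto
    show ?case
    proof (rule approximable_close)
      fix \<epsilon> :: real assume \<epsilon>: "0 < \<epsilon>"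
      \<comment> \<open>What the first n sets leave uncovered. Its preimages under both projections
        decrease to the empty set, and N is finite, so their measures tend to 0; the squared
        distance is the sum of these two measures.\<close>
      define B where "B n = (\<Union>i. A i) - (\<Union>i\<in>{..<n}. A i)" for n :: nat
      have B [measurable]: "B n \<in> sets M" for n unfolding B_def by measurable
      have lim: "(\<lambda>n. emeasure N (p -` B n \<inter> space N)) \<longlonglongrightarrow> 0" if [measurable]: "p \<in> N \<rightarrow>\<^sub>M M" for p
      proof -
        have "(\<lambda>n. emeasure N (p -` B n \<inter> space N)) \<longlonglongrightarrow> emeasure N (\<Inter>n. p -` B n \<inter> space N)"
        proof (rule Lim_emeasure_decseq)
          show "decseq (\<lambda>n. p -` B n \<inter> space N)"
            unfolding decseq_def by (auto simp: B_def) 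
          show "emeasure N (p -` B i \<inter> space N) \<noteq> \<infinity>" for i by (simp add: emeasure_eq_measure)
        qed (auto intro: measurable_sets[OF that B])
        also have "(\<Inter>n. p -` B n \<inter> space N) = {}" by (auto simp: B_def)
        finally show ?thesis by simp
      qed
      have eq: "sq_dist (\<lambda>y. indicator (\<Union>i. A i) y - (\<Sum>i<n. indicator (A i) y)) = emeasure N (p1 -` B n \<inter> space N) + emeasure N (p2 -` B n \<inter> space N)" for n
      proof -
        have d: "(\<Sum>i<n. indicator (A i) y) = (indicator (\<Union>i\<in>{..<n}. A i) y :: real)" for y
          by (rule indicator_UN_disjoint[symmetric]) (use union(1) in \<open>auto simp: disjoint_family_on_def\<close>)
        have "sq_dist (\<lambda>y. indicator (\<Union>i. A i) y - (\<Sum>i<n. indicator (A i) y)) = (\<integral>\<^sup>+ x. indicator (p1 -` B n \<inter> space N) x + indicator (p2 -` B n \<inter> space N) x \<partial>N)"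
          unfolding sq_dist_def d by (intro nn_integral_cong) (auto simp: B_def split: split_indicator)
        also have "\<dots> = emeasure N (p1 -` B n \<inter> space N) + emeasure N (p2 -` B n \<inter> space N)"
          by (subst nn_integral_add) (auto intro: measurable_sets[OF p1 B] measurable_sets[OF p2 B])
        finally show ?thesis .
      qed
      have "(\<lambda>n. sq_dist (\<lambda>y. indicator (\<Union>i. A i) y - (\<Sum>i<n. indicator (A i) y))) \<longlonglongrightarrow> 0 + 0"
        unfolding eq by (intro tendsto_add lim p1 p2)
      then have "\<forall>\<^sub>F n in sequentially. sq_dist (\<lambda>y. indicator (\<Union>i. A i) y - (\<Sum>i<n. indicator (A i) y)) < ennreal \<epsilon>"
        using \<epsilon> by (intro order_tendstoD) auto
      then obtain n where "sq_dist (\<lambda>y. indicator (\<Union>i. A i) y - (\<Sum>i<n. indicator (A i) y)) < ennreal \<epsilon>"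
        by (auto simp: eventually_sequentially)
      moreover have "approximable (\<lambda>y. \<Sum>i<n. indicator (A i) y)"
        using union(3) by (intro approximable_sum) auto
      ultimately show "\<exists>g. g \<in> borel_measurable M \<and> approximable g \<and> sq_dist (\<lambda>y. indicator (\<Union>i. A i) y - g y) < ennreal \<epsilon>"
        by (intro exI[of _ "\<lambda>y. \<Sum>i<n. indicator (A i) y"]) auto
    qed measurable
  qed
qed

lemma approximable_simple_function:
  fixes g :: "'b \<Rightarrow> real"
  assumes g: "simple_function M g" "\<And>y. y \<notin> space M \<Longrightarrow> g y = 0"
  shows "approximable g"
proof -
  have "approximable (\<lambda>y. \<Sum>c\<in>g ` space M. c * indicator (g -` {c} \<inter> space M) y)"
    using g by (intro approximable_sum approximable_cmult approximable_indicator) (auto simp: simple_function_def)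
  also have "(\<lambda>y. \<Sum>c\<in>g ` space M. c * indicator (g -` {c} \<inter> space M) y) = g"
  proof
    fix y
    show "(\<Sum>c\<in>g ` space M. c * indicator (g -` {c} \<inter> space M) y) = g y"
    proof (cases "y \<in> space M")
      case True
      have "(\<Sum>c\<in>g ` space M. c * indicator (g -` {c} \<inter> space M) y) = (\<Sum>c\<in>g ` space M. if c = g y then c else 0)"
        using True by (intro sum.cong) (auto split: split_indicator)
      also have "\<dots> = g y" using True g(1) by (auto simp: simple_function_def)
      finally show ?thesis .
    qed (simp add: g(2))
  qed
  finally show ?thesis .
qed

text \<open>Writing the approximant as g plus an error leaves a product of errors and two mixed
  terms. Young's inequality with a small weight \<theta> controls the mixed terms by the bound C of
  g and the squared error alone, so no bound on the approximant enters.\<close>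

lemma quadratic_form_nonneg:
  assumes [measurable]: "g \<in> borel_measurable M" and C: "\<And>y. \<bar>g y\<bar> \<le> C" and g: "approximable g"
    and pos: "\<And>l. \<forall>(c, E)\<in>set l. E \<in> G \<Longrightarrow> 0 \<le> (LINT x|N. indicator_comb l (p1 x) * indicator_comb l (p2 x))"
  shows "0 \<le> (LINT x|N. g (p1 x) * g (p2 x))"
proof (rule field_le_epsilon)
  fix \<eta> :: real assume \<eta>: "0 < \<eta>"
  have C0: "0 \<le> C" using C[of undefined] by linarith
  define m where "m = measure N (space N)"
  \<comment> \<open>Twice \<theta> times the total mass m stays below \<eta> / 2; m + 1 avoids
    division by zero. \<open>K\<close> below collects the coefficients of the squared errors: 1/2
    from their product and C^2 / (4 \<theta>) from Young's inequality.\<close>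
  define \<theta> where "\<theta> = \<eta> / (4 * (m + 1))"
  have m: "0 \<le> m" by (simp add: m_def)
  then have \<theta>: "0 < \<theta>" using \<eta> by (simp add: \<theta>_def)
  define K where "K = 1 / 2 + C\<^sup>2 / (4 * \<theta>)"
  have K: "0 < K" using \<theta> by (simp add: K_def add_pos_nonneg)
  have \<eta>K: "0 < \<eta> / (2 * K)" using \<eta> K by simp
  obtain l where l: "\<forall>(c, E)\<in>set l. E \<in> G" "sq_dist (\<lambda>y. g y - indicator_comb l y) < ennreal (\<eta> / (2 * K))"
    using g \<eta>K unfolding approximable_def by blast
  note [measurable] = comb_measurable[OF l(1)]
  let ?l = "indicator_comb l"
  define D where "D = (\<Sum>(c, E)\<leftarrow>l. \<bar>c\<bar>)"
  have D: "\<bar>?l y\<bar> \<le> D" for y unfolding D_def by (rule indicator_comb_bounded)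
  have D0: "0 \<le> D" using D[of undefined] by linarith
  define S where "S x = (g (p1 x) - ?l (p1 x))\<^sup>2 + (g (p2 x) - ?l (p2 x))\<^sup>2" for x
  have [measurable]: "S \<in> borel_measurable N" unfolding S_def by measurable
  have intl: "integrable N (\<lambda>x. ?l (p1 x) * ?l (p2 x))"
    using D D0 by (intro integrable_const_bound[where B="D * D"]) (auto simp: abs_mult intro!: mult_mono)
  have intg: "integrable N (\<lambda>x. g (p1 x) * g (p2 x))"
    using C C0 by (intro integrable_const_bound[where B="C * C"]) (auto simp: abs_mult intro!: mult_mono)
  have S: "integrable N S" "integral\<^sup>L N S < \<eta> / (2 * K)"
  proof -
    have fin: "(\<integral>\<^sup>+ x. ennreal (S x) \<partial>N) < ennreal (\<eta> / (2 * K))" using l(2) by (simp add: sq_dist_def S_def)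
    then show "integrable N S"
      by (intro integrableI_nonneg) (auto simp: S_def intro: order.strict_trans ennreal_less_top)
    then have "ennreal (integral\<^sup>L N S) < ennreal (\<eta> / (2 * K))"
      using fin by (subst nn_integral_eq_integral[symmetric]) (auto simp: S_def)
    then show "integral\<^sup>L N S < \<eta> / (2 * K)"
      by (subst (asm) ennreal_less_iff) (auto simp: S_def)
  qed
  have pw: "?l (p1 x) * ?l (p2 x) - g (p1 x) * g (p2 x) \<le> K * S x + 2 * \<theta>" for x
  proof -
    define u v where "u = ?l (p1 x) - g (p1 x)" and "v = ?l (p2 x) - g (p2 x)"
    have "?l (p1 x) * ?l (p2 x) - g (p1 x) * g (p2 x) = u * v + g (p1 x) * v + g (p2 x) * u"
      by (simp add: u_def v_def algebra_simps)
    moreover have "u * v \<le> (u\<^sup>2 + v\<^sup>2) / 2" using sum_squares_bound[of u v] by simp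
    moreover have young: "a * w \<le> \<theta> + C\<^sup>2 / (4 * \<theta>) * w\<^sup>2" if "\<bar>a\<bar> \<le> C" for a w
    proof -
      have "a * w \<le> \<bar>a\<bar> * \<bar>w\<bar>" using abs_ge_self[of "a * w"] by (simp add: abs_mult)
      also have "\<dots> \<le> C * \<bar>w\<bar>" using that by (rule mult_right_mono) simp
      also have "\<dots> \<le> \<theta> + C\<^sup>2 / (4 * \<theta>) * w\<^sup>2"
      proof -
        have "0 \<le> (2 * \<theta> - C * \<bar>w\<bar>)\<^sup>2 / (4 * \<theta>)" using \<theta> by simp
        also have "\<dots> = \<theta> + C\<^sup>2 / (4 * \<theta>) * w\<^sup>2 - C * \<bar>w\<bar>"
          using \<theta> by (simp add: power2_diff power_mult_distrib field_simps) (simp add: power2_eq_square)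
        finally show ?thesis by simp
      qed
      finally show ?thesis .
    qed
    ultimately have "?l (p1 x) * ?l (p2 x) - g (p1 x) * g (p2 x) \<le> (u\<^sup>2 + v\<^sup>2) / 2 + (\<theta> + C\<^sup>2 / (4 * \<theta>) * v\<^sup>2) + (\<theta> + C\<^sup>2 / (4 * \<theta>) * u\<^sup>2)"
      using young[OF C, of "p1 x" v] young[OF C, of "p2 x" u] by linarith
    also have "\<dots> = K * S x + 2 * \<theta>"
      by (simp add: K_def S_def u_def v_def power2_commute[of "?l _"] distrib_right distrib_left)
    finally show ?thesis .
  qed
  have "(LINT x|N. ?l (p1 x) * ?l (p2 x)) - (LINT x|N. g (p1 x) * g (p2 x)) = (LINT x|N. ?l (p1 x) * ?l (p2 x) - g (p1 x) * g (p2 x))"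
    using intl intg by simp
  also have "\<dots> \<le> (LINT x|N. K * S x + 2 * \<theta>)"
    using intl intg S pw by (intro integral_mono) auto
  also have "\<dots> = K * integral\<^sup>L N S + 2 * \<theta> * m"
    using S by (simp add: m_def mult.commute)
  also have "\<dots> \<le> \<eta> / 2 + \<eta> / 2"
  proof (rule add_mono)
    show "K * integral\<^sup>L N S \<le> \<eta> / 2" using S(2) K by (simp add: field_simps)
    show "2 * \<theta> * m \<le> \<eta> / 2" unfolding \<theta>_def using m \<eta> by (simp add: field_simps)
  qed
  finally show "0 \<le> (LINT x|N. g (p1 x) * g (p2 x)) + \<eta>"
    using pos[OF l(1)] by simp
qed

end

section \<open>The energy space of the noise\<close>

lemma centred_gaussian_square_integrable:
  assumes "centred_gaussian P X"
  shows "integrable P (\<lambda>\<omega>. (X \<omega>)\<^sup>2)"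
  using assms unfolding centred_gaussian_def
proof (elim conjE disjE exE)
  assume [measurable]: "X \<in> borel_measurable P" and "AE \<omega> in P. X \<omega> = 0"
  then have "integrable P (\<lambda>\<omega>. (X \<omega>)\<^sup>2) \<longleftrightarrow> integrable P (\<lambda>_. 0 :: real)"
    by (intro integrable_cong_AE) auto
  then show ?thesis by simp
next
  fix \<sigma> :: real assume "0 < \<sigma>" "distributed P lborel X (\<lambda>x. ennreal (normal_density 0 \<sigma> x))"
  then show ?thesis
    using distributed_integrable[of P lborel X "normal_density 0 \<sigma>" "\<lambda>x. x\<^sup>2"] integrable_normal_moment[of \<sigma> 0 2] by simp
qed

lemma integrable_product_of_squares:
  fixes X Y :: "'w \<Rightarrow> real"
  assumes [measurable]: "X \<in> borel_measurable P" "Y \<in> borel_measurable P"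
    and "integrable P (\<lambda>\<omega>. (X \<omega>)\<^sup>2)" "integrable P (\<lambda>\<omega>. (Y \<omega>)\<^sup>2)"
  shows "integrable P (\<lambda>\<omega>. X \<omega> * Y \<omega>)"
proof (rule Bochner_Integration.integrable_bound)
  show "integrable P (\<lambda>\<omega>. (X \<omega>)\<^sup>2 + (Y \<omega>)\<^sup>2)" using assms by simp
  have "\<bar>x * y\<bar> \<le> x\<^sup>2 + y\<^sup>2" for x y :: real
    using sum_squares_bound[of x y] sum_squares_bound[of x "- y"] zero_le_power2[of x] zero_le_power2[of y] by (simp add: abs_le_iff)
  then show "AE \<omega> in P. norm (X \<omega> * Y \<omega>) \<le> norm ((X \<omega>)\<^sup>2 + (Y \<omega>)\<^sup>2)" by simp
qed simp

lemma fractional_covariance_nonneg: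
  assumes "0 < H" "0 \<le> t" "0 \<le> s"
  shows "0 \<le> fractional_covariance H t s"
proof -
  have "\<bar>t - s\<bar> powr (2 * H) \<le> max t s powr (2 * H)" using assms by (intro powr_mono2) auto
  also have "\<dots> \<le> t powr (2 * H) + s powr (2 * H)" by (simp add: max_def)
  finally show ?thesis by (simp add: fractional_covariance_def)
qed

definition slab :: "real \<Rightarrow> 'a set \<Rightarrow> real \<Rightarrow> 'a \<Rightarrow> real" where
  "slab t A \<tau> z = indicator {0..t} \<tau> * indicator A z"

lemma slab_measurable [measurable]:
  assumes [measurable]: "A \<in> sets borel"
  shows "spacetime_measurable (slab t A)"
  unfolding slab_def by measurable

lemma elem_fun_Nil [simp]: "elem_fun [] = (\<lambda>\<tau> z. 0)"
  by (simp add: elem_fun_def fun_eq_iff)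

lemma elem_fun_Cons: "elem_fun ((c, t, A) # l) = (\<lambda>\<tau> z. c * slab t A \<tau> z + elem_fun l \<tau> z)"
  by (simp add: elem_fun_def fun_eq_iff slab_def mult.assoc)

lemma elem_integral_Cons: "elem_integral W ((c, t, A) # l) = (\<lambda>\<omega>. c * W t A \<omega> + elem_integral W l \<omega>)"
  by (simp add: elem_integral_def fun_eq_iff)

lemma elementary_Cons: "elementary T ((c, t, A) # l) \<longleftrightarrow> 0 \<le> t \<and> t \<le> T \<and> A \<in> sets borel \<and> bounded A \<and> elementary T l"
  by (auto simp: elementary_def)

lemma elem_fun_measurable: "elementary T l \<Longrightarrow> spacetime_measurable (elem_fun l)"
proof (induction l)
  case (Cons p l)
  obtain c t A where p: "p = (c, t, A)" by (cases p)
  have [measurable]: "A \<in> sets borel" "spacetime_measurable (elem_fun l)"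
    using Cons by (auto simp: p elementary_Cons)
  have "spacetime_measurable (\<lambda>\<tau> z. c * slab t A \<tau> z + elem_fun l \<tau> z)"
    using slab_measurable[of A t] by (simp add: case_prod_beta')
  then show ?case by (simp only: p elem_fun_Cons)
qed (simp add: case_prod_beta')

lemma elem_fun_support: "elementary T l \<Longrightarrow> \<tau> \<notin> {0..T} \<Longrightarrow> elem_fun l \<tau> z = 0"
proof (induction l)
  case (Cons p l)
  obtain c t A where p: "p = (c, t, A)" by (cases p)
  show ?case using Cons by (auto simp: p elem_fun_Cons elementary_Cons slab_def)
qed simp

lemma cross_linear_left: "cross H (\<lambda>\<tau> z. a * g \<tau> z + b * g' \<tau> z) h x = a * cross H g h x + b * cross H g' h x"
  by (simp add: cross_def algebra_simps)

lemma cross_linear_right: "cross H h (\<lambda>\<tau> z. a * g \<tau> z + b * g' \<tau> z) x = a * cross H h g x + b * cross H h g' x"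
  by (simp add: cross_def algebra_simps)

locale coloured_noise = prob_space P for P :: "'w measure" +
  fixes T H :: real and \<Lambda> :: "'a::euclidean_space measure" and W :: "real \<Rightarrow> 'a set \<Rightarrow> 'w \<Rightarrow> real"
  assumes T: "0 < T" and H: "1 / 2 < H" "H < 1"
    and \<Lambda>: "tempered_measure \<Lambda>" and W: "gaussian_noise P T H \<Lambda> W"
begin

definition cH :: real where "cH = H * (2 * H - 1)"

lemma cH_pos: "0 < cH"
  using H by (simp add: cH_def)

lemma elem_integral_gaussian: "elementary T l \<Longrightarrow> centred_gaussian P (elem_integral W l)"
  using W by (simp add: gaussian_noise_def)

lemma elem_integral_measurable: "elementary T l \<Longrightarrow> elem_integral W l \<in> borel_measurable P"
  using elem_integral_gaussian by (auto simp: centred_gaussian_def)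

lemma elem_integral_product_integrable:
  "elementary T l \<Longrightarrow> elementary T l' \<Longrightarrow> integrable P (\<lambda>\<omega>. elem_integral W l \<omega> * elem_integral W l' \<omega>)"
  by (intro integrable_product_of_squares elem_integral_measurable centred_gaussian_square_integrable elem_integral_gaussian)

text \<open>Here the postulated covariance of W meets the energy form: for bounded A and B both
  sides are the fractional covariance times the finite mass of A x B.\<close>

lemma cross_slab:
  assumes t: "t \<in> {0..T}" "s \<in> {0..T}" and A: "A \<in> sets borel" "B \<in> sets borel" "bounded A" "bounded B"
  shows "integrable (energy_measure \<Lambda>) (cross H (slab t A) (slab s B))"
    and "cH * integral\<^sup>L (energy_measure \<Lambda>) (cross H (slab t A) (slab s B)) = (LINT \<omega>|P. W t A \<omega> * W s B \<omega>)"
proof -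
  have fin: "emeasure (pair_correlation \<Lambda>) (A \<times> B) = ennreal (measure (pair_correlation \<Lambda>) (A \<times> B))"
    using pair_correlation_Times_finite[OF \<Lambda> A] by (intro emeasure_eq_ennreal_measure) simp
  have fc: "0 \<le> fractional_covariance H t s" using H t by (intro fractional_covariance_nonneg) auto
  have nn: "(\<integral>\<^sup>+ x. ennreal (cross H (slab t A) (slab s B) x) \<partial>energy_measure \<Lambda>) = ennreal (fractional_covariance H t s / cH * measure (pair_correlation \<Lambda>) (A \<times> B))"
    using nn_integral_cross_rectangles[OF H _ _ \<Lambda> A(1,2), of t s] t fc cH_pos
    unfolding fin cH_def slab_def[abs_def] by (simp add: ennreal_mult[symmetric])
  have [measurable]: "cross H (slab t A) (slab s B) \<in> borel_measurable (energy_measure \<Lambda>)"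
    using A by (simp cong: measurable_cong_sets add: cross_measurable slab_measurable)
  have 0: "0 \<le> cross H (slab t A) (slab s B) x" for x by (simp add: cross_def slab_def)
  show "integrable (energy_measure \<Lambda>) (cross H (slab t A) (slab s B))"
    using nn by (intro integrableI_nonneg) (auto simp: 0)
  have "integral\<^sup>L (energy_measure \<Lambda>) (cross H (slab t A) (slab s B)) = fractional_covariance H t s / cH * measure (pair_correlation \<Lambda>) (A \<times> B)"
    using fc cH_pos by (subst integral_eq_nn_integral) (auto simp: 0 nn)
  then show "cH * integral\<^sup>L (energy_measure \<Lambda>) (cross H (slab t A) (slab s B)) = (LINT \<omega>|P. W t A \<omega> * W s B \<omega>)"
    using W t A cH_pos by (simp add: gaussian_noise_def)
qed

lemma cross_elem_slab:
  assumes l: "elementary T l" and s: "s \<in> {0..T}" and B: "B \<in> sets borel" "bounded B"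
  shows "integrable (energy_measure \<Lambda>) (cross H (elem_fun l) (slab s B)) \<and>
    cH * integral\<^sup>L (energy_measure \<Lambda>) (cross H (elem_fun l) (slab s B)) = (LINT \<omega>|P. elem_integral W l \<omega> * W s B \<omega>)"
  using l
proof (induction l)
  case Nil
  have "cross H (\<lambda>\<tau> z. 0) (slab s B) = (\<lambda>x. 0)" by (simp add: cross_def fun_eq_iff)
  then show ?case by (simp add: elem_integral_def)
next
  case (Cons p l)
  obtain c t A where p: "p = (c, t, A)" by (cases p)
  have l: "elementary T l" and t: "t \<in> {0..T}" and A: "A \<in> sets borel" "bounded A"
    using Cons.prems by (auto simp: p elementary_Cons)
  note IH = Cons.IH[OF l]
  note tA = cross_slab[OF t s A(1) B(1) A(2) B(2)]
  \<comment> \<open>A single noise variable is itself an elementary integral, hence Gaussian; its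
    measurability and second moment come from this.\<close>
  have WB: "elem_integral W [(1, s, B)] = W s B" by (simp add: elem_integral_def fun_eq_iff)
  have WA: "elem_integral W [(1, t, A)] = W t A" by (simp add: elem_integral_def fun_eq_iff)
  have eB: "elementary T [(1, s, B)]" "elementary T [(1, t, A)]" using s B t A by (auto simp: elementary_def)
  have i: "integrable P (\<lambda>\<omega>. W t A \<omega> * W s B \<omega>)" "integrable P (\<lambda>\<omega>. elem_integral W l \<omega> * W s B \<omega>)"
    using elem_integral_product_integrable[OF eB(2,1)] elem_integral_product_integrable[OF l eB(1)] by (simp_all add: WA WB)
  have "cross H (elem_fun (p # l)) (slab s B) = (\<lambda>x. c * cross H (slab t A) (slab s B) x + 1 * cross H (elem_fun l) (slab s B) x)"
    using cross_linear_left[of H c "slab t A" 1 "elem_fun l"] by (simp add: p elem_fun_Cons fun_eq_iff)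
  moreover have "(\<lambda>\<omega>. elem_integral W (p # l) \<omega> * W s B \<omega>) = (\<lambda>\<omega>. c * (W t A \<omega> * W s B \<omega>) + elem_integral W l \<omega> * W s B \<omega>)"
    by (simp add: p elem_integral_Cons fun_eq_iff algebra_simps)
  ultimately show ?case using IH tA i by (simp add: distrib_left mult.left_commute[of cH c])
qed

text \<open>Bilinear extension, one argument at a time. On the diagonal the energy of an elementary
  function becomes a second moment, and this is the source of all positivity of the energy.\<close>

lemma cross_elem:
  assumes l: "elementary T l" and l': "elementary T l'"
  shows "integrable (energy_measure \<Lambda>) (cross H (elem_fun l) (elem_fun l')) \<and>
    cH * integral\<^sup>L (energy_measure \<Lambda>) (cross H (elem_fun l) (elem_fun l')) = (LINT \<omega>|P. elem_integral W l \<omega> * elem_integral W l' \<omega>)"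
  using l'
proof (induction l')
  case Nil
  have "cross H (elem_fun l) (\<lambda>\<tau> z. 0) = (\<lambda>x. 0)" by (simp add: cross_def fun_eq_iff)
  then show ?case by (simp add: elem_integral_def)
next
  case (Cons p l')
  obtain c t A where p: "p = (c, t, A)" by (cases p)
  have l': "elementary T l'" and t: "t \<in> {0..T}" and A: "A \<in> sets borel" "bounded A"
    using Cons.prems by (auto simp: p elementary_Cons)
  note IH = Cons.IH[OF l']
  note tA = cross_elem_slab[OF l t A]
  have WA: "elem_integral W [(1, t, A)] = W t A" by (simp add: elem_integral_def fun_eq_iff)
  have eA: "elementary T [(1, t, A)]" using t A by (auto simp: elementary_def)
  have i: "integrable P (\<lambda>\<omega>. elem_integral W l \<omega> * W t A \<omega>)" "integrable P (\<lambda>\<omega>. elem_integral W l \<omega> * elem_integral W l' \<omega>)"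
    using elem_integral_product_integrable[OF l eA] elem_integral_product_integrable[OF l l'] by (simp_all add: WA)
  have "cross H (elem_fun l) (elem_fun (p # l')) = (\<lambda>x. c * cross H (elem_fun l) (slab t A) x + 1 * cross H (elem_fun l) (elem_fun l') x)"
    using cross_linear_right[of H "elem_fun l" c "slab t A" 1 "elem_fun l'"] by (simp add: p elem_fun_Cons fun_eq_iff)
  moreover have "(\<lambda>\<omega>. elem_integral W l \<omega> * elem_integral W (p # l') \<omega>) = (\<lambda>\<omega>. c * (elem_integral W l \<omega> * W t A \<omega>) + elem_integral W l \<omega> * elem_integral W l' \<omega>)"
    by (simp add: p elem_integral_Cons fun_eq_iff algebra_simps)
  ultimately show ?case using IH tA i by (simp add: distrib_left mult.left_commute[of cH c])
qed

text \<open>The support condition confines functions to the time interval on which the covariance of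
  the noise is given; positivity, which is inherited from the noise, is proved for these
  functions.\<close>

definition energy_space :: "(real \<Rightarrow> 'a \<Rightarrow> real) \<Rightarrow> bool" where
  "energy_space g \<longleftrightarrow> finite_energy H \<Lambda> g \<and> (\<forall>\<tau> z. \<tau> \<notin> {0..T} \<longrightarrow> g \<tau> z = 0)"

lemma energy_space_iff:
  "energy_space g \<longleftrightarrow> spacetime_measurable g \<and> integrable (energy_measure \<Lambda>) (cross H g g) \<and> (\<forall>\<tau> z. \<tau> \<notin> {0..T} \<longrightarrow> g \<tau> z = 0)"
  by (auto simp: energy_space_def finite_energy_def energy_integrand_eq_cross)

lemma energy_eq: "energy H \<Lambda> g = cH * integral\<^sup>L (energy_measure \<Lambda>) (cross H g g)"
  by (simp add: energy_def cH_def energy_integrand_eq_cross)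

lemma elem_energy_space: "elementary T l \<Longrightarrow> energy_space (elem_fun l)"
  using cross_elem by (auto simp: energy_space_iff elem_fun_measurable elem_fun_support)

lemma energy_elem: "elementary T l \<Longrightarrow> energy H \<Lambda> (elem_fun l) = (LINT \<omega>|P. (elem_integral W l \<omega>)\<^sup>2)"
  using cross_elem[of l l] by (simp add: energy_eq power2_eq_square)

lemma cross_borel:
  assumes "spacetime_measurable g" "spacetime_measurable h"
  shows "cross H g h \<in> borel_measurable (energy_measure \<Lambda>)"
  using cross_measurable[OF assms] by (simp cong: measurable_cong_sets)

text \<open>The energy integrand of the indicator of [0, T] times a ball. Used as a density, it
  replaces the energy measure by a finite one.\<close>

definition box_weight :: "real \<Rightarrow> (real \<times> real) \<times> ('a \<times> 'a) \<Rightarrow> real" where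
  "box_weight R = cross H (slab T (cball 0 R)) (slab T (cball 0 R))"

lemma box_weight_nonneg: "0 \<le> box_weight R x"
  by (simp add: box_weight_def cross_def slab_def)

lemma box_weight_integrable: "integrable (energy_measure \<Lambda>) (box_weight R)"
  unfolding box_weight_def using T by (intro cross_slab) auto

lemma box_weight_mult:
  "box_weight R x * (g (fst (fst x), fst (snd x)) * g (snd (fst x), snd (snd x)))
   = cross H (\<lambda>\<tau> z. g (\<tau>, z) * slab T (cball 0 R) \<tau> z) (\<lambda>\<tau> z. g (\<tau>, z) * slab T (cball 0 R) \<tau> z) x"
  by (simp add: box_weight_def cross_def)

text \<open>The reason for half-lines in the generator: cut by the slab, {..a} x A becomes
  [0, min a T] times a bounded Borel set, which is exactly the shape of a term of an elementary
  function.\<close>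

lemma indicator_comb_slab_elementary:
  assumes "\<forall>(c, E)\<in>set l. E \<in> {B \<times> A |B A. B \<in> insert UNIV (range atMost) \<and> A \<in> sets borel}"
  shows "\<exists>l'. elementary T l' \<and> elem_fun l' = (\<lambda>\<tau> z. indicator_comb l (\<tau>, z) * slab T (cball 0 R) \<tau> z)"
  using assms
proof (induction l)
  case Nil
  show ?case by (intro exI[of _ "[]"]) (simp add: elementary_def)
next
  case (Cons p l)
  obtain c E where p: "p = (c, E)" by (cases p)
  obtain l' where l': "elementary T l'" "elem_fun l' = (\<lambda>\<tau> z. indicator_comb l (\<tau>, z) * slab T (cball 0 R) \<tau> z)"
    using Cons by auto
  obtain B A where E: "E = B \<times> A" "B \<in> insert UNIV (range atMost)" "A \<in> sets borel"
    using Cons.prems by (auto simp: p)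
  obtain c' t where t: "t \<in> {0..T}" "\<And>\<tau>. c * (indicator B \<tau> * indicator {0..T} \<tau>) = c' * indicator {0..t} \<tau>"
  proof (cases "B = UNIV")
    case True
    then show ?thesis using T by (intro that[of T c]) auto
  next
    case False
    then obtain a where B: "B = {..a}" using E by auto
    show ?thesis
    proof (cases "0 \<le> a")
      case True
      then show ?thesis using T B by (intro that[of "min a T" c]) (auto split: split_indicator)
    next
      case False
      \<comment> \<open>A half-line ending before 0 misses [0, T]. The coefficient must be 0 here,
        since the interval from 0 to 0 still contains a point.\<close>
      then show ?thesis using T B by (intro that[of 0 0]) (auto split: split_indicator)
    qed
  qed
  have "elementary T ((c', t, A \<inter> cball 0 R) # l')"
    using t E l' by (auto simp: elementary_Cons intro: bounded_subset[OF bounded_cball])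
  moreover have "elem_fun ((c', t, A \<inter> cball 0 R) # l') = (\<lambda>\<tau> z. indicator_comb (p # l) (\<tau>, z) * slab T (cball 0 R) \<tau> z)"
  proof (intro ext)
    fix \<tau> z
    have "c' * slab t (A \<inter> cball 0 R) \<tau> z = (c * (indicator B \<tau> * indicator {0..T} \<tau>)) * (indicator A z * indicator (cball 0 R) z)"
      unfolding t(2) by (simp add: slab_def indicator_inter_arith)
    also have "\<dots> = c * indicator E (\<tau>, z) * slab T (cball 0 R) \<tau> z"
      by (simp add: E slab_def indicator_times mult_ac)
    finally show "elem_fun ((c', t, A \<inter> cball 0 R) # l') \<tau> z = indicator_comb (p # l) (\<tau>, z) * slab T (cball 0 R) \<tau> z"
      by (simp add: elem_fun_Cons l'(2) p distrib_right)
  qed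
  ultimately show ?case by blast
qed

text \<open>For a fixed A, the sets B with B x A in the generated algebra are shown to include all
  Borel sets by induction over their generation. The full line accompanies the half-lines because
  complements are taken inside UNIV x A, and because the approximation argument wants the whole
  space in the generator.\<close>

lemma sets_borel_pair_generator:
  "sets (borel \<Otimes>\<^sub>M borel :: (real \<times> 'a) measure) = sigma_sets UNIV {B \<times> A |B A. B \<in> insert UNIV (range atMost) \<and> A \<in> sets borel}"
    (is "_ = sigma_sets UNIV ?G")
proof
  have "B \<times> A \<in> sigma_sets UNIV ?G" if "B \<in> sets borel" "A \<in> sets borel" for B and A :: "'a set"
  proof -
    have "B \<in> sigma_sets UNIV (range atMost)" using that by (simp add: borel_eq_atMost)
    then show ?thesis
    proof induction
      case (Compl B)
      have "UNIV \<times> A \<in> sigma_sets UNIV ?G" using that by (intro sigma_sets.Basic) auto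
      then have "UNIV \<times> A - B \<times> A \<in> sigma_sets UNIV ?G"
        using Compl by (intro ring_of_sets.Diff[OF algebra.axioms(1)[OF sigma_algebra.axioms(1)[OF sigma_algebra_sigma_sets]]]) auto
      moreover have "UNIV \<times> A - B \<times> A = (UNIV - B) \<times> A" by auto
      ultimately show ?case by simp
    next
      case (Union B)
      have "(\<Union>i. B i \<times> A) \<in> sigma_sets UNIV ?G" using Union by (intro sigma_sets.Union) auto
      moreover have "(\<Union>i. B i \<times> A) = \<Union> (range B) \<times> A" by auto
      ultimately show ?case by simp
    qed (use that in \<open>auto intro: sigma_sets.Basic sigma_sets.Empty\<close>)
  qed
  then have "sigma_sets UNIV {B \<times> A |B A. B \<in> sets borel \<and> A \<in> sets (borel :: 'a measure)} \<subseteq> sigma_sets UNIV ?G"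
    by (intro sigma_sets_mono) auto
  then show "sets (borel \<Otimes>\<^sub>M borel :: (real \<times> 'a) measure) \<subseteq> sigma_sets UNIV ?G"
    by (simp add: sets_pair_measure)
  have "(UNIV :: (real \<times> 'a) set) \<in> sets (borel \<Otimes>\<^sub>M borel)"
    using sets.top[of "borel \<Otimes>\<^sub>M borel :: (real \<times> 'a) measure"] by (simp add: space_pair_measure)
  then show "sigma_sets UNIV ?G \<subseteq> sets (borel \<Otimes>\<^sub>M borel :: (real \<times> 'a) measure)"
  proof (rule sets.sigma_sets_subset'[rotated])
    show "?G \<subseteq> sets (borel \<Otimes>\<^sub>M borel :: (real \<times> 'a) measure)" by (auto intro!: pair_measureI)
  qed
qed

text \<open>With the box weight as density, the energy of the truncated function is the form of
  \<open>two_projections\<close> for the projections to (\<tau>, z) and (\<sigma>, w). Its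
  positivity on the generator is the positivity of second moments of elementary integrals.\<close>

lemma energy_simple_nonneg:
  fixes g :: "real \<times> 'a \<Rightarrow> real" and R :: real
  assumes g: "simple_function (borel \<Otimes>\<^sub>M borel) g"
  defines "h \<equiv> \<lambda>\<tau> z. g (\<tau>, z) * slab T (cball 0 R) \<tau> z"
  shows "0 \<le> integral\<^sup>L (energy_measure \<Lambda>) (cross H h h)"
proof -
  let ?G = "{B \<times> A |B A. B \<in> insert UNIV (range atMost) \<and> A \<in> sets borel} :: (real \<times> 'a) set set"
  let ?N = "density (energy_measure \<Lambda>) (\<lambda>x. ennreal (box_weight R x))"
  let ?p1 = "\<lambda>x :: (real \<times> real) \<times> ('a \<times> 'a). (fst (fst x), fst (snd x))"
  let ?p2 = "\<lambda>x :: (real \<times> real) \<times> ('a \<times> 'a). (snd (fst x), snd (snd x))"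
  have bw [measurable]: "box_weight R \<in> borel_measurable ((borel \<Otimes>\<^sub>M borel) \<Otimes>\<^sub>M (borel \<Otimes>\<^sub>M borel))"
    unfolding box_weight_def by (intro cross_measurable slab_measurable) auto
  have fin: "emeasure ?N (space ?N) < \<infinity>"
  proof -
    have "(UNIV :: ((real \<times> real) \<times> ('a \<times> 'a)) set) \<in> sets ((borel \<Otimes>\<^sub>M borel) \<Otimes>\<^sub>M (borel \<Otimes>\<^sub>M borel))"
      using sets.top[of "(borel \<Otimes>\<^sub>M borel) \<Otimes>\<^sub>M (borel \<Otimes>\<^sub>M borel) :: ((real \<times> real) \<times> ('a \<times> 'a)) measure"] by (simp add: space_pair_measure)
    then show ?thesis
      using nn_integral_eq_integral[OF box_weight_integrable[of R]] bw
      by (subst emeasure_density) (auto simp: box_weight_nonneg cong: measurable_cong_sets)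
  qed
  have two: "two_projections ?N (borel \<Otimes>\<^sub>M borel) ?p1 ?p2 ?G"
    unfolding two_projections_def two_projections_axioms_def
  proof (intro conjI)
    show "finite_measure ?N" using fin by (intro finite_measureI) simp
    show "?p1 \<in> ?N \<rightarrow>\<^sub>M borel \<Otimes>\<^sub>M borel" "?p2 \<in> ?N \<rightarrow>\<^sub>M borel \<Otimes>\<^sub>M borel" by measurable
    show "Int_stable ?G"
    proof (rule Int_stableI, clarify)
      fix B A B' A' :: "_ set"
      assume *: "B \<in> insert UNIV (range (atMost :: real \<Rightarrow> _))" "B' \<in> insert UNIV (range (atMost :: real \<Rightarrow> _))" "A \<in> sets (borel :: 'a measure)" "A' \<in> sets (borel :: 'a measure)"
      have "B \<inter> B' \<in> insert UNIV (range atMost)" using *(1,2) by (auto simp: image_iff)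
      then show "\<exists>Ba Aa. B \<times> A \<inter> B' \<times> A' = Ba \<times> Aa \<and> Ba \<in> insert UNIV (range atMost) \<and> Aa \<in> sets borel"
        using * by (intro exI[of _ "B \<inter> B'"] exI[of _ "A \<inter> A'"]) auto
    qed
    show "sets (borel \<Otimes>\<^sub>M borel) = sigma_sets (space (borel \<Otimes>\<^sub>M borel)) ?G"
      by (simp add: sets_borel_pair_generator space_pair_measure)
    have "UNIV = UNIV \<times> (UNIV :: 'a set)" by simp
    then show "space (borel \<Otimes>\<^sub>M borel) \<in> ?G" by (auto simp: space_pair_measure intro!: exI[of _ UNIV])
  qed (simp add: space_pair_measure)
  interpret two_projections ?N "borel \<Otimes>\<^sub>M borel" ?p1 ?p2 ?G by (rule two)
  have eq: "(LINT x|?N. f (?p1 x) * f (?p2 x)) = integral\<^sup>L (energy_measure \<Lambda>) (cross H (\<lambda>\<tau> z. f (\<tau>, z) * slab T (cball 0 R) \<tau> z) (\<lambda>\<tau> z. f (\<tau>, z) * slab T (cball 0 R) \<tau> z))"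
    if [measurable]: "f \<in> borel_measurable (borel \<Otimes>\<^sub>M borel)" for f
    by (subst integral_density) (auto simp: box_weight_nonneg box_weight_mult[symmetric] intro!: Bochner_Integration.integral_cong)
  have gm [measurable]: "g \<in> borel_measurable (borel \<Otimes>\<^sub>M borel)" using g by (rule borel_measurable_simple_function)
  have "finite (range g)" using g by (simp add: simple_function_def space_pair_measure)
  then have C: "\<bar>g y\<bar> \<le> Max (abs ` range g)" for y by (intro Max_ge) auto
  have "0 \<le> (LINT x|?N. g (?p1 x) * g (?p2 x))"
  proof (rule quadratic_form_nonneg[OF gm C])
    show "approximable g" by (rule approximable_simple_function[OF g]) (simp add: space_pair_measure)
    fix l :: "(real \<times> (real \<times> 'a) set) list" assume l: "\<forall>(c, E)\<in>set l. E \<in> ?G"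
    obtain l' where l': "elementary T l'" "elem_fun l' = (\<lambda>\<tau> z. indicator_comb l (\<tau>, z) * slab T (cball 0 R) \<tau> z)"
      using indicator_comb_slab_elementary[OF l] by blast
    have "0 \<le> energy H \<Lambda> (elem_fun l')" by (simp add: energy_elem[OF l'(1)])
    then have "0 \<le> integral\<^sup>L (energy_measure \<Lambda>) (cross H (elem_fun l') (elem_fun l'))"
      using cH_pos by (simp add: energy_eq zero_le_mult_iff)
    then show "0 \<le> (LINT x|?N. indicator_comb l (?p1 x) * indicator_comb l (?p2 x))"
      using comb_measurable[OF l] by (subst eq) (simp_all add: l'(2))
  qed
  then show ?thesis unfolding eq[OF gm] h_def .
qed

lemma slab_tendsto_1:
  fixes z :: 'a
  shows "\<forall>\<^sub>F n in sequentially. slab T (cball 0 (real n)) \<tau> z = indicator {0..T} \<tau>"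
proof -
  obtain N where "norm z \<le> real N" using real_arch_simple by blast
  then show ?thesis
    unfolding eventually_sequentially by (intro exI[of _ N]) (auto simp: slab_def)
qed

text \<open>Simple functions cut off to growing boxes converge to g. Their cross integrands are
  dominated by a multiple of that of g, which is absolutely integrable by the very definition of
  finite energy.\<close>

theorem energy_nonneg:
  assumes "energy_space g"
  shows "0 \<le> energy H \<Lambda> g"
proof -
  have g: "spacetime_measurable g" and int: "integrable (energy_measure \<Lambda>) (cross H g g)" and supp: "\<And>\<tau> z. \<tau> \<notin> {0..T} \<Longrightarrow> g \<tau> z = 0"
    using assms by (auto simp: energy_space_iff)
  \<comment> \<open>The bound by 2 |g| enters once for each factor of the cross integrand, hence the
    4 in the dominating function.\<close>
  obtain F where F: "\<And>i. simple_function (borel \<Otimes>\<^sub>M borel) (F i)" "\<And>x. (\<lambda>i. F i x) \<longlonglongrightarrow> case_prod g x"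
    "\<And>i x. \<bar>F i x\<bar> \<le> 2 * \<bar>case_prod g x\<bar>"
    using borel_measurable_implies_sequence_metric[OF g, of 0] by (auto simp: space_pair_measure dist_real_def)
  define h where "h n \<tau> z = F n (\<tau>, z) * slab T (cball 0 (real n)) \<tau> z" for n \<tau> z
  have [measurable]: "spacetime_measurable (h n)" for n
  proof -
    have [measurable]: "F n \<in> borel_measurable (borel \<Otimes>\<^sub>M borel)" using F(1) by (rule borel_measurable_simple_function)
    have "case_prod (h n) = (\<lambda>x. F n x * case_prod (slab T (cball 0 (real n))) x)" by (auto simp: h_def)
    moreover have "\<dots> \<in> borel_measurable (borel \<Otimes>\<^sub>M borel)" by measurable
    ultimately show ?thesis by simp
  qed
  have hlim: "(\<lambda>n. h n \<tau> z) \<longlonglongrightarrow> g \<tau> z" for \<tau> z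
  proof -
    have "(\<lambda>n. F n (\<tau>, z) * indicator {0..T} \<tau>) \<longlonglongrightarrow> g \<tau> z * indicator {0..T} \<tau>"
      using F(2)[of "(\<tau>, z)"] by (intro tendsto_mult) auto
    also have "g \<tau> z * indicator {0..T} \<tau> = g \<tau> z" using supp[of \<tau> z] by (auto split: split_indicator)
    finally show ?thesis
      by (rule Lim_transform_eventually) (use slab_tendsto_1[of \<tau> z] in eventually_elim, simp add: h_def)
  qed
  have hle: "\<bar>h n \<tau> z\<bar> \<le> 2 * \<bar>g \<tau> z\<bar>" for n \<tau> z
    using F(3)[of n "(\<tau>, z)"] by (auto simp: h_def slab_def split: split_indicator)
  have "(\<lambda>n. integral\<^sup>L (energy_measure \<Lambda>) (cross H (h n) (h n))) \<longlonglongrightarrow> integral\<^sup>L (energy_measure \<Lambda>) (cross H g g)"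
  proof (rule integral_dominated_convergence[where w="\<lambda>x. 4 * \<bar>cross H g g x\<bar>"])
    show "AE x in energy_measure \<Lambda>. (\<lambda>n. cross H (h n) (h n) x) \<longlonglongrightarrow> cross H g g x"
      unfolding cross_def by (intro AE_I2 tendsto_intros hlim)
    show "AE x in energy_measure \<Lambda>. norm (cross H (h n) (h n) x) \<le> 4 * \<bar>cross H g g x\<bar>" for n
    proof (rule AE_I2)
      fix x
      have "\<bar>h n (fst (fst x)) (fst (snd x))\<bar> * \<bar>h n (snd (fst x)) (snd (snd x))\<bar> \<le> (2 * \<bar>g (fst (fst x)) (fst (snd x))\<bar>) * (2 * \<bar>g (snd (fst x)) (snd (snd x))\<bar>)"
        by (intro mult_mono hle) auto
      then have "\<bar>fst (fst x) - snd (fst x)\<bar> powr (2 * H - 2) * (\<bar>h n (fst (fst x)) (fst (snd x))\<bar> * \<bar>h n (snd (fst x)) (snd (snd x))\<bar>) \<le> \<bar>fst (fst x) - snd (fst x)\<bar> powr (2 * H - 2) * ((2 * \<bar>g (fst (fst x)) (fst (snd x))\<bar>) * (2 * \<bar>g (snd (fst x)) (snd (snd x))\<bar>))"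
        by (rule mult_left_mono) simp
      then show "norm (cross H (h n) (h n) x) \<le> 4 * \<bar>cross H g g x\<bar>"
        by (simp add: cross_def abs_mult mult_ac)
    qed
  qed (use int in \<open>auto intro!: cross_borel g\<close>)
  moreover have "0 \<le> integral\<^sup>L (energy_measure \<Lambda>) (cross H (h n) (h n))" for n
    using energy_simple_nonneg[OF F(1), of n "real n"] unfolding h_def[abs_def] .
  ultimately have "0 \<le> integral\<^sup>L (energy_measure \<Lambda>) (cross H g g)"
    by (intro LIMSEQ_le_const) auto
  then show ?thesis using cH_pos by (simp add: energy_eq)
qed

lemma energy_space_bounded:
  fixes g h :: "real \<Rightarrow> 'a \<Rightarrow> real"
  assumes g: "spacetime_measurable g" and h: "spacetime_measurable h"
    and le: "\<And>\<tau> z. \<bar>g \<tau> z\<bar> \<le> C * slab T (cball 0 R) \<tau> z" "\<And>\<tau> z. \<bar>h \<tau> z\<bar> \<le> C * slab T (cball 0 R) \<tau> z"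
  shows "integrable (energy_measure \<Lambda>) (cross H g h)"
proof (rule Bochner_Integration.integrable_bound)
  show "integrable (energy_measure \<Lambda>) (\<lambda>x. C * C * box_weight R x)" using box_weight_integrable by simp
  show "AE x in energy_measure \<Lambda>. norm (cross H g h x) \<le> norm (C * C * box_weight R x)"
  proof (rule AE_I2)
    fix x :: "(real \<times> real) \<times> ('a \<times> 'a)"
    let ?a = "slab T (cball 0 R) (fst (fst x)) (fst (snd x))" and ?b = "slab T (cball 0 R) (snd (fst x)) (snd (snd x))"
    have "\<bar>g (fst (fst x)) (fst (snd x))\<bar> * \<bar>h (snd (fst x)) (snd (snd x))\<bar> \<le> (C * ?a) * (C * ?b)"
      using le(1)[of "fst (fst x)" "fst (snd x)"] by (intro mult_mono le) auto
    then have "\<bar>fst (fst x) - snd (fst x)\<bar> powr (2 * H - 2) * (\<bar>g (fst (fst x)) (fst (snd x))\<bar> * \<bar>h (snd (fst x)) (snd (snd x))\<bar>)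
      \<le> \<bar>fst (fst x) - snd (fst x)\<bar> powr (2 * H - 2) * ((C * ?a) * (C * ?b))"
      by (rule mult_left_mono) simp
    also have "\<dots> = C * C * box_weight R x" by (simp add: box_weight_def cross_def mult_ac)
    finally have "\<bar>cross H g h x\<bar> \<le> C * C * box_weight R x" by (simp add: cross_def abs_mult mult.assoc)
    then show "norm (cross H g h x) \<le> norm (C * C * box_weight R x)" by simp
  qed
qed (intro cross_borel g h)

text \<open>
  Positivity of the energy of differences of truncations bounds the cross terms by the energies
  of \<open>\<bar>g\<bar>\<close> and \<open>\<bar>h\<bar>\<close>, uniformly in the truncation level.
\<close>
lemma cross_integrable:
  assumes g: "energy_space g" and h: "energy_space h"
  shows "integrable (energy_measure \<Lambda>) (cross H g h)"
proof -
  have gm: "spacetime_measurable g" and gi: "integrable (energy_measure \<Lambda>) (cross H g g)" and gs: "\<And>\<tau> z. \<tau> \<notin> {0..T} \<Longrightarrow> g \<tau> z = 0"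
    using g by (auto simp: energy_space_iff)
  have hm: "spacetime_measurable h" and hi: "integrable (energy_measure \<Lambda>) (cross H h h)" and hs: "\<And>\<tau> z. \<tau> \<notin> {0..T} \<Longrightarrow> h \<tau> z = 0"
    using h by (auto simp: energy_space_iff)
  \<comment> \<open>Truncating absolute values makes all cross integrands nonnegative and increasing
    in n: the cross term in the other order can be discarded, and monotone convergence
    applies.\<close>
  define tr :: "(real \<Rightarrow> 'a \<Rightarrow> real) \<Rightarrow> nat \<Rightarrow> real \<Rightarrow> 'a \<Rightarrow> real" where "tr f n \<tau> z = min \<bar>f \<tau> z\<bar> (real n) * slab T (cball 0 (real n)) \<tau> z" for f n \<tau> z
  have tr0: "0 \<le> tr f n \<tau> z" for f n \<tau> z by (simp add: tr_def slab_def)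
  have trle: "tr f n \<tau> z \<le> \<bar>f \<tau> z\<bar>" for f n \<tau> z by (auto simp: tr_def slab_def split: split_indicator)
  have trC: "\<bar>tr f n \<tau> z\<bar> \<le> real n * slab T (cball 0 (real n)) \<tau> z" for f n \<tau> z
    by (auto simp: tr_def slab_def split: split_indicator)
  have trm: "spacetime_measurable (tr f n)" if "spacetime_measurable f" for f n
  proof -
    have "case_prod (tr f n) = (\<lambda>x. min \<bar>case_prod f x\<bar> (real n) * case_prod (slab T (cball 0 (real n))) x)" by (auto simp: tr_def)
    moreover have "\<dots> \<in> borel_measurable (borel \<Otimes>\<^sub>M borel)" using that by measurable
    ultimately show ?thesis by simp
  qed
  have int: "integrable (energy_measure \<Lambda>) (cross H (tr f n) (tr f' n))" if "spacetime_measurable f" "spacetime_measurable f'" for f f' n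
    using that by (intro energy_space_bounded[where C="real n" and R="real n"] trm trC)
  have mono: "cross H (tr f n) (tr f' m) x \<le> \<bar>cross H f f' x\<bar>" for f f' n m x
    unfolding cross_def abs_mult mult.assoc by (intro mult_mono trle mult_nonneg_nonneg tr0) auto
  have cr0: "0 \<le> cross H (tr f n) (tr f' m) x" for f f' n m x
    unfolding cross_def by (intro mult_nonneg_nonneg tr0) auto
  define K where "K = (LINT x|energy_measure \<Lambda>. \<bar>cross H g g x\<bar>) + (LINT x|energy_measure \<Lambda>. \<bar>cross H h h x\<bar>)"
  let ?I = "\<lambda>f f' n. integral\<^sup>L (energy_measure \<Lambda>) (cross H (tr f n) (tr f' n))"
  have bound: "?I g h n \<le> K" for n
  proof -
    let ?d = "\<lambda>\<tau> z. 1 * tr g n \<tau> z + (-1) * tr h n \<tau> z"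
    have dx: "cross H ?d ?d x = cross H (tr g n) (tr g n) x - cross H (tr g n) (tr h n) x - (cross H (tr h n) (tr g n) x - cross H (tr h n) (tr h n) x)" for x
      by (simp add: cross_def algebra_simps)
    have "energy_space ?d"
      unfolding energy_space_iff
    proof (intro conjI allI impI)
      show "spacetime_measurable ?d"
        using trm[OF gm, of n] trm[OF hm, of n] by (simp add: case_prod_beta')
      show "integrable (energy_measure \<Lambda>) (cross H ?d ?d)"
        unfolding dx[abs_def] using int gm hm by simp
      show "?d \<tau> z = 0" if "\<tau> \<notin> {0..T}" for \<tau> z using that by (simp add: tr_def slab_def)
    qed
    then have "0 \<le> integral\<^sup>L (energy_measure \<Lambda>) (cross H ?d ?d)"
      using energy_nonneg[of ?d] cH_pos by (simp add: energy_eq zero_le_mult_iff)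
    also have "\<dots> = ?I g g n - ?I g h n - (?I h g n - ?I h h n)"
      unfolding dx[abs_def] using int gm hm by simp
    finally have "?I g h n \<le> ?I g g n + ?I h h n - ?I h g n" by simp
    moreover have "0 \<le> ?I h g n" by (intro Bochner_Integration.integral_nonneg cr0)
    moreover have "?I g g n \<le> (LINT x|energy_measure \<Lambda>. \<bar>cross H g g x\<bar>)" using gi gm int by (intro integral_mono mono) auto
    moreover have "?I h h n \<le> (LINT x|energy_measure \<Lambda>. \<bar>cross H h h x\<bar>)" using hi hm int by (intro integral_mono mono) auto
    ultimately show ?thesis by (simp add: K_def)
  qed
  let ?u = "\<lambda>n x. ennreal (cross H (tr g n) (tr h n) x)"
  have "(\<integral>\<^sup>+ x. ennreal (norm (cross H g h x)) \<partial>energy_measure \<Lambda>) \<le> (\<integral>\<^sup>+ x. (SUP n. ?u n x) \<partial>energy_measure \<Lambda>)"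
  proof (intro nn_integral_mono)
    fix x :: "(real \<times> real) \<times> ('a \<times> 'a)"
    let ?\<tau> = "fst (fst x)" and ?z = "fst (snd x)" and ?\<sigma> = "snd (fst x)" and ?w = "snd (snd x)"
    have ev: "\<forall>\<^sub>F n in sequentially. tr f n \<tau> z = \<bar>f \<tau> z\<bar>" if "\<And>\<tau> z. \<tau> \<notin> {0..T} \<Longrightarrow> f \<tau> z = 0" for f \<tau> z
    proof -
      have "\<forall>\<^sub>F n in sequentially. \<bar>f \<tau> z\<bar> \<le> real n"
        using filterlim_real_sequentially by (auto simp: filterlim_at_top)
      with slab_tendsto_1[of \<tau> z] show ?thesis
        by eventually_elim (use that[of \<tau> z] in \<open>auto simp: tr_def split: split_indicator\<close>)
    qed
    have evg: "\<forall>\<^sub>F n in sequentially. tr g n ?\<tau> ?z = \<bar>g ?\<tau> ?z\<bar>" by (rule ev) (rule gs)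
    have evh: "\<forall>\<^sub>F n in sequentially. tr h n ?\<sigma> ?w = \<bar>h ?\<sigma> ?w\<bar>" by (rule ev) (rule hs)
    from evg evh have "\<forall>\<^sub>F n in sequentially. cross H (tr g n) (tr h n) x = \<bar>cross H g h x\<bar>"
      by eventually_elim (simp add: cross_def abs_mult)
    then obtain n where "cross H (tr g n) (tr h n) x = \<bar>cross H g h x\<bar>" by (auto simp: eventually_sequentially)
    then have "ennreal (norm (cross H g h x)) = ?u n x" by simp
    also have "\<dots> \<le> (SUP n. ?u n x)" by (rule SUP_upper) simp
    finally show "ennreal (norm (cross H g h x)) \<le> (SUP n. ?u n x)" .
  qed
  also have "\<dots> = (SUP n. \<integral>\<^sup>+ x. ?u n x \<partial>energy_measure \<Lambda>)"
  proof (rule nn_integral_monotone_convergence_SUP)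
    have "tr f n \<tau> z \<le> tr f m \<tau> z" if "n \<le> m" for f n m \<tau> z
      using that unfolding tr_def slab_def by (intro mult_mono) (auto split: split_indicator)
    then show "incseq ?u"
      unfolding incseq_def le_fun_def cross_def by (intro allI impI ennreal_leI mult_mono mult_nonneg_nonneg tr0) auto
    show "?u n \<in> borel_measurable (energy_measure \<Lambda>)" for n
      using cross_borel[OF trm[OF gm] trm[OF hm]] by simp
  qed
  also have "\<dots> \<le> ennreal K"
  proof (rule SUP_least)
    fix n
    have "(\<integral>\<^sup>+ x. ?u n x \<partial>energy_measure \<Lambda>) = ennreal (?I g h n)"
      by (intro nn_integral_eq_integral int gm hm AE_I2 cr0)
    then show "(\<integral>\<^sup>+ x. ?u n x \<partial>energy_measure \<Lambda>) \<le> ennreal K" using bound by (simp add: ennreal_leI)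
  qed
  also have "\<dots> < \<infinity>" by simp
  finally show ?thesis
    using cross_borel[OF gm hm] by (simp add: integrable_iff_bounded)
qed

definition cross_energy :: "(real \<Rightarrow> 'a \<Rightarrow> real) \<Rightarrow> (real \<Rightarrow> 'a \<Rightarrow> real) \<Rightarrow> real" where
  "cross_energy g h = cH * integral\<^sup>L (energy_measure \<Lambda>) (cross H g h)"

lemma energy_space_linear:
  assumes g: "energy_space g" and h: "energy_space h"
  shows "energy_space (\<lambda>\<tau> z. a * g \<tau> z + b * h \<tau> z)"
    and "energy H \<Lambda> (\<lambda>\<tau> z. a * g \<tau> z + b * h \<tau> z) = a\<^sup>2 * energy H \<Lambda> g + b\<^sup>2 * energy H \<Lambda> h + a * b * (cross_energy g h + cross_energy h g)"
proof -
  let ?f = "\<lambda>\<tau> z. a * g \<tau> z + b * h \<tau> z"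
  have eq: "cross H ?f ?f = (\<lambda>x. a\<^sup>2 * cross H g g x + b\<^sup>2 * cross H h h x + a * b * (cross H g h x + cross H h g x))"
    by (simp add: cross_def fun_eq_iff algebra_simps power2_eq_square)
  note int = cross_integrable[OF g g] cross_integrable[OF h h] cross_integrable[OF g h] cross_integrable[OF h g]
  have "integrable (energy_measure \<Lambda>) (cross H ?f ?f)" unfolding eq using int by simp
  moreover have "spacetime_measurable ?f"
  proof -
    have "(\<lambda>x. a * case_prod g x + b * case_prod h x) \<in> borel_measurable (borel \<Otimes>\<^sub>M borel)"
      using g h unfolding energy_space_iff by (intro borel_measurable_add borel_measurable_times borel_measurable_const) auto
    then show ?thesis by (simp add: case_prod_beta')
  qed
  ultimately show "energy_space ?f" using g h by (auto simp: energy_space_iff)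
  show "energy H \<Lambda> ?f = a\<^sup>2 * energy H \<Lambda> g + b\<^sup>2 * energy H \<Lambda> h + a * b * (cross_energy g h + cross_energy h g)"
    unfolding energy_eq eq cross_energy_def using int by (simp add: algebra_simps)
qed

lemma energy_space_diff:
  assumes "energy_space g" "energy_space h"
  shows "energy_space (\<lambda>\<tau> z. g \<tau> z - h \<tau> z)"
    and "energy H \<Lambda> (\<lambda>\<tau> z. g \<tau> z - h \<tau> z) = energy H \<Lambda> g + energy H \<Lambda> h - (cross_energy g h + cross_energy h g)"
  using energy_space_linear[OF assms, of 1 "-1"] by simp_all

end

section \<open>Triangle inequalities and the Wiener isometry\<close>

lemma quadratic_triangle:
  fixes A B C :: real
  assumes "\<And>a b. 0 \<le> a\<^sup>2 * A + b\<^sup>2 * B + a * b * C"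
  shows "sqrt (A + B + C) \<le> sqrt A + sqrt B"
proof -
  have A: "0 \<le> A" using assms[of 1 0] by simp
  have B: "0 \<le> B" using assms[of 0 1] by simp
  \<comment> \<open>Cauchy-Schwarz for an abstract nonnegative form, so that energy and second
    moments are served alike. In the nondegenerate case the test point is a = - sqrt B, b = sqrt
    A.\<close>
  have "C \<le> 2 * (sqrt A * sqrt B)"
  proof (cases "A = 0")
    case True
    have "C \<le> 0"
    proof (rule ccontr)
      assume "\<not> C \<le> 0"
      then have C: "0 < C" by simp
      \<comment> \<open>With A = 0 the form at b = 1 is B + a C, and this choice of a gives it the
        value -1.\<close>
      have "0 \<le> (-(B + 1) / C)\<^sup>2 * A + 1\<^sup>2 * B + (-(B + 1) / C) * 1 * C" by (rule assms)
      then show False using C True by simp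
    qed
    then show ?thesis using True by simp
  next
    case False
    then have A': "0 < A" using A by simp
    have "0 \<le> (- sqrt B)\<^sup>2 * A + (sqrt A)\<^sup>2 * B + (- sqrt B) * sqrt A * C" by (rule assms)
    then have 1: "sqrt B * sqrt A * C \<le> 2 * A * B" using A B by simp
    show ?thesis
    proof (cases "B = 0")
      case True
      have "C \<le> 0"
      proof (rule ccontr)
        assume "\<not> C \<le> 0"
        then have C: "0 < C" by simp
        have "0 \<le> 1\<^sup>2 * A + (-(A + 1) / C)\<^sup>2 * B + 1 * (-(A + 1) / C) * C" by (rule assms)
        then show False using C True by simp
      qed
      then show ?thesis using True by simp
    next
      case False
      then have p: "0 < sqrt A * sqrt B" using A' B by simp
      have "(sqrt A * sqrt B) * (2 * (sqrt A * sqrt B)) = 2 * (sqrt A * sqrt A) * (sqrt B * sqrt B)"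
        by (simp only: mult_ac)
      also have "\<dots> = 2 * A * B" using A B by simp
      finally have "sqrt B * sqrt A * C \<le> (sqrt A * sqrt B) * (2 * (sqrt A * sqrt B))"
        using 1 by (simp only:)
      then have "(sqrt A * sqrt B) * C \<le> (sqrt A * sqrt B) * (2 * (sqrt A * sqrt B))"
        by (simp only: mult.commute[of "sqrt B" "sqrt A"])
      then show ?thesis using p by (rule mult_left_le_imp_le)
    qed
  qed
  then have "A + B + C \<le> (sqrt A + sqrt B)\<^sup>2" using A B by (simp add: power2_sum)
  then show ?thesis using A B by (intro real_le_lsqrt) auto
qed

lemma L2_norm_triangle:
  assumes X: "X \<in> borel_measurable P" "integrable P (\<lambda>\<omega>. (X \<omega>)\<^sup>2)" and Y: "Y \<in> borel_measurable P" "integrable P (\<lambda>\<omega>. (Y \<omega>)\<^sup>2)"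
  shows "L2_norm P (\<lambda>\<omega>. X \<omega> + Y \<omega>) \<le> L2_norm P X + L2_norm P Y"
proof -
  note XY = integrable_product_of_squares[OF X(1) Y(1) X(2) Y(2)]
  define C where "C = 2 * (LINT \<omega>|P. X \<omega> * Y \<omega>)"
  have eq: "(LINT \<omega>|P. (a * X \<omega> + b * Y \<omega>)\<^sup>2) = a\<^sup>2 * (LINT \<omega>|P. (X \<omega>)\<^sup>2) + b\<^sup>2 * (LINT \<omega>|P. (Y \<omega>)\<^sup>2) + a * b * C" for a b
  proof -
    have "(LINT \<omega>|P. (a * X \<omega> + b * Y \<omega>)\<^sup>2) = (LINT \<omega>|P. a\<^sup>2 * (X \<omega>)\<^sup>2 + b\<^sup>2 * (Y \<omega>)\<^sup>2 + (2 * a * b) * (X \<omega> * Y \<omega>))"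
      by (intro Bochner_Integration.integral_cong) (auto simp: power2_sum power_mult_distrib algebra_simps)
    also have "\<dots> = a\<^sup>2 * (LINT \<omega>|P. (X \<omega>)\<^sup>2) + b\<^sup>2 * (LINT \<omega>|P. (Y \<omega>)\<^sup>2) + (2 * a * b) * (LINT \<omega>|P. X \<omega> * Y \<omega>)"
      using X Y XY by simp
    finally show ?thesis by (simp add: C_def)
  qed
  have "sqrt ((LINT \<omega>|P. (X \<omega>)\<^sup>2) + (LINT \<omega>|P. (Y \<omega>)\<^sup>2) + C) \<le> sqrt (LINT \<omega>|P. (X \<omega>)\<^sup>2) + sqrt (LINT \<omega>|P. (Y \<omega>)\<^sup>2)"
    by (rule quadratic_triangle) (simp flip: eq)
  then show ?thesis using eq[of 1 1] by (simp add: L2_norm_def)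
qed

context coloured_noise
begin

lemma energy_triangle:
  assumes g: "energy_space g" and h: "energy_space h"
  shows "sqrt (energy H \<Lambda> (\<lambda>\<tau> z. g \<tau> z + h \<tau> z)) \<le> sqrt (energy H \<Lambda> g) + sqrt (energy H \<Lambda> h)"
proof -
  have "sqrt (energy H \<Lambda> g + energy H \<Lambda> h + (cross_energy g h + cross_energy h g)) \<le> sqrt (energy H \<Lambda> g) + sqrt (energy H \<Lambda> h)"
    by (rule quadratic_triangle) (simp flip: energy_space_linear(2)[OF g h] add: energy_nonneg energy_space_linear(1)[OF g h])
  then show ?thesis using energy_space_linear(2)[OF g h, of 1 1] by simp
qed

lemma energy_uminus: "energy H \<Lambda> (\<lambda>\<tau> z. - g \<tau> z) = energy H \<Lambda> g"
  by (simp add: energy_eq cross_def[abs_def])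

text \<open>The isometry holds for elementary functions. The square root of the energy and the L^2
  norm both satisfy the triangle inequality, so the two sides converge along the approximating
  sequences of g and h, and the limits agree.\<close>

theorem wiener_isometry:
  assumes g: "energy_space g" and h: "energy_space h"
    and X: "wiener_integral P T H \<Lambda> W g X" and Y: "wiener_integral P T H \<Lambda> W h Y"
  shows "(L2_norm P (\<lambda>\<omega>. X \<omega> - Y \<omega>))\<^sup>2 = energy H \<Lambda> (\<lambda>\<tau> z. g \<tau> z - h \<tau> z)"
proof -
  have Xm: "X \<in> borel_measurable P" "integrable P (\<lambda>\<omega>. (X \<omega>)\<^sup>2)" and Ym: "Y \<in> borel_measurable P" "integrable P (\<lambda>\<omega>. (Y \<omega>)\<^sup>2)"
    using X Y by (auto simp: wiener_integral_def)
  obtain l where l: "\<And>n. elementary T (l n)" "(\<lambda>n. energy H \<Lambda> (\<lambda>\<tau> z. elem_fun (l n) \<tau> z - g \<tau> z)) \<longlonglongrightarrow> 0"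
      "(\<lambda>n. L2_norm P (\<lambda>\<omega>. elem_integral W (l n) \<omega> - X \<omega>)) \<longlonglongrightarrow> 0"
    using X by (auto simp: wiener_integral_def)
  obtain m where m: "\<And>n. elementary T (m n)" "(\<lambda>n. energy H \<Lambda> (\<lambda>\<tau> z. elem_fun (m n) \<tau> z - h \<tau> z)) \<longlonglongrightarrow> 0"
      "(\<lambda>n. L2_norm P (\<lambda>\<omega>. elem_integral W (m n) \<omega> - Y \<omega>)) \<longlonglongrightarrow> 0"
    using Y by (auto simp: wiener_integral_def)
  define I J where "I n = elem_integral W (l n)" and "J n = elem_integral W (m n)" for n
  define a b where "a n = elem_fun (l n)" and "b n = elem_fun (m n)" for n
  have IJ: "I n \<in> borel_measurable P" "integrable P (\<lambda>\<omega>. (I n \<omega>)\<^sup>2)" "J n \<in> borel_measurable P" "integrable P (\<lambda>\<omega>. (J n \<omega>)\<^sup>2)" for n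
    unfolding I_def J_def using l(1) m(1) by (auto intro: elem_integral_measurable centred_gaussian_square_integrable elem_integral_gaussian)
  have ab: "energy_space (a n)" "energy_space (b n)" for n
    unfolding a_def b_def using l(1) m(1) by (auto intro: elem_energy_space)
  define sq where "sq U \<longleftrightarrow> U \<in> borel_measurable P \<and> integrable P (\<lambda>\<omega>. (U \<omega>)\<^sup>2)" for U :: "'w \<Rightarrow> real"
  have sqd: "sq (\<lambda>\<omega>. U \<omega> - V \<omega>)" if "sq U" "sq V" for U V
    using that integrable_product_of_squares[of U P V] by (auto simp: sq_def power2_diff mult.assoc)
  have sq: "sq (I n)" "sq (J n)" "sq X" "sq Y" for n using IJ Xm Ym by (auto simp: sq_def)
  have sym: "L2_norm P (\<lambda>\<omega>. U \<omega> - V \<omega>) = L2_norm P (\<lambda>\<omega>. V \<omega> - U \<omega>)" for U V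
    by (simp add: L2_norm_def power2_commute)
  have tri: "L2_norm P (\<lambda>\<omega>. U \<omega> - Z \<omega>) \<le> L2_norm P (\<lambda>\<omega>. U \<omega> - V \<omega>) + L2_norm P (\<lambda>\<omega>. V \<omega> - Z \<omega>)"
    if "sq U" "sq V" "sq Z" for U V Z
    using L2_norm_triangle[of "\<lambda>\<omega>. U \<omega> - V \<omega>" P "\<lambda>\<omega>. V \<omega> - Z \<omega>"] sqd[OF that(1,2)] sqd[OF that(2,3)]
    by (simp add: sq_def)
  \<comment> \<open>The difference is not rewritten as a single elementary list; both sides are
    expanded bilinearly and compared by means of \<open>cross_elem\<close>.\<close>
  have e: "energy H \<Lambda> (\<lambda>\<tau> z. a n \<tau> z - b n \<tau> z) = (L2_norm P (\<lambda>\<omega>. I n \<omega> - J n \<omega>))\<^sup>2" for n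
  proof -
    have int: "integrable P (\<lambda>\<omega>. I n \<omega> * J n \<omega>)" "integrable P (\<lambda>\<omega>. J n \<omega> * I n \<omega>)"
      unfolding I_def J_def by (intro elem_integral_product_integrable l m)+
    have "energy H \<Lambda> (\<lambda>\<tau> z. a n \<tau> z - b n \<tau> z) = (LINT \<omega>|P. (I n \<omega>)\<^sup>2) + (LINT \<omega>|P. (J n \<omega>)\<^sup>2) - ((LINT \<omega>|P. I n \<omega> * J n \<omega>) + (LINT \<omega>|P. J n \<omega> * I n \<omega>))"
      unfolding energy_space_diff(2)[OF ab] cross_energy_def a_def b_def I_def J_def
      using cross_elem[OF l(1) m(1), of n n] cross_elem[OF m(1) l(1), of n n] energy_elem[OF l(1), of n] energy_elem[OF m(1), of n]
      unfolding energy_space_diff(2)[OF elem_energy_space[OF l(1)] elem_energy_space[OF m(1)]] cross_energy_def by simp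
    also have "\<dots> = (LINT \<omega>|P. (I n \<omega>)\<^sup>2 + (J n \<omega>)\<^sup>2 - (I n \<omega> * J n \<omega> + J n \<omega> * I n \<omega>))"
      using IJ int by (simp add: mult.commute[of "J n _"])
    also have "\<dots> = (LINT \<omega>|P. (I n \<omega> - J n \<omega>)\<^sup>2)"
      by (intro Bochner_Integration.integral_cong) (auto simp: power2_eq_square algebra_simps)
    finally show ?thesis by (simp add: L2_norm_def)
  qed
  let ?A = "\<lambda>n. L2_norm P (\<lambda>\<omega>. I n \<omega> - J n \<omega>)" and ?N = "L2_norm P (\<lambda>\<omega>. X \<omega> - Y \<omega>)"
  have N0: "0 \<le> L2_norm P U" for U by (simp add: L2_norm_def)
  have lim1: "?A \<longlonglongrightarrow> ?N"
  proof (rule LIM_zero_cancel)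
    have up: "?A n \<le> ?N + (L2_norm P (\<lambda>\<omega>. I n \<omega> - X \<omega>) + L2_norm P (\<lambda>\<omega>. J n \<omega> - Y \<omega>))" for n
      using tri[OF sq(1,3,2), of n n] tri[OF sq(3,4,2), of n] sym[of Y "J n"] by linarith
    have lo: "?N \<le> ?A n + (L2_norm P (\<lambda>\<omega>. I n \<omega> - X \<omega>) + L2_norm P (\<lambda>\<omega>. J n \<omega> - Y \<omega>))" for n
      using tri[OF sq(3,1,4), of n] tri[OF sq(1,2,4), of n n] sym[of X "I n"] by linarith
    have r: "(\<lambda>n. L2_norm P (\<lambda>\<omega>. I n \<omega> - X \<omega>) + L2_norm P (\<lambda>\<omega>. J n \<omega> - Y \<omega>)) \<longlonglongrightarrow> 0"
      using tendsto_add[OF l(3) m(3)] unfolding I_def J_def by simp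
    have "norm (?A n - ?N) \<le> L2_norm P (\<lambda>\<omega>. I n \<omega> - X \<omega>) + L2_norm P (\<lambda>\<omega>. J n \<omega> - Y \<omega>)" for n
      using up[of n] lo[of n] by (simp add: abs_le_iff)
    then show "(\<lambda>n. ?A n - ?N) \<longlonglongrightarrow> 0"
      by (intro Lim_null_comparison[OF always_eventually r] allI)
  qed
  let ?B = "\<lambda>n. sqrt (energy H \<Lambda> (\<lambda>\<tau> z. a n \<tau> z - b n \<tau> z))" and ?M = "sqrt (energy H \<Lambda> (\<lambda>\<tau> z. g \<tau> z - h \<tau> z))"
  have lim2: "?B \<longlonglongrightarrow> ?M"
  proof (rule LIM_zero_cancel)
    let ?r = "\<lambda>n. sqrt (energy H \<Lambda> (\<lambda>\<tau> z. a n \<tau> z - g \<tau> z)) + sqrt (energy H \<Lambda> (\<lambda>\<tau> z. b n \<tau> z - h \<tau> z))"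
    note d = energy_space_diff(1)
    have um: "energy_space (\<lambda>\<tau> z. - f \<tau> z)" if "energy_space f" for f
      using energy_space_linear(1)[OF that that, of "-1" 0] by simp
    have ad: "energy_space (\<lambda>\<tau> z. f \<tau> z + f' \<tau> z)" if "energy_space f" "energy_space f'" for f f'
      using energy_space_linear(1)[OF that, of 1 1] by simp
    have up: "?B n \<le> ?M + ?r n" for n
    proof -
      have "?B n = sqrt (energy H \<Lambda> (\<lambda>\<tau> z. (g \<tau> z - h \<tau> z) + ((a n \<tau> z - g \<tau> z) + - (b n \<tau> z - h \<tau> z))))" by (simp add: algebra_simps)
      also have "\<dots> \<le> ?M + sqrt (energy H \<Lambda> (\<lambda>\<tau> z. (a n \<tau> z - g \<tau> z) + - (b n \<tau> z - h \<tau> z)))"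
        by (intro energy_triangle ad um d g h ab)
      also have "sqrt (energy H \<Lambda> (\<lambda>\<tau> z. (a n \<tau> z - g \<tau> z) + - (b n \<tau> z - h \<tau> z))) \<le> sqrt (energy H \<Lambda> (\<lambda>\<tau> z. a n \<tau> z - g \<tau> z)) + sqrt (energy H \<Lambda> (\<lambda>\<tau> z. - (b n \<tau> z - h \<tau> z)))"
        by (intro energy_triangle um d g h ab)
      finally show ?thesis by (simp only: energy_uminus)
    qed
    have lo: "?M \<le> ?B n + ?r n" for n
    proof -
      have "?M = sqrt (energy H \<Lambda> (\<lambda>\<tau> z. (a n \<tau> z - b n \<tau> z) + (- (a n \<tau> z - g \<tau> z) + (b n \<tau> z - h \<tau> z))))" by (simp add: algebra_simps)
      also have "\<dots> \<le> ?B n + sqrt (energy H \<Lambda> (\<lambda>\<tau> z. - (a n \<tau> z - g \<tau> z) + (b n \<tau> z - h \<tau> z)))"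
        by (intro energy_triangle ad um d g h ab)
      also have "sqrt (energy H \<Lambda> (\<lambda>\<tau> z. - (a n \<tau> z - g \<tau> z) + (b n \<tau> z - h \<tau> z))) \<le> sqrt (energy H \<Lambda> (\<lambda>\<tau> z. - (a n \<tau> z - g \<tau> z))) + sqrt (energy H \<Lambda> (\<lambda>\<tau> z. b n \<tau> z - h \<tau> z))"
        by (intro energy_triangle um d g h ab)
      finally show ?thesis by (simp only: energy_uminus)
    qed
    have r: "?r \<longlonglongrightarrow> 0"
      using tendsto_add[OF tendsto_real_sqrt[OF l(2)] tendsto_real_sqrt[OF m(2)]] unfolding a_def b_def by simp
    have "norm (?B n - ?M) \<le> ?r n" for n
      using up[of n] lo[of n] by (simp add: abs_le_iff)
    then show "(\<lambda>n. ?B n - ?M) \<longlonglongrightarrow> 0"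
      by (intro Lim_null_comparison[OF always_eventually r] allI)
  qed
  have "?B n = ?A n" for n unfolding e by (simp add: N0)
  then have "?N = ?M" using lim1 lim2 LIMSEQ_unique by (metis (no_types, lifting) ext)
  then show ?thesis by (simp add: energy_nonneg energy_space_diff(1)[OF g h])
qed

end

section \<open>Spectral representation\<close>

lemma integrable_gaussian_tempered:
  fixes M :: "'a::euclidean_space measure"
  assumes M: "tempered_measure M" and a: "0 < a"
  shows "integrable M (\<lambda>x. exp (- a * (norm (h - x))\<^sup>2))"
proof -
  have [measurable_cong]: "sets M = sets borel" using M by (simp add: tempered_measure_def)
  obtain k where k: "(\<integral>\<^sup>+ x. ennreal (1 / (1 + norm x) ^ k) \<partial>M) < \<infinity>"
    using M by (auto simp: tempered_measure_def)
  obtain B where B: "\<And>x. (1 + norm x) ^ k * exp (- a * (norm (h - x))\<^sup>2) \<le> B"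
    using gaussian_decay[OF a] by metis
  show ?thesis
  proof (rule Bochner_Integration.integrable_bound)
    have "integrable M (\<lambda>x. 1 / (1 + norm x) ^ k)"
      by (rule integrableI_nonneg) (use k in auto)
    then show "integrable M (\<lambda>x. B * (1 / (1 + norm x) ^ k))" by (intro integrable_mult_right)
    show "AE x in M. norm (exp (- a * (norm (h - x))\<^sup>2)) \<le> norm (B * (1 / (1 + norm x) ^ k))"
    proof (rule AE_I2)
      fix x :: 'a
      have pos: "0 < (1 + norm x) ^ k" by (simp add: add_pos_nonneg)
      have "exp (- a * (norm (h - x))\<^sup>2) \<le> B * (1 / (1 + norm x) ^ k)"
        using B[of x] pos by (simp add: field_simps)
      then have "exp (- a * (norm (h - x))\<^sup>2) \<le> \<bar>B * (1 / (1 + norm x) ^ k)\<bar>"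
        by (rule order_trans[OF _ abs_ge_self])
      then show "norm (exp (- a * (norm (h - x))\<^sup>2)) \<le> norm (B * (1 / (1 + norm x) ^ k))"
        by (simp only: real_norm_def abs_exp_cancel)
    qed
  qed measurable
qed

text \<open>The spectral duality applied to the Schwartz function v ->
  \<open>heat_kernel c (h - v)\<close>; real parts turn the phase into a cosine. Adding the integral
  with 1 - cos makes all three terms nonnegative and finite, so the identity can be used in
  \<open>ennreal\<close>.\<close>

lemma spectral_heat_kernel:
  fixes \<Lambda> \<mu> :: "'a::euclidean_space measure"
  assumes \<Lambda>: "tempered_measure \<Lambda>" and \<mu>: "spectral_measure \<Lambda> \<mu>" and c: "0 < c"
  shows "(\<integral>\<^sup>+ v. ennreal (heat_kernel c (h - v)) \<partial>\<Lambda>) + (\<integral>\<^sup>+ \<xi>. ennreal (exp (- c * (norm \<xi>)\<^sup>2) * (1 - cos (\<xi> \<bullet> h))) \<partial>\<mu>)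
    = (\<integral>\<^sup>+ \<xi>. ennreal (exp (- c * (norm \<xi>)\<^sup>2)) \<partial>\<mu>)"
proof -
  have \<mu>t: "tempered_measure \<mu>" using \<mu> by (simp add: spectral_measure_def)
  have [measurable_cong]: "sets \<mu> = sets borel" "sets \<Lambda> = sets borel" using \<mu>t \<Lambda> by (simp_all add: tempered_measure_def)
  have i1: "integrable \<Lambda> (\<lambda>v. heat_kernel c (h - v))"
    using integrable_gaussian_tempered[OF \<Lambda>, of "1 / (4 * c)" h] c by (simp add: heat_kernel_def)
  have i2: "integrable \<mu> (\<lambda>\<xi>. exp (- c * (norm \<xi>)\<^sup>2))"
    using integrable_gaussian_tempered[OF \<mu>t c, of 0] by simp
  have i3: "integrable \<mu> (\<lambda>\<xi>. exp (- (\<i> * complex_of_real (h \<bullet> \<xi>))) * complex_of_real (exp (- c * (norm \<xi>)\<^sup>2)))"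
    by (rule Bochner_Integration.integrable_bound[OF i2]) (auto simp: norm_mult)
  have i4: "integrable \<mu> (\<lambda>\<xi>. exp (- c * (norm \<xi>)\<^sup>2) * cos (\<xi> \<bullet> h))"
    by (rule Bochner_Integration.integrable_bound[OF i2]) (auto simp: abs_mult mult_left_le)
  have "complex_of_real (LINT v|\<Lambda>. heat_kernel c (h - v)) = (LINT v|\<Lambda>. complex_of_real (heat_kernel c (h - v)))"
    by (rule integral_of_real[symmetric]) (rule i1)
  also have "\<dots> = (LINT \<xi>|\<mu>. fourier (\<lambda>v. complex_of_real (heat_kernel c (h - v))) \<xi>)"
  proof -
    have "\<forall>\<phi>. schwartz \<phi> \<longrightarrow> (LINT v|\<Lambda>. \<phi> v) = (LINT \<xi>|\<mu>. fourier \<phi> \<xi>)"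
      using \<mu> unfolding spectral_measure_def by (elim conjE)
    from this[rule_format, OF schwartz_heat_kernel[OF c, of h]] show ?thesis .
  qed
  also have "\<dots> = (LINT \<xi>|\<mu>. exp (- (\<i> * complex_of_real (h \<bullet> \<xi>))) * complex_of_real (exp (- c * (norm \<xi>)\<^sup>2)))"
    using c by (simp add: fourier_heat_kernel)
  finally have "(LINT v|\<Lambda>. heat_kernel c (h - v)) = Re (LINT \<xi>|\<mu>. exp (- (\<i> * complex_of_real (h \<bullet> \<xi>))) * complex_of_real (exp (- c * (norm \<xi>)\<^sup>2)))"
    by (metis Re_complex_of_real)
  also have "\<dots> = (LINT \<xi>|\<mu>. Re (exp (- (\<i> * complex_of_real (h \<bullet> \<xi>))) * complex_of_real (exp (- c * (norm \<xi>)\<^sup>2))))"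
    by (rule integral_Re[symmetric]) (rule i3)
  also have "\<dots> = (LINT \<xi>|\<mu>. exp (- c * (norm \<xi>)\<^sup>2) * cos (\<xi> \<bullet> h))"
    by (intro Bochner_Integration.integral_cong) (auto simp: Re_exp inner_commute)
  finally have eq: "(LINT v|\<Lambda>. heat_kernel c (h - v)) = (LINT \<xi>|\<mu>. exp (- c * (norm \<xi>)\<^sup>2) * cos (\<xi> \<bullet> h))" .
  have n1: "(\<integral>\<^sup>+ v. ennreal (heat_kernel c (h - v)) \<partial>\<Lambda>) = ennreal (LINT v|\<Lambda>. heat_kernel c (h - v))"
    by (intro nn_integral_eq_integral i1) auto
  have i5: "integrable \<mu> (\<lambda>\<xi>. exp (- c * (norm \<xi>)\<^sup>2) * (1 - cos (\<xi> \<bullet> h)))"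
    using i2 i4 by (simp add: right_diff_distrib)
  have n2: "(\<integral>\<^sup>+ \<xi>. ennreal (exp (- c * (norm \<xi>)\<^sup>2) * (1 - cos (\<xi> \<bullet> h))) \<partial>\<mu>) = ennreal (LINT \<xi>|\<mu>. exp (- c * (norm \<xi>)\<^sup>2) * (1 - cos (\<xi> \<bullet> h)))"
    by (intro nn_integral_eq_integral i5) auto
  have n3: "(\<integral>\<^sup>+ \<xi>. ennreal (exp (- c * (norm \<xi>)\<^sup>2)) \<partial>\<mu>) = ennreal (LINT \<xi>|\<mu>. exp (- c * (norm \<xi>)\<^sup>2))"
    by (intro nn_integral_eq_integral i2) auto
  have "(LINT v|\<Lambda>. heat_kernel c (h - v)) + (LINT \<xi>|\<mu>. exp (- c * (norm \<xi>)\<^sup>2) * (1 - cos (\<xi> \<bullet> h))) = (LINT \<xi>|\<mu>. exp (- c * (norm \<xi>)\<^sup>2))"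
    unfolding eq using i2 i4 by (simp add: right_diff_distrib)
  moreover have "0 \<le> (LINT v|\<Lambda>. heat_kernel c (h - v))" "0 \<le> (LINT \<xi>|\<mu>. exp (- c * (norm \<xi>)\<^sup>2) * (1 - cos (\<xi> \<bullet> h)))"
    by (intro Bochner_Integration.integral_nonneg; simp)+
  ultimately show ?thesis unfolding n1 n2 n3 by (simp flip: ennreal_plus)
qed

definition heat_source :: "real \<Rightarrow> 'a::euclidean_space \<Rightarrow> real \<Rightarrow> 'a \<Rightarrow> real" where
  "heat_source t x \<tau> z = (if 0 \<le> \<tau> \<and> \<tau> < t then heat_kernel (t - \<tau>) (x - z) else 0)"

lemma heat_source_nonneg: "0 \<le> heat_source t x \<tau> z"
  by (simp add: heat_source_def)

lemma heat_source_measurable [measurable]: "spacetime_measurable (heat_source t x)"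
  unfolding heat_source_def heat_kernel_def by measurable

definition spectral_form :: "real \<Rightarrow> real \<Rightarrow> real \<Rightarrow> 'a::euclidean_space \<Rightarrow> ennreal" where
  "spectral_form H t s \<xi> = frac_form H (decay ((norm \<xi>)\<^sup>2) t) (decay ((norm \<xi>)\<^sup>2) s)"

lemma spectral_form_measurable [measurable]: "spectral_form H t s \<in> borel_measurable borel"
  unfolding spectral_form_def frac_form_def decay_def by measurable

text \<open>The semigroup law collapses the two kernels to one of age (t - \<tau>) + (s - \<sigma>),
  to which \<open>spectral_heat_kernel\<close> applies; integrating against the fractional weight
  and exchanging time with frequency by Tonelli gives the claim, with no finiteness assumed.\<close>

lemma spectral_identity:
  fixes \<Lambda> \<mu> :: "'a::euclidean_space measure"
  assumes \<Lambda>: "tempered_measure \<Lambda>" and \<mu>: "spectral_measure \<Lambda> \<mu>"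
  shows "(\<integral>\<^sup>+ p. ennreal (cross H (heat_source t x) (heat_source s y) p) \<partial>energy_measure \<Lambda>)
      + (\<integral>\<^sup>+ \<xi>. spectral_form H t s \<xi> * ennreal (1 - cos (\<xi> \<bullet> (x - y))) \<partial>\<mu>)
    = (\<integral>\<^sup>+ \<xi>. spectral_form H t s \<xi> \<partial>\<mu>)"
proof -
  have \<mu>t: "tempered_measure \<mu>" using \<mu> by (simp add: spectral_measure_def)
  have sets: "sets \<mu> = sets borel" "sets \<Lambda> = sets borel" using \<mu>t \<Lambda> by (simp_all add: tempered_measure_def)
  note [measurable_cong] = sets
  interpret m: sigma_finite_measure \<mu> by (rule tempered_measure_sigma_finite[OF \<mu>t])
  interpret lm: pair_sigma_finite "lborel :: real measure" \<mu> ..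
  interpret \<Lambda>: sigma_finite_measure \<Lambda> by (rule tempered_measure_sigma_finite[OF \<Lambda>])
  define w :: "real \<Rightarrow> real \<Rightarrow> ennreal" where "w \<tau> \<sigma> = ennreal (\<bar>\<tau> - \<sigma>\<bar> powr (2 * H - 2) * indicator {0..<t} \<tau> * indicator {0..<s} \<sigma>)" for \<tau> \<sigma>
  let ?h = "x - y"
  let ?c = "\<lambda>\<tau> \<sigma>. (t - \<tau>) + (s - \<sigma>)"
  let ?E = "\<lambda>\<tau> \<sigma> (\<xi>::'a). ennreal (exp (- ?c \<tau> \<sigma> * (norm \<xi>)\<^sup>2))"
  let ?D = "\<lambda>\<tau> \<sigma> \<xi>. ennreal (exp (- ?c \<tau> \<sigma> * (norm \<xi>)\<^sup>2) * (1 - cos (\<xi> \<bullet> ?h)))"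
  let ?G = "\<lambda>\<tau> \<sigma>. (\<integral>\<^sup>+ v. ennreal (heat_kernel (?c \<tau> \<sigma>) (?h - v)) \<partial>\<Lambda>)"
  have [measurable]: "(\<lambda>(\<tau>, \<sigma>). w \<tau> \<sigma>) \<in> borel_measurable (borel \<Otimes>\<^sub>M borel)" unfolding w_def by measurable
  have wm [measurable]: "w \<tau> \<in> borel_measurable borel" for \<tau> unfolding w_def[abs_def] by measurable
  have [measurable]: "(\<lambda>(\<tau>, \<sigma>). ?G \<tau> \<sigma>) \<in> borel_measurable (borel \<Otimes>\<^sub>M borel)"
    unfolding heat_kernel_def by measurable
  have S: "(\<integral>\<^sup>+ \<tau>. \<integral>\<^sup>+ \<sigma>. w \<tau> \<sigma> * ?E \<tau> \<sigma> \<xi> \<partial>lborel \<partial>lborel) = spectral_form H t s \<xi>" for \<xi>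
    unfolding spectral_form_def frac_form_def w_def decay_def
    by (intro nn_integral_cong) (auto simp: ennreal_mult[symmetric] exp_add[symmetric] algebra_simps split: split_indicator)
  have S': "(\<integral>\<^sup>+ \<tau>. \<integral>\<^sup>+ \<sigma>. w \<tau> \<sigma> * ?D \<tau> \<sigma> \<xi> \<partial>lborel \<partial>lborel) = spectral_form H t s \<xi> * ennreal (1 - cos (\<xi> \<bullet> ?h))" for \<xi>
  proof -
    have "(\<integral>\<^sup>+ \<tau>. \<integral>\<^sup>+ \<sigma>. w \<tau> \<sigma> * ?D \<tau> \<sigma> \<xi> \<partial>lborel \<partial>lborel) = (\<integral>\<^sup>+ \<tau>. \<integral>\<^sup>+ \<sigma>. (w \<tau> \<sigma> * ?E \<tau> \<sigma> \<xi>) * ennreal (1 - cos (\<xi> \<bullet> ?h)) \<partial>lborel \<partial>lborel)"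
      by (simp add: ennreal_mult mult.assoc)
    also have "\<dots> = (\<integral>\<^sup>+ \<tau>. \<integral>\<^sup>+ \<sigma>. w \<tau> \<sigma> * ?E \<tau> \<sigma> \<xi> \<partial>lborel \<partial>lborel) * ennreal (1 - cos (\<xi> \<bullet> ?h))"
      by (simp add: nn_integral_multc)
    finally show ?thesis unfolding S .
  qed
  have swap: "(\<integral>\<^sup>+ \<tau>. \<integral>\<^sup>+ \<sigma>. w \<tau> \<sigma> * (\<integral>\<^sup>+ \<xi>. F \<tau> \<sigma> \<xi> \<partial>\<mu>) \<partial>lborel \<partial>lborel) = (\<integral>\<^sup>+ \<xi>. \<integral>\<^sup>+ \<tau>. \<integral>\<^sup>+ \<sigma>. w \<tau> \<sigma> * F \<tau> \<sigma> \<xi> \<partial>lborel \<partial>lborel \<partial>\<mu>)"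
    if [measurable]: "(\<lambda>x. F (fst (fst x)) (snd (fst x)) (snd x)) \<in> borel_measurable ((borel \<Otimes>\<^sub>M borel) \<Otimes>\<^sub>M borel)" for F :: "real \<Rightarrow> real \<Rightarrow> 'a \<Rightarrow> ennreal"
  proof -
    have [measurable]: "(\<lambda>x. F (f x) (g x) (h x)) \<in> borel_measurable N" if "f \<in> N \<rightarrow>\<^sub>M borel" "g \<in> N \<rightarrow>\<^sub>M borel" "h \<in> N \<rightarrow>\<^sub>M borel" for f g h and N :: "'z measure"
      using measurable_compose[OF measurable_Pair[OF measurable_Pair[OF that(1,2)] that(3)] \<open>(\<lambda>x. F (fst (fst x)) (snd (fst x)) (snd x)) \<in> _\<close>] by simp
    have "(\<integral>\<^sup>+ \<tau>. \<integral>\<^sup>+ \<sigma>. w \<tau> \<sigma> * (\<integral>\<^sup>+ \<xi>. F \<tau> \<sigma> \<xi> \<partial>\<mu>) \<partial>lborel \<partial>lborel) = (\<integral>\<^sup>+ \<tau>. \<integral>\<^sup>+ \<sigma>. \<integral>\<^sup>+ \<xi>. w \<tau> \<sigma> * F \<tau> \<sigma> \<xi> \<partial>\<mu> \<partial>lborel \<partial>lborel)"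
      by (simp add: nn_integral_cmult)
    also have "\<dots> = (\<integral>\<^sup>+ \<tau>. \<integral>\<^sup>+ \<xi>. \<integral>\<^sup>+ \<sigma>. w \<tau> \<sigma> * F \<tau> \<sigma> \<xi> \<partial>lborel \<partial>\<mu> \<partial>lborel)"
      by (intro nn_integral_cong lm.Fubini'[symmetric]) measurable
    also have "\<dots> = (\<integral>\<^sup>+ \<xi>. \<integral>\<^sup>+ \<tau>. \<integral>\<^sup>+ \<sigma>. w \<tau> \<sigma> * F \<tau> \<sigma> \<xi> \<partial>lborel \<partial>lborel \<partial>\<mu>)"
      by (intro lm.Fubini'[symmetric]) measurable
    finally show ?thesis .
  qed
  have inner: "(\<integral>\<^sup>+ p. ennreal (cross H (heat_source t x) (heat_source s y) ((\<tau>, \<sigma>), p)) \<partial>pair_correlation \<Lambda>) = w \<tau> \<sigma> * ?G \<tau> \<sigma>" for \<tau> \<sigma>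
  proof (cases "0 \<le> \<tau> \<and> \<tau> < t \<and> 0 \<le> \<sigma> \<and> \<sigma> < s")
    case True
    have [measurable]: "(\<lambda>p. ennreal (cross H (heat_source t x) (heat_source s y) ((\<tau>, \<sigma>), p))) \<in> borel_measurable (borel \<Otimes>\<^sub>M borel)"
      using measurable_compose[OF _ cross_measurable[OF heat_source_measurable heat_source_measurable], of "\<lambda>p. ((\<tau>, \<sigma>), p)" "borel \<Otimes>\<^sub>M borel" H t x s y] by simp
    have "(\<integral>\<^sup>+ p. ennreal (cross H (heat_source t x) (heat_source s y) ((\<tau>, \<sigma>), p)) \<partial>pair_correlation \<Lambda>)
      = (\<integral>\<^sup>+ v. \<integral>\<^sup>+ u. ennreal (cross H (heat_source t x) (heat_source s y) ((\<tau>, \<sigma>), (v + u, u))) \<partial>lborel \<partial>\<Lambda>)"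
      by (rule nn_integral_pair_correlation[OF sets(2)]) measurable
    also have "\<dots> = (\<integral>\<^sup>+ v. \<integral>\<^sup>+ u. w \<tau> \<sigma> * ennreal (heat_kernel (t - \<tau>) (x - (v + u)) * heat_kernel (s - \<sigma>) (y - u)) \<partial>lborel \<partial>\<Lambda>)"
      using True by (intro nn_integral_cong) (simp add: cross_def heat_source_def w_def ennreal_mult mult.assoc)
    also have "\<dots> = (\<integral>\<^sup>+ v. w \<tau> \<sigma> * ennreal (heat_kernel (?c \<tau> \<sigma>) (?h - v)) \<partial>\<Lambda>)"
      using True by (intro nn_integral_cong) (simp add: nn_integral_cmult nn_integral_heat_kernel_semigroup)
    also have "\<dots> = w \<tau> \<sigma> * ?G \<tau> \<sigma>" by (rule nn_integral_cmult) measurable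
    finally show ?thesis .
  next
    case False
    then have "cross H (heat_source t x) (heat_source s y) ((\<tau>, \<sigma>), p) = 0" for p
      by (auto simp: cross_def heat_source_def)
    moreover have "w \<tau> \<sigma> = 0" using False by (auto simp: w_def split: split_indicator)
    ultimately show ?thesis by simp
  qed
  have "(\<integral>\<^sup>+ p. ennreal (cross H (heat_source t x) (heat_source s y) p) \<partial>energy_measure \<Lambda>) = (\<integral>\<^sup>+ \<tau>. \<integral>\<^sup>+ \<sigma>. w \<tau> \<sigma> * ?G \<tau> \<sigma> \<partial>lborel \<partial>lborel)"
    using cross_measurable[OF heat_source_measurable heat_source_measurable, of H t x s y]
    by (subst nn_integral_energy_measure[OF \<Lambda>]) (auto simp: inner)
  moreover have "(\<integral>\<^sup>+ \<xi>. spectral_form H t s \<xi> * ennreal (1 - cos (\<xi> \<bullet> ?h)) \<partial>\<mu>) = (\<integral>\<^sup>+ \<tau>. \<integral>\<^sup>+ \<sigma>. w \<tau> \<sigma> * (\<integral>\<^sup>+ \<xi>. ?D \<tau> \<sigma> \<xi> \<partial>\<mu>) \<partial>lborel \<partial>lborel)"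
  proof -
    have mD: "(\<lambda>x. ?D (fst (fst x)) (snd (fst x)) (snd x)) \<in> borel_measurable ((borel \<Otimes>\<^sub>M borel) \<Otimes>\<^sub>M borel)" by measurable
    show ?thesis by (simp only: swap[OF mD] S')
  qed
  moreover have "(\<integral>\<^sup>+ \<xi>. spectral_form H t s \<xi> \<partial>\<mu>) = (\<integral>\<^sup>+ \<tau>. \<integral>\<^sup>+ \<sigma>. w \<tau> \<sigma> * (\<integral>\<^sup>+ \<xi>. ?E \<tau> \<sigma> \<xi> \<partial>\<mu>) \<partial>lborel \<partial>lborel)"
  proof -
    have mE: "(\<lambda>x. ?E (fst (fst x)) (snd (fst x)) (snd x)) \<in> borel_measurable ((borel \<Otimes>\<^sub>M borel) \<Otimes>\<^sub>M borel)" by measurable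
    show ?thesis by (simp only: swap[OF mE] S)
  qed
  moreover have "(\<integral>\<^sup>+ \<tau>. \<integral>\<^sup>+ \<sigma>. w \<tau> \<sigma> * ?G \<tau> \<sigma> \<partial>lborel \<partial>lborel) + (\<integral>\<^sup>+ \<tau>. \<integral>\<^sup>+ \<sigma>. w \<tau> \<sigma> * (\<integral>\<^sup>+ \<xi>. ?D \<tau> \<sigma> \<xi> \<partial>\<mu>) \<partial>lborel \<partial>lborel)
     = (\<integral>\<^sup>+ \<tau>. \<integral>\<^sup>+ \<sigma>. w \<tau> \<sigma> * ?G \<tau> \<sigma> + w \<tau> \<sigma> * (\<integral>\<^sup>+ \<xi>. ?D \<tau> \<sigma> \<xi> \<partial>\<mu>) \<partial>lborel \<partial>lborel)"
    by (simp add: nn_integral_add)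
  moreover have "\<dots> = (\<integral>\<^sup>+ \<tau>. \<integral>\<^sup>+ \<sigma>. w \<tau> \<sigma> * (\<integral>\<^sup>+ \<xi>. ?E \<tau> \<sigma> \<xi> \<partial>\<mu>) \<partial>lborel \<partial>lborel)"
  proof (intro nn_integral_cong)
    fix \<tau> \<sigma> :: real
    show "w \<tau> \<sigma> * ?G \<tau> \<sigma> + w \<tau> \<sigma> * (\<integral>\<^sup>+ \<xi>. ?D \<tau> \<sigma> \<xi> \<partial>\<mu>) = w \<tau> \<sigma> * (\<integral>\<^sup>+ \<xi>. ?E \<tau> \<sigma> \<xi> \<partial>\<mu>)"
    \<comment> \<open>Where the weight does not vanish, both source times lie strictly before t and
      s, so the combined age is positive as \<open>spectral_heat_kernel\<close> requires.\<close>
    proof (cases "w \<tau> \<sigma> = 0")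
      case False
      then have "0 < ?c \<tau> \<sigma>" by (auto simp: w_def split: split_indicator_asm)
      from spectral_heat_kernel[OF \<Lambda> \<mu> this, of ?h] show ?thesis by (simp only: distrib_left[symmetric])
    qed simp
  qed
  ultimately show ?thesis by simp
qed

section \<open>Bounds for the spectral integrals\<close>

text \<open>Expand (a - b) (a' - b') <= |a - b| |a' - b'| and move the negative products to the
  other side. This bounds the form of the signed difference by that of its absolute value, again
  without subtraction in \<open>ennreal\<close>.\<close>

lemma frac_form_diff_le:
  assumes [measurable]: "\<phi> \<in> borel_measurable borel" "\<psi> \<in> borel_measurable borel"
    and nn: "\<And>r. 0 \<le> \<phi> r" "\<And>r. 0 \<le> \<psi> r"
  shows "frac_form H \<phi> \<phi> + frac_form H \<psi> \<psi> \<le> frac_form H \<phi> \<psi> + frac_form H \<psi> \<phi> + frac_form H (\<lambda>r. \<bar>\<phi> r - \<psi> r\<bar>) (\<lambda>r. \<bar>\<phi> r - \<psi> r\<bar>)"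
proof -
  let ?k = "\<lambda>\<tau> \<sigma>. \<bar>\<tau> - \<sigma>\<bar> powr (2 * H - 2)"
  let ?I = "\<lambda>F. \<integral>\<^sup>+ \<tau>. \<integral>\<^sup>+ \<sigma>. F \<tau> \<sigma> \<partial>lborel \<partial>(lborel :: real measure)"
  have "frac_form H \<phi> \<phi> + frac_form H \<psi> \<psi> = ?I (\<lambda>\<tau> \<sigma>. ennreal (?k \<tau> \<sigma> * \<phi> \<tau> * \<phi> \<sigma>) + ennreal (?k \<tau> \<sigma> * \<psi> \<tau> * \<psi> \<sigma>))"
    unfolding frac_form_def by (simp add: nn_integral_add)
  also have "\<dots> \<le> ?I (\<lambda>\<tau> \<sigma>. ennreal (?k \<tau> \<sigma> * \<phi> \<tau> * \<psi> \<sigma>) + ennreal (?k \<tau> \<sigma> * \<psi> \<tau> * \<phi> \<sigma>) + ennreal (?k \<tau> \<sigma> * \<bar>\<phi> \<tau> - \<psi> \<tau>\<bar> * \<bar>\<phi> \<sigma> - \<psi> \<sigma>\<bar>))"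
  proof (rule nn_integral_mono, rule nn_integral_mono)
    fix \<tau> \<sigma> :: real
    have "(\<phi> \<tau> - \<psi> \<tau>) * (\<phi> \<sigma> - \<psi> \<sigma>) \<le> \<bar>\<phi> \<tau> - \<psi> \<tau>\<bar> * \<bar>\<phi> \<sigma> - \<psi> \<sigma>\<bar>"
      by (metis abs_ge_self abs_mult)
    then have "\<phi> \<tau> * \<phi> \<sigma> + \<psi> \<tau> * \<psi> \<sigma> \<le> \<phi> \<tau> * \<psi> \<sigma> + \<psi> \<tau> * \<phi> \<sigma> + \<bar>\<phi> \<tau> - \<psi> \<tau>\<bar> * \<bar>\<phi> \<sigma> - \<psi> \<sigma>\<bar>"
      by (simp add: algebra_simps)
    then have "?k \<tau> \<sigma> * (\<phi> \<tau> * \<phi> \<sigma> + \<psi> \<tau> * \<psi> \<sigma>) \<le> ?k \<tau> \<sigma> * (\<phi> \<tau> * \<psi> \<sigma> + \<psi> \<tau> * \<phi> \<sigma> + \<bar>\<phi> \<tau> - \<psi> \<tau>\<bar> * \<bar>\<phi> \<sigma> - \<psi> \<sigma>\<bar>)"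
      by (rule mult_left_mono) simp
    then show "ennreal (?k \<tau> \<sigma> * \<phi> \<tau> * \<phi> \<sigma>) + ennreal (?k \<tau> \<sigma> * \<psi> \<tau> * \<psi> \<sigma>) \<le> ennreal (?k \<tau> \<sigma> * \<phi> \<tau> * \<psi> \<sigma>) + ennreal (?k \<tau> \<sigma> * \<psi> \<tau> * \<phi> \<sigma>) + ennreal (?k \<tau> \<sigma> * \<bar>\<phi> \<tau> - \<psi> \<tau>\<bar> * \<bar>\<phi> \<sigma> - \<psi> \<sigma>\<bar>)"
      using nn by (simp add: distrib_left mult.assoc flip: ennreal_plus)
  qed
  also have "\<dots> = frac_form H \<phi> \<psi> + frac_form H \<psi> \<phi> + frac_form H (\<lambda>r. \<bar>\<phi> r - \<psi> r\<bar>) (\<lambda>r. \<bar>\<phi> r - \<psi> r\<bar>)"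
    unfolding frac_form_def by (simp add: nn_integral_add)
  finally show ?thesis .
qed

definition increment_form :: "real \<Rightarrow> real \<Rightarrow> real \<Rightarrow> 'a::euclidean_space \<Rightarrow> ennreal" where
  "increment_form H t s \<xi> = frac_form H (\<lambda>r. \<bar>decay ((norm \<xi>)\<^sup>2) t r - decay ((norm \<xi>)\<^sup>2) s r\<bar>) (\<lambda>r. \<bar>decay ((norm \<xi>)\<^sup>2) t r - decay ((norm \<xi>)\<^sup>2) s r\<bar>)"

lemma increment_form_measurable [measurable]: "increment_form H t s \<in> borel_measurable borel"
  unfolding increment_form_def frac_form_def decay_def by measurable

lemma spectral_form_diff_le:
  "spectral_form H t t \<xi> + spectral_form H s s \<xi> \<le> spectral_form H t s \<xi> + spectral_form H s t \<xi> + increment_form H t s \<xi>"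
  unfolding spectral_form_def increment_form_def by (rule frac_form_diff_le) auto

lemma increment_bound:
  fixes \<alpha> H k1 k2 :: real
  assumes H: "1 / 2 < H" "H < 1" and \<alpha>: "0 \<le> \<alpha>" "\<alpha> < real DIM('a::euclidean_space)" "real DIM('a) - \<alpha> < 4 * H" and k2: "0 < k2"
  shows "\<exists>C>0. \<forall>\<mu> :: 'a measure. riesz_comparable \<alpha> k1 k2 \<mu> \<longrightarrow> (\<forall>s t. 0 \<le> s \<longrightarrow> s < t \<longrightarrow>
    (\<integral>\<^sup>+ \<xi>. increment_form H t s \<xi> \<partial>\<mu>) \<le> ennreal (C * (t - s) powr (2 * H - (real DIM('a) - \<alpha>) / 2)))"
proof -
  define C0 where "C0 = (2 / (2 * H - 1) + 1) * 2 powr (2 * H)"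
  have C0: "C0 > 0" using H by (simp add: C0_def add_pos_pos)
  obtain C1 where C1: "C1 > 0" "\<And>\<delta>. 0 < \<delta> \<Longrightarrow>
      (\<integral>\<^sup>+\<xi>. ennreal (norm (\<xi>::'a) powr (- \<alpha>) * min \<delta> (1 / (norm \<xi>)\<^sup>2) powr (2 * H)) \<partial>lborel) \<le> ennreal (C1 * \<delta> powr (2 * H - (real DIM('a) - \<alpha>) / 2))"
    using spectral_time_integral_le[OF \<alpha>] H by auto
  have "(\<integral>\<^sup>+ \<xi>. increment_form H t s \<xi> \<partial>\<mu>) \<le> ennreal ((k2 * (C0 * C1)) * (t - s) powr (2 * H - (real DIM('a) - \<alpha>) / 2))"
    if \<mu>: "riesz_comparable \<alpha> k1 k2 \<mu>" and st: "0 \<le> s" "s < t" for \<mu> :: "'a measure" and s t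
  proof -
    have "(\<integral>\<^sup>+ \<xi>. increment_form H t s \<xi> \<partial>\<mu>) \<le> ennreal k2 * (\<integral>\<^sup>+ \<xi>. increment_form H t s (\<xi>::'a) * ennreal (norm \<xi> powr (- \<alpha>)) \<partial>lborel)"
      using \<mu> unfolding riesz_comparable_def by (elim ballE[where x="increment_form H t s"]) auto
    also have "\<dots> \<le> ennreal k2 * (\<integral>\<^sup>+ \<xi>. ennreal C0 * ennreal (norm (\<xi>::'a) powr (- \<alpha>) * min (t - s) (1 / (norm \<xi>)\<^sup>2) powr (2 * H)) \<partial>lborel)"
    proof (intro mult_left_mono nn_integral_mono_AE, use AE_lborel_singleton[of "0::'a"] in eventually_elim)
      fix \<xi> :: 'a assume "\<xi> \<noteq> 0"
      then have "increment_form H t s \<xi> \<le> ennreal ((2 / (2 * H - 1) + 1) * (2 * min (t - s) (1 / (norm \<xi>)\<^sup>2)) powr (2 * H))"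
        unfolding increment_form_def using H st by (intro frac_form_decay_diff_le) auto
      also have "(2 / (2 * H - 1) + 1) * (2 * min (t - s) (1 / (norm \<xi>)\<^sup>2)) powr (2 * H) = C0 * min (t - s) (1 / (norm \<xi>)\<^sup>2) powr (2 * H)"
        using st by (simp add: C0_def powr_mult)
      finally have "increment_form H t s \<xi> * ennreal (norm \<xi> powr (- \<alpha>)) \<le> ennreal (C0 * min (t - s) (1 / (norm \<xi>)\<^sup>2) powr (2 * H)) * ennreal (norm \<xi> powr (- \<alpha>))"
        by (rule mult_right_mono) simp
      also have "\<dots> = ennreal C0 * ennreal (norm \<xi> powr (- \<alpha>) * min (t - s) (1 / (norm \<xi>)\<^sup>2) powr (2 * H))"
        using C0 by (simp add: ennreal_mult[symmetric] mult_ac)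
      finally show "increment_form H t s \<xi> * ennreal (norm \<xi> powr (- \<alpha>)) \<le> ennreal C0 * ennreal (norm \<xi> powr (- \<alpha>) * min (t - s) (1 / (norm \<xi>)\<^sup>2) powr (2 * H))" .
    qed simp
    also have "\<dots> = ennreal k2 * (ennreal C0 * (\<integral>\<^sup>+ \<xi>. ennreal (norm (\<xi>::'a) powr (- \<alpha>) * min (t - s) (1 / (norm \<xi>)\<^sup>2) powr (2 * H)) \<partial>lborel))"
      by (subst nn_integral_cmult) auto
    also have "\<dots> \<le> ennreal k2 * (ennreal C0 * ennreal (C1 * (t - s) powr (2 * H - (real DIM('a) - \<alpha>) / 2)))"
      using st by (intro mult_left_mono C1) auto
    also have "\<dots> = ennreal ((k2 * (C0 * C1)) * (t - s) powr (2 * H - (real DIM('a) - \<alpha>) / 2))"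
      using k2 C0 C1(1) by (simp add: ennreal_mult[symmetric] mult.assoc)
    finally show ?thesis .
  qed
  moreover have "0 < k2 * (C0 * C1)" using k2 C0 C1 by simp
  ultimately show ?thesis by blast
qed

text \<open>Where |\<xi>|^2 (t - s) >= K, the diagonal term of the later time is at least exp (-2)
  |\<xi>|^(-4H), and the two cross terms together take at most half of it. At the remaining
  frequencies positivity of the form is enough. Only the later time needs a lower bound, so s = 0 is
  allowed.\<close>

lemma increment_lower_bound:
  fixes \<alpha> H k1 k2 :: real
  assumes H: "1 / 2 < H" "H < 1" and \<alpha>: "0 \<le> \<alpha>" "real DIM('a::euclidean_space) - \<alpha> < 4 * H" and k1: "0 < k1"
  shows "\<exists>c>0. \<forall>\<mu> :: 'a measure. sets \<mu> = sets borel \<longrightarrow> riesz_comparable \<alpha> k1 k2 \<mu> \<longrightarrow> (\<forall>s t. 0 \<le> s \<longrightarrow> s < t \<longrightarrow>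
    (\<integral>\<^sup>+ \<xi>. spectral_form H t s \<xi> \<partial>\<mu>) + (\<integral>\<^sup>+ \<xi>. spectral_form H s t \<xi> \<partial>\<mu>) + ennreal (c * (t - s) powr (2 * H - (real DIM('a) - \<alpha>) / 2))
     \<le> (\<integral>\<^sup>+ \<xi>. spectral_form H t t \<xi> \<partial>\<mu>) + (\<integral>\<^sup>+ \<xi>. spectral_form H s s \<xi> \<partial>\<mu>))"
proof -
  obtain K where K: "1 \<le> K" "\<And>\<kappa> s t. 0 \<le> s \<Longrightarrow> s < t \<Longrightarrow> K \<le> \<kappa> * (t - s) \<Longrightarrow>
     frac_form H (decay \<kappa> t) (decay \<kappa> s) \<le> ennreal (exp (- 2) / 4 * \<kappa> powr (- 2 * H))"
    using frac_form_separation[OF H] by blast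
  obtain c1 where c1: "c1 > 0" "\<And>\<delta>. 0 < \<delta> \<Longrightarrow> ennreal (c1 * \<delta> powr (2 * H - (real DIM('a) - \<alpha>) / 2)) \<le>
    (\<integral>\<^sup>+\<xi>. ennreal (norm (\<xi>::'a) powr (- \<alpha>) * (indicator {K..} ((norm \<xi>)\<^sup>2 * \<delta>) * ((norm \<xi>)\<^sup>2) powr (- 2 * H))) \<partial>lborel)"
    using spectral_time_integral_ge[where 'a='a, OF \<alpha>, of K] K(1) by auto
  define c where "c = k1 * (exp (- 2) / 2 * c1)"
  have c: "c > 0" using k1 c1 by (simp add: c_def)
  have "(\<integral>\<^sup>+ \<xi>. spectral_form H t s \<xi> \<partial>\<mu>) + (\<integral>\<^sup>+ \<xi>. spectral_form H s t \<xi> \<partial>\<mu>) + ennreal (c * (t - s) powr (2 * H - (real DIM('a) - \<alpha>) / 2))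
     \<le> (\<integral>\<^sup>+ \<xi>. spectral_form H t t \<xi> \<partial>\<mu>) + (\<integral>\<^sup>+ \<xi>. spectral_form H s s \<xi> \<partial>\<mu>)"
    if sets: "sets \<mu> = sets borel" and \<mu>: "riesz_comparable \<alpha> k1 k2 \<mu>" and st: "0 \<le> s" "s < t" for \<mu> :: "'a measure" and s t
  proof -
    note [measurable_cong] = sets
    let ?J = "\<lambda>\<xi>::'a. ennreal (exp (- 2) / 2 * (indicator {K..} ((norm \<xi>)\<^sup>2 * (t - s)) * ((norm \<xi>)\<^sup>2) powr (- 2 * H)))"
    have pw: "spectral_form H t s \<xi> + spectral_form H s t \<xi> + ?J \<xi> \<le> spectral_form H t t \<xi> + spectral_form H s s \<xi>" for \<xi> :: 'a
    proof (cases "K \<le> (norm \<xi>)\<^sup>2 * (t - s)")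
      case True
      let ?\<kappa> = "(norm \<xi>)\<^sup>2"
      have \<kappa>: "0 < ?\<kappa>" using True K(1) by (metis less_le_trans mult_zero_left not_less zero_less_one zero_le_power2 order_le_less)
      have "1 \<le> ?\<kappa> * (t - s)" using True K(1) by linarith
      then have "1 / ?\<kappa> \<le> t - s" using \<kappa> by (simp add: pos_divide_le_eq mult.commute)
      then have "1 / ?\<kappa> \<le> t" using st by linarith
      then have "ennreal (exp (- 2) * (1 / ?\<kappa>) powr (2 * H)) \<le> spectral_form H t t \<xi>"
        unfolding spectral_form_def using \<kappa> H by (intro frac_form_decay_ge) auto
      moreover have "(1 / ?\<kappa>) powr (2 * H) = ?\<kappa> powr (- 2 * H)"
        using \<kappa> by (simp add: powr_minus powr_divide field_simps)
      ultimately have 1: "ennreal (exp (- 2) * ?\<kappa> powr (- 2 * H)) \<le> spectral_form H t t \<xi>" by simp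
      have 2: "spectral_form H t s \<xi> \<le> ennreal (exp (- 2) / 4 * ?\<kappa> powr (- 2 * H))"
        unfolding spectral_form_def by (rule K(2)[OF st True])
      have 3: "spectral_form H s t \<xi> = spectral_form H t s \<xi>"
        unfolding spectral_form_def by (rule frac_form_commute) auto
      have "spectral_form H t s \<xi> + spectral_form H s t \<xi> + ?J \<xi> \<le> ennreal (exp (- 2) / 4 * ?\<kappa> powr (- 2 * H)) + ennreal (exp (- 2) / 4 * ?\<kappa> powr (- 2 * H)) + ennreal (exp (- 2) / 2 * ?\<kappa> powr (- 2 * H))"
        unfolding 3 using True by (intro add_mono 2) auto
      also have "\<dots> = ennreal (exp (- 2) * ?\<kappa> powr (- 2 * H))"
        by (simp flip: ennreal_plus)
      also have "\<dots> \<le> spectral_form H t t \<xi> + spectral_form H s s \<xi>"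
        using 1 by (rule order_trans) simp
      finally show ?thesis .
    next
      case False
      then show ?thesis unfolding spectral_form_def using frac_form_amgm[OF H, of "decay ((norm \<xi>)\<^sup>2) t" "decay ((norm \<xi>)\<^sup>2) s"] by simp
    qed
    have "ennreal (c * (t - s) powr (2 * H - (real DIM('a) - \<alpha>) / 2)) = ennreal k1 * (ennreal (exp (- 2) / 2) * ennreal (c1 * (t - s) powr (2 * H - (real DIM('a) - \<alpha>) / 2)))"
      using k1 c1(1) by (simp add: c_def ennreal_mult[symmetric] mult_ac)
    also have "\<dots> \<le> ennreal k1 * (ennreal (exp (- 2) / 2) * (\<integral>\<^sup>+\<xi>. ennreal (norm (\<xi>::'a) powr (- \<alpha>) * (indicator {K..} ((norm \<xi>)\<^sup>2 * (t - s)) * ((norm \<xi>)\<^sup>2) powr (- 2 * H))) \<partial>lborel))"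
      using st by (intro mult_left_mono c1) auto
    also have "\<dots> = ennreal k1 * (\<integral>\<^sup>+\<xi>. ?J \<xi> * ennreal (norm \<xi> powr (- \<alpha>)) \<partial>lborel)"
      by (subst nn_integral_cmult[symmetric]) (auto intro!: arg_cong2[where f="(*)"] nn_integral_cong simp: ennreal_mult[symmetric] mult_ac)
    also have "\<dots> \<le> (\<integral>\<^sup>+\<xi>. ?J \<xi> \<partial>\<mu>)"
      using \<mu> unfolding riesz_comparable_def by (elim ballE[where x="?J"]) auto
    finally have "(\<integral>\<^sup>+ \<xi>. spectral_form H t s \<xi> \<partial>\<mu>) + (\<integral>\<^sup>+ \<xi>. spectral_form H s t \<xi> \<partial>\<mu>) + ennreal (c * (t - s) powr (2 * H - (real DIM('a) - \<alpha>) / 2))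
      \<le> (\<integral>\<^sup>+ \<xi>. spectral_form H t s \<xi> \<partial>\<mu>) + (\<integral>\<^sup>+ \<xi>. spectral_form H s t \<xi> \<partial>\<mu>) + (\<integral>\<^sup>+\<xi>. ?J \<xi> \<partial>\<mu>)"
      by (rule add_left_mono)
    also have "\<dots> = (\<integral>\<^sup>+ \<xi>. spectral_form H t s \<xi> + spectral_form H s t \<xi> + ?J \<xi> \<partial>\<mu>)"
      by (simp add: nn_integral_add)
    also have "\<dots> \<le> (\<integral>\<^sup>+ \<xi>. spectral_form H t t \<xi> + spectral_form H s s \<xi> \<partial>\<mu>)"
      by (intro nn_integral_mono pw)
    also have "\<dots> = (\<integral>\<^sup>+ \<xi>. spectral_form H t t \<xi> \<partial>\<mu>) + (\<integral>\<^sup>+ \<xi>. spectral_form H s s \<xi> \<partial>\<mu>)"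
      by (simp add: nn_integral_add)
    finally show ?thesis .
  qed
  with c show ?thesis by blast
qed

lemma spatial_bound:
  fixes \<alpha> H k1 k2 T D :: real
  assumes H: "1 / 2 < H" "H < 1" and \<alpha>: "0 \<le> \<alpha>" "\<alpha> < real DIM('a::euclidean_space)" and \<gamma>: "\<gamma> = 4 * H - (real DIM('a) - \<alpha>)" "0 < \<gamma>"
    and k2: "0 < k2" and T: "0 < T" and D: "0 < D"
  shows "\<exists>C>0. \<forall>\<mu> :: 'a measure. riesz_comparable \<alpha> k1 k2 \<mu> \<longrightarrow> (\<forall>s h. s \<in> {0..T} \<longrightarrow> h \<noteq> 0 \<longrightarrow> norm h \<le> D \<longrightarrow>
    (\<integral>\<^sup>+ \<xi>. spectral_form H s s \<xi> * ennreal (1 - cos (\<xi> \<bullet> h)) \<partial>\<mu>) \<le> ennreal (C * modulus D \<gamma> (norm h)))"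
proof -
  define K0 where "K0 = 2 / (2 * H - 1) + 1"
  define C0 where "C0 = K0 * 2"
  have K0: "K0 > 0" using H by (simp add: K0_def add_pos_pos)
  then have C0: "C0 > 0" by (simp add: C0_def)
  obtain C1 where C1: "C1 > 0" "\<And>\<rho>. 0 < \<rho> \<Longrightarrow> \<rho> \<le> D \<Longrightarrow>
    (\<integral>\<^sup>+\<xi>. ennreal (norm (\<xi>::'a::euclidean_space) powr (- \<alpha>) * (min T (1 / (norm \<xi>)\<^sup>2) powr (2 * H) * min 1 ((norm \<xi>)\<^sup>2 * \<rho>\<^sup>2))) \<partial>lborel)
      \<le> ennreal (C1 * modulus D \<gamma> \<rho>)"
    using spectral_space_integral_le[OF \<alpha> \<gamma> _ D T] H by auto
  have "(\<integral>\<^sup>+ \<xi>. spectral_form H s s \<xi> * ennreal (1 - cos (\<xi> \<bullet> h)) \<partial>\<mu>) \<le> ennreal ((k2 * (C0 * C1)) * modulus D \<gamma> (norm h))"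
    if \<mu>: "riesz_comparable \<alpha> k1 k2 \<mu>" and s: "s \<in> {0..T}" and h: "h \<noteq> 0" "norm h \<le> D" for \<mu> :: "'a measure" and s and h :: 'a
  proof -
    let ?f = "\<lambda>\<xi>. spectral_form H s s \<xi> * ennreal (1 - cos (\<xi> \<bullet> h))"
    let ?g = "\<lambda>\<xi>::'a. norm \<xi> powr (- \<alpha>) * (min T (1 / (norm \<xi>)\<^sup>2) powr (2 * H) * min 1 ((norm \<xi>)\<^sup>2 * (norm h)\<^sup>2))"
    have "(\<integral>\<^sup>+ \<xi>. ?f \<xi> \<partial>\<mu>) \<le> ennreal k2 * (\<integral>\<^sup>+ \<xi>. ?f \<xi> * ennreal (norm \<xi> powr (- \<alpha>)) \<partial>lborel)"
      using \<mu> unfolding riesz_comparable_def by (elim ballE[where x="?f"]) auto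
    also have "\<dots> \<le> ennreal k2 * (\<integral>\<^sup>+ \<xi>. ennreal C0 * ennreal (?g \<xi>) \<partial>lborel)"
    proof (intro mult_left_mono nn_integral_mono_AE, use AE_lborel_singleton[of "0::'a"] in eventually_elim)
      fix \<xi> :: 'a assume "\<xi> \<noteq> 0"
      then have 1: "spectral_form H s s \<xi> \<le> ennreal (K0 * min T (1 / (norm \<xi>)\<^sup>2) powr (2 * H))"
        unfolding spectral_form_def K0_def using H s T by (intro frac_form_decay_le) auto
      have "1 - cos (\<xi> \<bullet> h) \<le> 2 * min 1 ((\<xi> \<bullet> h)\<^sup>2)" by (rule one_minus_cos_le)
      also have "\<dots> \<le> 2 * min 1 ((norm \<xi>)\<^sup>2 * (norm h)\<^sup>2)"
      proof -
        have "(\<xi> \<bullet> h)\<^sup>2 \<le> (norm \<xi> * norm h)\<^sup>2"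
          using Cauchy_Schwarz_ineq2[of \<xi> h] by (metis abs_ge_zero power2_abs power_mono)
        then show ?thesis by (auto simp: power_mult_distrib min_def)
      qed
      finally have 2: "ennreal (1 - cos (\<xi> \<bullet> h)) \<le> ennreal (2 * min 1 ((norm \<xi>)\<^sup>2 * (norm h)\<^sup>2))" by (rule ennreal_leI)
      have "?f \<xi> * ennreal (norm \<xi> powr (- \<alpha>)) \<le> (ennreal (K0 * min T (1 / (norm \<xi>)\<^sup>2) powr (2 * H)) * ennreal (2 * min 1 ((norm \<xi>)\<^sup>2 * (norm h)\<^sup>2))) * ennreal (norm \<xi> powr (- \<alpha>))"
        by (intro mult_mono 1 2) auto
      also have "\<dots> = ennreal C0 * ennreal (?g \<xi>)"
        using K0 by (simp add: C0_def ennreal_mult[symmetric] mult_ac)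
      finally show "?f \<xi> * ennreal (norm \<xi> powr (- \<alpha>)) \<le> ennreal C0 * ennreal (?g \<xi>)" .
    qed simp
    also have "\<dots> = ennreal k2 * (ennreal C0 * (\<integral>\<^sup>+ \<xi>. ennreal (?g \<xi>) \<partial>lborel))"
      by (subst nn_integral_cmult) auto
    also have "\<dots> \<le> ennreal k2 * (ennreal C0 * ennreal (C1 * modulus D \<gamma> (norm h)))"
      using h by (intro mult_left_mono C1) auto
    also have "\<dots> = ennreal ((k2 * (C0 * C1)) * modulus D \<gamma> (norm h))"
    proof -
      have "0 \<le> modulus D \<gamma> (norm h)" using modulus_log[of "norm h" D] h by (simp add: modulus_def)
      then show ?thesis using k2 C0 C1(1) by (simp add: ennreal_mult[symmetric] mult.assoc)
    qed
    finally show ?thesis .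
  qed
  moreover have "0 < k2 * (C0 * C1)" using k2 C0 C1 by simp
  ultimately show ?thesis by blast
qed

text \<open>This is where times are kept away from 0: for s >= t0 the diagonal form is at least exp
  (-2) times the power 2H of min t0 (1 / |\<xi>|^2), uniformly in s.\<close>

lemma spatial_lower_bound:
  fixes \<alpha> H k1 k2 t0 D :: real
  assumes H: "1 / 2 < H" "H < 1" and \<alpha>: "0 \<le> \<alpha>" "\<alpha> < real DIM('a::euclidean_space)" and \<gamma>: "\<gamma> = 4 * H - (real DIM('a) - \<alpha>)"
    and k1: "0 < k1" and t0: "0 < t0" and D: "0 < D"
  shows "\<exists>c>0. \<forall>\<mu> :: 'a measure. riesz_comparable \<alpha> k1 k2 \<mu> \<longrightarrow> (\<forall>s h. t0 \<le> s \<longrightarrow> h \<noteq> 0 \<longrightarrow> norm h \<le> D \<longrightarrow>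
    ennreal (c * modulus D \<gamma> (norm h)) \<le> (\<integral>\<^sup>+ \<xi>. spectral_form H s s \<xi> * ennreal (1 - cos (\<xi> \<bullet> h)) \<partial>\<mu>))"
proof -
  obtain c1 where c1: "c1 > 0" "\<And>h::'a. h \<noteq> 0 \<Longrightarrow> norm h \<le> D \<Longrightarrow> ennreal (c1 * modulus D \<gamma> (norm h)) \<le>
    (\<integral>\<^sup>+\<xi>. ennreal (norm \<xi> powr (- \<alpha>) * (min t0 (1 / (norm \<xi>)\<^sup>2) powr (2 * H) * (1 - cos (\<xi> \<bullet> h)))) \<partial>lborel)"
    using spectral_space_integral_ge[OF \<alpha> \<gamma> _ D t0] H by auto
  have "ennreal ((k1 * (exp (- 2) * c1)) * modulus D \<gamma> (norm h)) \<le> (\<integral>\<^sup>+ \<xi>. spectral_form H s s \<xi> * ennreal (1 - cos (\<xi> \<bullet> h)) \<partial>\<mu>)"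
    if \<mu>: "riesz_comparable \<alpha> k1 k2 \<mu>" and s: "t0 \<le> s" and h: "h \<noteq> 0" "norm h \<le> D" for \<mu> :: "'a measure" and s and h :: 'a
  proof -
    let ?f = "\<lambda>\<xi>. spectral_form H s s \<xi> * ennreal (1 - cos (\<xi> \<bullet> h))"
    let ?g = "\<lambda>\<xi>::'a. norm \<xi> powr (- \<alpha>) * (min t0 (1 / (norm \<xi>)\<^sup>2) powr (2 * H) * (1 - cos (\<xi> \<bullet> h)))"
    have m: "0 \<le> modulus D \<gamma> (norm h)" using modulus_log[of "norm h" D] h by (simp add: modulus_def)
    have "ennreal ((k1 * (exp (- 2) * c1)) * modulus D \<gamma> (norm h)) = ennreal k1 * (ennreal (exp (- 2)) * ennreal (c1 * modulus D \<gamma> (norm h)))"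
      using m k1 c1(1) by (simp add: ennreal_mult[symmetric] mult.assoc)
    also have "\<dots> \<le> ennreal k1 * (ennreal (exp (- 2)) * (\<integral>\<^sup>+ \<xi>. ennreal (?g \<xi>) \<partial>lborel))"
      using h by (intro mult_left_mono c1) auto
    also have "\<dots> = ennreal k1 * (\<integral>\<^sup>+ \<xi>. ennreal (exp (- 2)) * ennreal (?g \<xi>) \<partial>lborel)"
      by (subst nn_integral_cmult) auto
    also have "\<dots> \<le> ennreal k1 * (\<integral>\<^sup>+ \<xi>. ?f \<xi> * ennreal (norm \<xi> powr (- \<alpha>)) \<partial>lborel)"
    proof (intro mult_left_mono nn_integral_mono_AE, use AE_lborel_singleton[of "0::'a"] in eventually_elim)
      fix \<xi> :: 'a assume \<xi>: "\<xi> \<noteq> 0"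
      have "ennreal (exp (- 2) * min t0 (1 / (norm \<xi>)\<^sup>2) powr (2 * H)) \<le> spectral_form H s s \<xi>"
        unfolding spectral_form_def using H s t0 \<xi> by (intro frac_form_decay_ge) auto
      then have "ennreal (exp (- 2) * min t0 (1 / (norm \<xi>)\<^sup>2) powr (2 * H)) * ennreal (1 - cos (\<xi> \<bullet> h)) * ennreal (norm \<xi> powr (- \<alpha>)) \<le> ?f \<xi> * ennreal (norm \<xi> powr (- \<alpha>))"
        by (intro mult_right_mono) auto
      then show "ennreal (exp (- 2)) * ennreal (?g \<xi>) \<le> ?f \<xi> * ennreal (norm \<xi> powr (- \<alpha>))"
        by (simp add: ennreal_mult[symmetric] mult_ac)
    qed simp
    also have "\<dots> \<le> (\<integral>\<^sup>+ \<xi>. ?f \<xi> \<partial>\<mu>)"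
      using \<mu> unfolding riesz_comparable_def by (elim ballE[where x="?f"]) auto
    finally show ?thesis .
  qed
  moreover have "0 < k1 * (exp (- 2) * c1)" using k1 c1 by simp
  ultimately show ?thesis by blast
qed


section \<open>Increments of the solution\<close>

locale heat_field = coloured_noise +
  fixes \<mu> :: "'b measure" and u :: "real \<Rightarrow> 'b \<Rightarrow> 'a \<Rightarrow> real"
  assumes \<mu>: "spectral_measure \<Lambda> \<mu>" and u: "heat_solution P T H \<Lambda> W u"
begin

lemma u_wiener: "t \<in> {0..T} \<Longrightarrow> wiener_integral P T H \<Lambda> W (heat_source t x) (u t x)"
  using u unfolding heat_solution_def heat_source_def[abs_def] by blast

lemma heat_source_energy_space: "t \<in> {0..T} \<Longrightarrow> energy_space (heat_source t x)"
  using u_wiener[of t x] by (auto simp: wiener_integral_def energy_space_def heat_source_def)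

text \<open>The covariance integral of u(t, x) and u(s, y) without the factor
  \<open>cH\<close>.\<close>

definition cov_form :: "real \<Rightarrow> 'b \<Rightarrow> real \<Rightarrow> 'b \<Rightarrow> real" where
  "cov_form t x s y = integral\<^sup>L (energy_measure \<Lambda>) (cross H (heat_source t x) (heat_source s y))"

lemma cov_form_nonneg: "0 \<le> cov_form t x s y"
  unfolding cov_form_def by (intro Bochner_Integration.integral_nonneg) (simp add: cross_def heat_source_nonneg)

lemma cov_form_spectral:
  assumes "t \<in> {0..T}" "s \<in> {0..T}"
  shows "ennreal (cov_form t x s y) + (\<integral>\<^sup>+ \<xi>. spectral_form H t s \<xi> * ennreal (1 - cos (\<xi> \<bullet> (x - y))) \<partial>\<mu>) = (\<integral>\<^sup>+ \<xi>. spectral_form H t s \<xi> \<partial>\<mu>)"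
proof -
  have "ennreal (cov_form t x s y) = (\<integral>\<^sup>+ p. ennreal (cross H (heat_source t x) (heat_source s y) p) \<partial>energy_measure \<Lambda>)"
    unfolding cov_form_def
    by (rule nn_integral_eq_integral[symmetric]) (use assms in \<open>auto intro!: cross_integrable heat_source_energy_space simp: cross_def heat_source_nonneg\<close>)
  then show ?thesis using spectral_identity[OF \<Lambda> \<mu>, of H t x s y] by simp
qed

lemma cov_form_same: "t \<in> {0..T} \<Longrightarrow> s \<in> {0..T} \<Longrightarrow> (\<integral>\<^sup>+ \<xi>. spectral_form H t s \<xi> \<partial>\<mu>) = ennreal (cov_form t x s x)"
  using cov_form_spectral[of t s x x] by simp

text \<open>Spatial homogeneity: for coinciding points the spectral expression does not depend on
  the point.\<close>

lemma cov_form_shift: "t \<in> {0..T} \<Longrightarrow> s \<in> {0..T} \<Longrightarrow> cov_form t y s y = cov_form t x s x"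
  using cov_form_same[of t s x] cov_form_same[of t s y] by (simp add: cov_form_nonneg)

lemma cov_form_le:
  assumes "t \<in> {0..T}" "s \<in> {0..T}"
  shows "cov_form t x s y \<le> cov_form t x s x"
proof -
  have "ennreal (cov_form t x s y) \<le> (\<integral>\<^sup>+ \<xi>. spectral_form H t s \<xi> \<partial>\<mu>)"
    unfolding cov_form_spectral[OF assms, of x y, symmetric] by simp
  then show ?thesis unfolding cov_form_same[OF assms, of x] by (simp add: cov_form_nonneg)
qed

definition sq_increment :: "real \<Rightarrow> real \<Rightarrow> 'b \<Rightarrow> 'b \<Rightarrow> real" where
  "sq_increment t s x y = (L2_norm P (\<lambda>\<omega>. u t x \<omega> - u s y \<omega>))\<^sup>2"

lemma sq_increment_eq:
  assumes "t \<in> {0..T}" "s \<in> {0..T}"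
  shows "sq_increment t s x y = cH * (cov_form t x t x + cov_form s y s y - cov_form t x s y - cov_form s y t x)"
  unfolding sq_increment_def
    wiener_isometry[OF heat_source_energy_space[OF assms(1)] heat_source_energy_space[OF assms(2)] u_wiener[OF assms(1)] u_wiener[OF assms(2)]]
    energy_space_diff(2)[OF heat_source_energy_space[OF assms(1)] heat_source_energy_space[OF assms(2)]]
  by (simp add: energy_eq cross_energy_def cov_form_def algebra_simps)

lemma sq_increment_nonneg: "0 \<le> sq_increment t s x y"
  by (simp add: sq_increment_def)

lemma sq_increment_commute: "sq_increment t s x y = sq_increment s t y x"
  by (simp add: sq_increment_def L2_norm_def power2_commute)

lemma sq_increment_time_le:
  assumes "t \<in> {0..T}" "s \<in> {0..T}"
  shows "sq_increment t s x x \<le> sq_increment t s x y"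
proof -
  have "cov_form s y t x \<le> cov_form s x t x"
    using cov_form_le[OF assms(2,1), of y x] cov_form_shift[OF assms(2,1), of y x] by simp
  moreover have "cov_form t x s y \<le> cov_form t x s x" by (rule cov_form_le[OF assms])
  moreover have "cov_form s y s y = cov_form s x s x" by (rule cov_form_shift[OF assms(2,2)])
  ultimately show ?thesis
    unfolding sq_increment_eq[OF assms] using cH_pos by (intro mult_left_mono) auto
qed

lemma sq_increment_triangle:
  assumes "t \<in> {0..T}" "s \<in> {0..T}" "r \<in> {0..T}"
  shows "sq_increment t s x y \<le> 2 * sq_increment t r x z + 2 * sq_increment r s z y"
proof -
  have m: "u t x \<in> borel_measurable P" "integrable P (\<lambda>\<omega>. (u t x \<omega>)\<^sup>2)" if "t \<in> {0..T}" for t x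
    using u_wiener[OF that] by (auto simp: wiener_integral_def)
  have d: "(\<lambda>\<omega>. u t x \<omega> - u s y \<omega>) \<in> borel_measurable P" "integrable P (\<lambda>\<omega>. (u t x \<omega> - u s y \<omega>)\<^sup>2)" if "t \<in> {0..T}" "s \<in> {0..T}" for t s x y
  proof -
    show "(\<lambda>\<omega>. u t x \<omega> - u s y \<omega>) \<in> borel_measurable P" using m that by simp
    show "integrable P (\<lambda>\<omega>. (u t x \<omega> - u s y \<omega>)\<^sup>2)"
      using integrable_product_of_squares[OF m(1)[OF that(1)] m(1)[OF that(2)] m(2)[OF that(1)] m(2)[OF that(2)]] m(2)[OF that(1)] m(2)[OF that(2)]
      by (simp add: power2_diff mult.assoc)
  qed
  have "L2_norm P (\<lambda>\<omega>. u t x \<omega> - u s y \<omega>) \<le> L2_norm P (\<lambda>\<omega>. u t x \<omega> - u r z \<omega>) + L2_norm P (\<lambda>\<omega>. u r z \<omega> - u s y \<omega>)"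
    using L2_norm_triangle[OF d(1)[OF assms(1,3), of x z] d(2)[OF assms(1,3), of x z] d(1)[OF assms(3,2), of z y] d(2)[OF assms(3,2), of z y]] by simp
  then have "sq_increment t s x y \<le> (L2_norm P (\<lambda>\<omega>. u t x \<omega> - u r z \<omega>) + L2_norm P (\<lambda>\<omega>. u r z \<omega> - u s y \<omega>))\<^sup>2"
    unfolding sq_increment_def by (intro power_mono) (auto simp: L2_norm_def)
  also have "\<dots> \<le> 2 * sq_increment t r x z + 2 * sq_increment r s z y"
    unfolding sq_increment_def power2_sum
    using sum_squares_bound[of "L2_norm P (\<lambda>\<omega>. u t x \<omega> - u r z \<omega>)" "L2_norm P (\<lambda>\<omega>. u r z \<omega> - u s y \<omega>)"] by linarith
  finally show ?thesis .
qed

text \<open>Each of the two covariances falls short of the variance by the integral with 1 - cos,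
  since the cosine is even; hence the factor 2.\<close>

lemma sq_increment_space:
  assumes s: "s \<in> {0..T}"
  shows "ennreal (sq_increment s s x y) = ennreal (2 * cH) * (\<integral>\<^sup>+ \<xi>. spectral_form H s s \<xi> * ennreal (1 - cos (\<xi> \<bullet> (x - y))) \<partial>\<mu>)"
proof -
  let ?D = "\<lambda>h. (\<integral>\<^sup>+ \<xi>. spectral_form H s s \<xi> * ennreal (1 - cos (\<xi> \<bullet> h)) \<partial>\<mu>)"
  let ?e = "cov_form s x s x"
  have 1: "ennreal (cov_form s x s y) + ?D (x - y) = ennreal ?e"
    using cov_form_spectral[OF s s, of x y] cov_form_same[OF s s, of x] by simp
  have "?D (y - x) = ?D (x - y)"
    by (intro nn_integral_cong) (metis cos_minus inner_minus_right minus_diff_eq)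
  then have 2: "ennreal (cov_form s y s x) + ?D (x - y) = ennreal ?e"
    using cov_form_spectral[OF s s, of y x] cov_form_same[OF s s, of x] by simp
  \<comment> \<open>Finiteness first: the identities in \<open>ennreal\<close> can be solved for the
    covariances only once the integral is known to be a real number d.\<close>
  have "?D (x - y) \<le> ennreal ?e" unfolding 1[symmetric] by simp
  then obtain d where d: "?D (x - y) = ennreal d" "0 \<le> d"
    by (cases "?D (x - y)") (auto simp: top_unique)
  have "cov_form s x s y + d = ?e" "cov_form s y s x + d = ?e"
    using 1 2 d by (simp_all add: cov_form_nonneg flip: ennreal_plus)
  then have c: "cov_form s x s y = ?e - d" "cov_form s y s x = ?e - d" by linarith+
  have "sq_increment s s x y = 2 * cH * d"
    unfolding sq_increment_eq[OF s s] c cov_form_shift[OF s s, of y x] by (simp add: algebra_simps)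
  then show ?thesis using d cH_pos by (simp add: ennreal_mult)
qed

lemma sq_increment_time_upper:
  assumes ts: "t \<in> {0..T}" "s \<in> {0..T}" and b: "(\<integral>\<^sup>+ \<xi>. increment_form H t s \<xi> \<partial>\<mu>) \<le> ennreal b" "0 \<le> b"
  shows "sq_increment t s x x \<le> cH * b"
proof -
  have [measurable_cong]: "sets \<mu> = sets borel" using \<mu> by (simp add: spectral_measure_def tempered_measure_def)
  have "(\<integral>\<^sup>+ \<xi>. spectral_form H t t \<xi> \<partial>\<mu>) + (\<integral>\<^sup>+ \<xi>. spectral_form H s s \<xi> \<partial>\<mu>) = (\<integral>\<^sup>+ \<xi>. spectral_form H t t \<xi> + spectral_form H s s \<xi> \<partial>\<mu>)"
    by (simp add: nn_integral_add)
  also have "\<dots> \<le> (\<integral>\<^sup>+ \<xi>. spectral_form H t s \<xi> + spectral_form H s t \<xi> + increment_form H t s \<xi> \<partial>\<mu>)"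
    by (intro nn_integral_mono spectral_form_diff_le)
  also have "\<dots> = (\<integral>\<^sup>+ \<xi>. spectral_form H t s \<xi> \<partial>\<mu>) + (\<integral>\<^sup>+ \<xi>. spectral_form H s t \<xi> \<partial>\<mu>) + (\<integral>\<^sup>+ \<xi>. increment_form H t s \<xi> \<partial>\<mu>)"
    by (simp add: nn_integral_add)
  also have "\<dots> \<le> (\<integral>\<^sup>+ \<xi>. spectral_form H t s \<xi> \<partial>\<mu>) + (\<integral>\<^sup>+ \<xi>. spectral_form H s t \<xi> \<partial>\<mu>) + ennreal b"
    by (intro add_left_mono b)
  finally have "cov_form t x t x + cov_form s x s x \<le> cov_form t x s x + cov_form s x t x + b"
    using ts b(2) by (simp add: cov_form_same[where x=x] cov_form_nonneg flip: ennreal_plus)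
  then show ?thesis unfolding sq_increment_eq[OF ts] using cH_pos by (intro mult_left_mono) auto
qed

lemma sq_increment_time_lower:
  assumes ts: "t \<in> {0..T}" "s \<in> {0..T}" and b: "0 \<le> b"
    and le: "(\<integral>\<^sup>+ \<xi>. spectral_form H t s \<xi> \<partial>\<mu>) + (\<integral>\<^sup>+ \<xi>. spectral_form H s t \<xi> \<partial>\<mu>) + ennreal b \<le> (\<integral>\<^sup>+ \<xi>. spectral_form H t t \<xi> \<partial>\<mu>) + (\<integral>\<^sup>+ \<xi>. spectral_form H s s \<xi> \<partial>\<mu>)"
  shows "cH * b \<le> sq_increment t s x x"
proof -
  have "cov_form t x s x + cov_form s x t x + b \<le> cov_form t x t x + cov_form s x s x"
    using le ts b by (simp add: cov_form_same[where x=x] cov_form_nonneg flip: ennreal_plus)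
  then show ?thesis unfolding sq_increment_eq[OF ts] using cH_pos by (intro mult_left_mono) auto
qed

end

text \<open>The diameter of the cube, which is the source of the constant inside the logarithm of
  \<open>\<Theta>\<close>.\<close>

lemma norm_diff_le_cube:
  fixes x y :: "real ^ 'n"
  assumes "\<forall>i. x $ i \<in> {-M..M}" "\<forall>i. y $ i \<in> {-M..M}"
  shows "norm (x - y) \<le> 2 * sqrt (real CARD('n)) * M"
proof -
  have M: "0 \<le> M" using assms(1)[rule_format, of undefined] by simp
  have "(\<Sum>i\<in>UNIV. ((x - y) $ i)\<^sup>2) \<le> (\<Sum>i\<in>(UNIV :: 'n set). (2 * M)\<^sup>2)"
  proof (intro sum_mono)
    fix i
    have "\<bar>(x - y) $ i\<bar> \<le> 2 * M" using assms(1)[rule_format, of i] assms(2)[rule_format, of i] by auto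
    then show "((x - y) $ i)\<^sup>2 \<le> (2 * M)\<^sup>2" by (metis abs_ge_zero power2_abs power_mono)
  qed
  then have "norm (x - y) \<le> sqrt (real CARD('n) * (2 * M)\<^sup>2)"
    unfolding norm_vec_def L2_set_def by (intro real_sqrt_le_mono) simp
  also have "\<dots> = 2 * sqrt (real CARD('n)) * M" using M by (simp add: real_sqrt_mult)
  finally show ?thesis .
qed

text \<open>The estimate of \<open>spectral_space_integral_le\<close> once more, by the same split
  at the frequencies 1 / D and 1 / \<rho>.\<close>

lemma
  assumes \<alpha>: "0 \<le> \<alpha>" "\<alpha> < real DIM('a)" and \<gamma>: "\<gamma> = 4 * H - (real DIM('a) - \<alpha>)" "0 < \<gamma>"
    and H: "0 < H" and D: "0 < D" and T: "0 < T"
  shows "\<exists>C>0. \<forall>\<rho>. 0 < \<rho> \<longrightarrow> \<rho> \<le> D \<longrightarrow>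
    (\<integral>\<^sup>+\<xi>. ennreal (norm (\<xi>::'a::euclidean_space) powr (- \<alpha>) * (min T (1 / (norm \<xi>)\<^sup>2) powr (2 * H) * min 1 ((norm \<xi>)\<^sup>2 * \<rho>\<^sup>2))) \<partial>lborel)
      \<le> ennreal (C * modulus D \<gamma> \<rho>)"
proof -
  let ?d = "real DIM('a)" and ?v = "real DIM('a) * unit_ball_vol (real DIM('a))"
  have v: "0 < ?v" by simp
  define q where "q = - \<alpha> - 4 * H"
  have q: "q = - ?d - \<gamma>" using \<gamma> by (simp add: q_def)
  obtain C2 where C2: "C2 > 0" "\<And>\<rho>. 0 < \<rho> \<Longrightarrow> \<rho> \<le> D \<Longrightarrow>
    (\<integral>\<^sup>+\<xi>. ennreal (norm (\<xi>::'a) powr (2 + q) * indicator {1 / D..1 / \<rho>} (norm \<xi>)) \<partial>lborel)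
      \<le> ennreal (C2 * (modulus D \<gamma> \<rho> / \<rho>\<^sup>2))"
    using nn_integral_norm_powr_annulus_le[OF D q] by blast
  define A1 where "A1 = T powr (2 * H) * (?v * ((1 / D) powr (2 - \<alpha> + ?d) / (2 - \<alpha> + ?d)))"
  have A1: "A1 \<ge> 0" unfolding A1_def using \<alpha> v by (intro mult_nonneg_nonneg divide_nonneg_nonneg) auto
  define C where "C = A1 * D powr (2 - min 2 \<gamma>) + C2 + ?v / \<gamma> * D powr (\<gamma> - min 2 \<gamma>)"
  have C: "C > 0" using A1 C2 v \<gamma> D unfolding C_def by (intro add_nonneg_pos add_pos_pos mult_pos_pos divide_pos_pos) (auto intro!: add_nonneg_pos mult_nonneg_nonneg)
  have "(\<integral>\<^sup>+\<xi>. ennreal (norm (\<xi>::'a) powr (- \<alpha>) * (min T (1 / (norm \<xi>)\<^sup>2) powr (2 * H) * min 1 ((norm \<xi>)\<^sup>2 * \<rho>\<^sup>2))) \<partial>lborel)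
      \<le> ennreal (C * modulus D \<gamma> \<rho>)" if \<rho>: "0 < \<rho>" "\<rho> \<le> D" for \<rho>
  proof -
    have m0: "0 \<le> modulus D \<gamma> \<rho>" using modulus_log[OF \<rho>] by (simp add: modulus_def)
    let ?f1 = "\<lambda>\<xi>::'a. ennreal (norm \<xi> powr (2 - \<alpha>) * indicator {0..1 / D} (norm \<xi>))"
    let ?f2 = "\<lambda>\<xi>::'a. ennreal (norm \<xi> powr (2 + q) * indicator {1 / D..1 / \<rho>} (norm \<xi>))"
    let ?f3 = "\<lambda>\<xi>::'a. ennreal (norm \<xi> powr q * indicator {1 / \<rho>..} (norm \<xi>))"
    have "(\<integral>\<^sup>+\<xi>. ennreal (norm (\<xi>::'a) powr (- \<alpha>) * (min T (1 / (norm \<xi>)\<^sup>2) powr (2 * H) * min 1 ((norm \<xi>)\<^sup>2 * \<rho>\<^sup>2))) \<partial>lborel)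
      \<le> (\<integral>\<^sup>+\<xi>. ennreal (T powr (2 * H) * \<rho>\<^sup>2) * ?f1 \<xi> + (ennreal (\<rho>\<^sup>2) * ?f2 \<xi> + ?f3 \<xi>) \<partial>lborel)"
    proof (intro nn_integral_mono_AE, use AE_lborel_singleton[of "0::'a"] in eventually_elim)
      fix \<xi> :: 'a assume "\<xi> \<noteq> 0"
      then have n: "0 < norm \<xi>" by simp
      let ?m = "min T (1 / (norm \<xi>)\<^sup>2) powr (2 * H)" and ?k = "min 1 ((norm \<xi>)\<^sup>2 * \<rho>\<^sup>2)"
      have m1: "?m \<le> T powr (2 * H)" using T H by (intro powr_mono2) auto
      have m2: "?m \<le> norm \<xi> powr (- 4 * H)"
      proof -
        have "?m \<le> (1 / (norm \<xi>)\<^sup>2) powr (2 * H)" using T H by (intro powr_mono2) auto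
        also have "\<dots> = (norm \<xi> powr (- 2)) powr (2 * H)"
          using n by (simp add: powr_minus powr_numeral field_simps)
        also have "\<dots> = norm \<xi> powr (- 4 * H)" by (simp add: powr_powr)
        finally show ?thesis .
      qed
      have n2: "(norm \<xi>)\<^sup>2 = norm \<xi> powr 2" using n by (simp add: powr_numeral)
      have "norm \<xi> powr (- \<alpha>) * (?m * ?k) \<le> (T powr (2 * H) * \<rho>\<^sup>2) * (norm \<xi> powr (2 - \<alpha>) * indicator {0..1 / D} (norm \<xi>))
        + (\<rho>\<^sup>2 * (norm \<xi> powr (2 + q) * indicator {1 / D..1 / \<rho>} (norm \<xi>)) + norm \<xi> powr q * indicator {1 / \<rho>..} (norm \<xi>))"
      proof -
        consider "norm \<xi> \<le> 1 / D" | "1 / D \<le> norm \<xi>" "norm \<xi> \<le> 1 / \<rho>" | "1 / \<rho> \<le> norm \<xi>" by linarith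
        then show ?thesis
        proof cases
          case 1
          have "norm \<xi> powr (- \<alpha>) * (?m * ?k) \<le> norm \<xi> powr (- \<alpha>) * (T powr (2 * H) * ((norm \<xi>)\<^sup>2 * \<rho>\<^sup>2))"
            using m1 by (intro mult_left_mono mult_mono) auto
          also have "\<dots> = (T powr (2 * H) * \<rho>\<^sup>2) * norm \<xi> powr (2 - \<alpha>)"
            unfolding n2 by (simp add: powr_diff powr_minus field_simps)
          finally show ?thesis using 1 by (simp add: add_increasing2)
        next
          case 2
          have "norm \<xi> powr (- \<alpha>) * (?m * ?k) \<le> norm \<xi> powr (- \<alpha>) * (norm \<xi> powr (- 4 * H) * ((norm \<xi>)\<^sup>2 * \<rho>\<^sup>2))"
            using m2 by (intro mult_left_mono mult_mono) auto
          also have "\<dots> = \<rho>\<^sup>2 * norm \<xi> powr (2 + q)"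
            unfolding n2 q_def by (simp add: powr_diff powr_add powr_minus field_simps)
          finally show ?thesis using 2 by (simp add: add_increasing add_increasing2)
        next
          case 3
          have "norm \<xi> powr (- \<alpha>) * (?m * ?k) \<le> norm \<xi> powr (- \<alpha>) * (norm \<xi> powr (- 4 * H) * 1)"
            using m2 by (intro mult_left_mono mult_mono) auto
          also have "\<dots> = norm \<xi> powr q"
            unfolding q_def by (simp flip: powr_add)
          finally show ?thesis using 3 by (simp add: add_increasing)
        qed
      qed
      then show "ennreal (norm \<xi> powr (- \<alpha>) * (?m * ?k)) \<le> ennreal (T powr (2 * H) * \<rho>\<^sup>2) * ?f1 \<xi> + (ennreal (\<rho>\<^sup>2) * ?f2 \<xi> + ?f3 \<xi>)"
        by (simp flip: ennreal_plus ennreal_mult)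
    qed
    also have "\<dots> = ennreal (T powr (2 * H) * \<rho>\<^sup>2) * (\<integral>\<^sup>+\<xi>. ?f1 \<xi> \<partial>lborel) + (ennreal (\<rho>\<^sup>2) * (\<integral>\<^sup>+\<xi>. ?f2 \<xi> \<partial>lborel) + (\<integral>\<^sup>+\<xi>. ?f3 \<xi> \<partial>lborel))"
      by (simp add: nn_integral_add nn_integral_cmult)
    also have "\<dots> \<le> ennreal (T powr (2 * H) * \<rho>\<^sup>2) * ennreal (?v * ((1 / D) powr (2 - \<alpha> + ?d) / (2 - \<alpha> + ?d)))
       + (ennreal (\<rho>\<^sup>2) * ennreal (C2 * (modulus D \<gamma> \<rho> / \<rho>\<^sup>2)) + ennreal (?v * ((1 / \<rho>) powr (q + ?d) / - (q + ?d))))"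
    proof (intro add_mono mult_left_mono C2 \<rho>)
      show "(\<integral>\<^sup>+\<xi>. ?f1 \<xi> \<partial>lborel) \<le> ennreal (?v * ((1 / D) powr (2 - \<alpha> + ?d) / (2 - \<alpha> + ?d)))"
        using \<alpha> D by (subst nn_integral_norm_powr_near) auto
      show "(\<integral>\<^sup>+\<xi>. ?f3 \<xi> \<partial>lborel) \<le> ennreal (?v * ((1 / \<rho>) powr (q + ?d) / - (q + ?d)))"
        using \<gamma> q \<rho> by (subst nn_integral_norm_powr_far) auto
    qed auto
    also have "\<dots> = ennreal (A1 * \<rho> powr 2 + C2 * modulus D \<gamma> \<rho> + ?v / \<gamma> * \<rho> powr \<gamma>)"
    proof -
      have "(1 / \<rho>) powr (q + ?d) / - (q + ?d) = \<rho> powr \<gamma> / \<gamma>"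
        using \<rho> by (simp add: q powr_minus powr_divide field_simps)
      then have "ennreal (?v * ((1 / \<rho>) powr (q + ?d) / - (q + ?d))) = ennreal (?v / \<gamma> * \<rho> powr \<gamma>)" by simp
      moreover have "ennreal (T powr (2 * H) * \<rho>\<^sup>2) * ennreal (?v * ((1 / D) powr (2 - \<alpha> + ?d) / (2 - \<alpha> + ?d))) = ennreal (A1 * \<rho> powr 2)"
        using \<rho> by (subst ennreal_mult'[symmetric]) (auto simp: A1_def powr_numeral mult_ac)
      moreover have "ennreal (\<rho>\<^sup>2) * ennreal (C2 * (modulus D \<gamma> \<rho> / \<rho>\<^sup>2)) = ennreal (C2 * modulus D \<gamma> \<rho>)"
        using \<rho> by (subst ennreal_mult'[symmetric]) auto
      moreover have "0 \<le> A1 * \<rho> powr 2" "0 \<le> C2 * modulus D \<gamma> \<rho>" "0 \<le> ?v / \<gamma> * \<rho> powr \<gamma>"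
        using A1 \<gamma> v C2(1) m0 by auto
      ultimately show ?thesis by (simp only: ennreal_plus add_nonneg_nonneg add.assoc)
    qed
    also have "\<dots> \<le> ennreal (C * modulus D \<gamma> \<rho>)"
    proof (rule ennreal_leI)
      have "A1 * \<rho> powr 2 \<le> A1 * (D powr (2 - min 2 \<gamma>) * modulus D \<gamma> \<rho>)"
        using \<rho> A1 by (intro mult_left_mono powr_le_modulus) auto
      moreover have "?v / \<gamma> * \<rho> powr \<gamma> \<le> ?v / \<gamma> * (D powr (\<gamma> - min 2 \<gamma>) * modulus D \<gamma> \<rho>)"
        using \<rho> \<gamma> v by (intro mult_left_mono powr_le_modulus) auto
      ultimately show "A1 * \<rho> powr 2 + C2 * modulus D \<gamma> \<rho> + ?v / \<gamma> * \<rho> powr \<gamma> \<le> C * modulus D \<gamma> \<rho>"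
        unfolding C_def distrib_right mult.assoc by linarith
    qed
    finally show ?thesis .
  qed
  with C show ?thesis by blast
qed

theorem theorem4p1:
  fixes \<alpha> H T t0 M k1 k2 :: real
  assumes "0 < T" "1 / 2 < H" "H < 1"
    and "0 \<le> \<alpha>" "\<alpha> < real CARD('n::finite)" "real CARD('n) - \<alpha> < 4 * H"
    and "0 < k1" "k1 \<le> k2"
    and "0 < M" "0 < t0" "t0 \<le> T"
  shows "\<exists>c5 > 0. \<exists>c6 > 0.
    \<forall>(\<Lambda> :: (real ^ 'n) measure) \<mu> (P :: 'w measure) W u.
      spatial_correlation \<alpha> \<Lambda> \<and> spectral_measure \<Lambda> \<mu> \<and> riesz_comparable \<alpha> k1 k2 \<mu> \<and>
      prob_space P \<and> gaussian_noise P T H \<Lambda> W \<and> heat_solution P T H \<Lambda> W u \<longrightarrow>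
      (\<forall>t \<in> {t0..T}. \<forall>s \<in> {t0..T}. \<forall>x y.
         (\<forall>i. x $ i \<in> {-M..M}) \<longrightarrow> (\<forall>i. y $ i \<in> {-M..M}) \<longrightarrow>
         c5 * \<Theta> H \<alpha> M t s x y \<le> (L2_norm P (\<lambda>\<omega>. u t x \<omega> - u s y \<omega>))\<^sup>2) \<and>
      (\<forall>t \<in> {0..T}. \<forall>s \<in> {0..T}. \<forall>x y.
         (\<forall>i. x $ i \<in> {-M..M}) \<longrightarrow> (\<forall>i. y $ i \<in> {-M..M}) \<longrightarrow>
         (L2_norm P (\<lambda>\<omega>. u t x \<omega> - u s y \<omega>))\<^sup>2 \<le> c6 * \<Theta> H \<alpha> M t s x y)"
proof -
  let ?d = "real CARD('n)"
  define \<gamma> where "\<gamma> = 4 * H - (?d - \<alpha>)"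
  define D where "D = 2 * sqrt ?d * M"
  define e where "e = 2 * H - (?d - \<alpha>) / 2"
  define cH where "cH = H * (2 * H - 1)"
  have D: "0 < D" and \<gamma>: "0 < \<gamma>" and cH: "0 < cH" and k2: "0 < k2" using assms by (auto simp: D_def \<gamma>_def cH_def)
  obtain C1 where C1: "C1 > 0" "\<And>\<mu> :: (real ^ 'n) measure. riesz_comparable \<alpha> k1 k2 \<mu> \<Longrightarrow> (\<forall>s t. 0 \<le> s \<longrightarrow> s < t \<longrightarrow>
      (\<integral>\<^sup>+ \<xi>. increment_form H t s \<xi> \<partial>\<mu>) \<le> ennreal (C1 * (t - s) powr e))"
    using increment_bound[where 'a="real ^ 'n", of H \<alpha> k2 k1] assms k2 unfolding e_def by auto
  obtain c1 where c1: "c1 > 0" "\<And>\<mu> :: (real ^ 'n) measure. sets \<mu> = sets borel \<Longrightarrow> riesz_comparable \<alpha> k1 k2 \<mu> \<Longrightarrow> (\<forall>s t. 0 \<le> s \<longrightarrow> s < t \<longrightarrow>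
    (\<integral>\<^sup>+ \<xi>. spectral_form H t s \<xi> \<partial>\<mu>) + (\<integral>\<^sup>+ \<xi>. spectral_form H s t \<xi> \<partial>\<mu>) + ennreal (c1 * (t - s) powr e)
     \<le> (\<integral>\<^sup>+ \<xi>. spectral_form H t t \<xi> \<partial>\<mu>) + (\<integral>\<^sup>+ \<xi>. spectral_form H s s \<xi> \<partial>\<mu>))"
    using increment_lower_bound[where 'a="real ^ 'n", of H \<alpha> k1 k2] assms unfolding e_def by auto
  obtain C2 where C2: "C2 > 0" "\<And>\<mu> :: (real ^ 'n) measure. riesz_comparable \<alpha> k1 k2 \<mu> \<Longrightarrow> (\<forall>s h. s \<in> {0..T} \<longrightarrow> h \<noteq> 0 \<longrightarrow> norm h \<le> D \<longrightarrow>
    (\<integral>\<^sup>+ \<xi>. spectral_form H s s \<xi> * ennreal (1 - cos (\<xi> \<bullet> h)) \<partial>\<mu>) \<le> ennreal (C2 * modulus D \<gamma> (norm h)))"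
    using spatial_bound[where 'a="real ^ 'n", of H \<alpha> \<gamma> k2 T D k1] assms k2 D \<gamma> by (auto simp: \<gamma>_def)
  obtain c2 where c2: "c2 > 0" "\<And>\<mu> :: (real ^ 'n) measure. riesz_comparable \<alpha> k1 k2 \<mu> \<Longrightarrow> (\<forall>s h. t0 \<le> s \<longrightarrow> h \<noteq> 0 \<longrightarrow> norm h \<le> D \<longrightarrow>
    ennreal (c2 * modulus D \<gamma> (norm h)) \<le> (\<integral>\<^sup>+ \<xi>. spectral_form H s s \<xi> * ennreal (1 - cos (\<xi> \<bullet> h)) \<partial>\<mu>))"
    using spatial_lower_bound[where 'a="real ^ 'n", of H \<alpha> \<gamma> k1 t0 D k2] assms D by (auto simp: \<gamma>_def)
  define m where "m x y = (if x = y then 0 else modulus D \<gamma> (norm (x - y)))" for x y :: "real ^ 'n"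
  have \<Theta>: "\<Theta> H \<alpha> M t s x y = \<bar>t - s\<bar> powr e + m x y" for t s and x y :: "real ^ 'n"
    by (simp add: \<Theta>_def Let_def m_def modulus_def e_def \<gamma>_def D_def mult_ac)
  \<comment> \<open>The increment dominates the temporal and the spatial part of
    \<open>\<Theta>\<close> separately, with the constants under the minimum; the outer half allows
    for their sum. In \<open>c6\<close> each term carries the factor 2 of the squared triangle
    inequality, and the spatial one also the factor 2 of \<open>sq_increment_space\<close>.\<close>
  define c5 where "c5 = min (cH * c1) (cH * c2 / 2) / 2"
  define c6 where "c6 = max (2 * (cH * C1)) (4 * (cH * C2))"
  have c56: "c5 > 0" "c6 > 0" using cH C1 C2 c1 c2 by (auto simp: c5_def c6_def less_max_iff_disj)
  show ?thesis
  proof (rule exI[of _ c5], rule conjI[OF c56(1)], rule exI[of _ c6], rule conjI[OF c56(2)], intro allI impI)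
    fix \<Lambda> :: "(real ^ 'n) measure" and \<mu> and P :: "'w measure" and W u
    assume A: "spatial_correlation \<alpha> \<Lambda> \<and> spectral_measure \<Lambda> \<mu> \<and> riesz_comparable \<alpha> k1 k2 \<mu> \<and>
      prob_space P \<and> gaussian_noise P T H \<Lambda> W \<and> heat_solution P T H \<Lambda> W u"
    then have R: "riesz_comparable \<alpha> k1 k2 \<mu>" by simp
    interpret prob_space P using A by simp
    interpret F: heat_field P T H \<Lambda> W \<mu> u
      by unfold_locales (use A assms in \<open>auto simp: spatial_correlation_def\<close>)
    have sets: "sets \<mu> = sets borel" using A by (simp add: spectral_measure_def tempered_measure_def)
    have cHF: "F.cH = cH" by (simp add: F.cH_def cH_def)
    have m0: "0 \<le> m x y" if "norm (x - y) \<le> D" for x y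
      using modulus_log[of "norm (x - y)" D] that by (simp add: m_def modulus_def)
    have time_up: "F.sq_increment t s x x \<le> cH * (C1 * \<bar>t - s\<bar> powr e)" if "t \<in> {0..T}" "s \<in> {0..T}" for t s x
    proof -
      consider "s < t" | "s = t" | "t < s" by linarith
      then show ?thesis
      proof cases
        case 1
        then show ?thesis using F.sq_increment_time_upper[OF that, of "C1 * (t - s) powr e" x] C1 R that by (simp add: cHF)
      next
        case 2
        then show ?thesis using C1 cH by (simp add: F.sq_increment_def L2_norm_def)
      next
        case 3
        then show ?thesis using F.sq_increment_time_upper[OF that(2,1), of "C1 * (s - t) powr e" x] C1 R that F.sq_increment_commute[of t s x x] by (simp add: cHF)
      qed
    qed
    have time_lo: "cH * (c1 * \<bar>t - s\<bar> powr e) \<le> F.sq_increment t s x x" if "t \<in> {0..T}" "s \<in> {0..T}" for t s x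
    proof -
      consider "s < t" | "s = t" | "t < s" by linarith
      then show ?thesis
      proof cases
        case 1
        then show ?thesis using F.sq_increment_time_lower[OF that, of "c1 * (t - s) powr e" x] c1(1) c1(2)[OF sets R] that by (simp add: cHF)
      next
        case 2
        then show ?thesis by (simp add: F.sq_increment_nonneg)
      next
        case 3
        then show ?thesis using F.sq_increment_time_lower[OF that(2,1), of "c1 * (s - t) powr e" x] c1(1) c1(2)[OF sets R] that F.sq_increment_commute[of t s x x] by (simp add: cHF)
      qed
    qed
    have space_up: "F.sq_increment s s x y \<le> 2 * cH * (C2 * m x y)" if s: "s \<in> {0..T}" and xy: "norm (x - y) \<le> D" for s x y
    proof (cases "x = y")
      case True
      then show ?thesis by (simp add: m_def F.sq_increment_def L2_norm_def)
    next
      case False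
      have "ennreal (F.sq_increment s s x y) \<le> ennreal (2 * cH) * ennreal (C2 * m x y)"
        unfolding F.sq_increment_space[OF s] cHF using C2(2)[OF R] s xy False by (intro mult_left_mono) (auto simp: m_def)
      also have "\<dots> = ennreal (2 * cH * (C2 * m x y))" using cH C2 m0[OF xy] by (simp add: ennreal_mult)
      finally show ?thesis using cH C2 m0[OF xy] by (subst (asm) ennreal_le_iff) auto
    qed
    have space_lo: "2 * cH * (c2 * m x y) \<le> F.sq_increment s s x y" if s: "s \<in> {t0..T}" and xy: "norm (x - y) \<le> D" for s x y
    proof (cases "x = y")
      case True
      then show ?thesis by (simp add: m_def F.sq_increment_nonneg)
    next
      case False
      have s': "s \<in> {0..T}" using s assms by auto
      have "ennreal (2 * cH * (c2 * m x y)) = ennreal (2 * cH) * ennreal (c2 * m x y)" using cH c2 m0[OF xy] by (simp add: ennreal_mult)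
      also have "\<dots> \<le> ennreal (F.sq_increment s s x y)"
        unfolding F.sq_increment_space[OF s'] cHF using c2(2)[OF R] s xy False by (intro mult_left_mono) (auto simp: m_def)
      finally show ?thesis by (simp add: F.sq_increment_nonneg)
    qed
    show "(\<forall>t \<in> {t0..T}. \<forall>s \<in> {t0..T}. \<forall>x y.
         (\<forall>i. x $ i \<in> {-M..M}) \<longrightarrow> (\<forall>i. y $ i \<in> {-M..M}) \<longrightarrow>
         c5 * \<Theta> H \<alpha> M t s x y \<le> (L2_norm P (\<lambda>\<omega>. u t x \<omega> - u s y \<omega>))\<^sup>2) \<and>
      (\<forall>t \<in> {0..T}. \<forall>s \<in> {0..T}. \<forall>x y.
         (\<forall>i. x $ i \<in> {-M..M}) \<longrightarrow> (\<forall>i. y $ i \<in> {-M..M}) \<longrightarrow>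
         (L2_norm P (\<lambda>\<omega>. u t x \<omega> - u s y \<omega>))\<^sup>2 \<le> c6 * \<Theta> H \<alpha> M t s x y)"
    proof (intro conjI ballI allI impI)
      fix t s and x y :: "real ^ 'n"
      assume t: "t \<in> {t0..T}" and s: "s \<in> {t0..T}" and "\<forall>i. x $ i \<in> {-M..M}" "\<forall>i. y $ i \<in> {-M..M}"
      then have xy: "norm (x - y) \<le> D" unfolding D_def by (intro norm_diff_le_cube)
      have t': "t \<in> {0..T}" and s': "s \<in> {0..T}" using t s assms by auto
      let ?N = "F.sq_increment t s x y"
      have "F.sq_increment t s x x \<le> ?N" by (rule F.sq_increment_time_le[OF t' s'])
      then have 1: "cH * c1 * \<bar>t - s\<bar> powr e \<le> ?N" using time_lo[OF t' s', of x] by (simp add: mult.assoc)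
      \<comment> \<open>The path from (s, x) via (t, x) to (s, y): its first leg is a temporal
        increment and thus already below the full one, so the spatial increment is at most 4
        \<open>?N\<close>.\<close>
      have "F.sq_increment s s x y \<le> 2 * F.sq_increment s t x x + 2 * ?N"
        by (rule F.sq_increment_triangle[OF s' s' t'])
      also have "\<dots> \<le> 4 * ?N" using \<open>F.sq_increment t s x x \<le> ?N\<close> F.sq_increment_commute[of s t x x] by simp
      finally have 2: "cH * c2 / 2 * m x y \<le> ?N" using space_lo[OF s xy] by (simp add: mult.assoc)
      have "c5 * \<bar>t - s\<bar> powr e \<le> (cH * c1 / 2) * \<bar>t - s\<bar> powr e" by (intro mult_right_mono) (auto simp: c5_def)
      moreover have "c5 * m x y \<le> (cH * c2 / 2 / 2) * m x y" using m0[OF xy] by (intro mult_right_mono) (auto simp: c5_def)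
      ultimately have "c5 * \<Theta> H \<alpha> M t s x y \<le> ?N" using 1 2 unfolding \<Theta> distrib_left by (simp add: field_simps)
      then show "c5 * \<Theta> H \<alpha> M t s x y \<le> (L2_norm P (\<lambda>\<omega>. u t x \<omega> - u s y \<omega>))\<^sup>2"
        by (simp add: F.sq_increment_def)
    next
      fix t s and x y :: "real ^ 'n"
      assume t: "t \<in> {0..T}" and s: "s \<in> {0..T}" and "\<forall>i. x $ i \<in> {-M..M}" "\<forall>i. y $ i \<in> {-M..M}"
      then have xy: "norm (x - y) \<le> D" unfolding D_def by (intro norm_diff_le_cube)
      \<comment> \<open>The path from (t, x) via (s, x) to (s, y). Both legs have upper bounds valid
        from time 0 on, hence the larger range of times.\<close>
      have "F.sq_increment t s x y \<le> 2 * F.sq_increment t s x x + 2 * F.sq_increment s s x y"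
        by (rule F.sq_increment_triangle[OF t s s])
      also have "\<dots> \<le> 2 * (cH * (C1 * \<bar>t - s\<bar> powr e)) + 2 * (2 * cH * (C2 * m x y))"
        by (intro add_mono mult_left_mono time_up space_up t s xy) auto
      also have "\<dots> = 2 * (cH * C1) * \<bar>t - s\<bar> powr e + 4 * (cH * C2) * m x y" by simp
      also have "\<dots> \<le> c6 * \<bar>t - s\<bar> powr e + c6 * m x y"
        using m0[OF xy] by (intro add_mono mult_right_mono) (auto simp: c6_def)
      also have "\<dots> = c6 * \<Theta> H \<alpha> M t s x y" unfolding \<Theta> by (simp add: distrib_left)
      finally show "(L2_norm P (\<lambda>\<omega>. u t x \<omega> - u s y \<omega>))\<^sup>2 \<le> c6 * \<Theta> H \<alpha> M t s x y"
        by (simp add: F.sq_increment_def)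
    qed
  qed
qed

end
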